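(* Let $P\in\mathcal W$ and let $\Gamma$ be a $\pi_{\mathsf S}$ context and $l$ a level function such that $\Gamma\vdash_{\mathsf s}P$ and $[\![\Gamma]\!]^l\vdash_{\mathsf w}[\![P]\!]$. If $[\![P]\!]\xrightarrow{\tau}U$, then there exist $R,Q\in\mathcal W$ such that $P\longrightarrow Q$, $R\equiv Q$ and $U=[\![R]\!]$.
   Context: Session calculus $\pi_{\mathsf S}$. Names (variables) $x,y,z,\dots$; values are names. Processes: $P,Q ::= \overline x\langle v\rangle.P \mid q\,x(y).P$ with $q\in\{\mathsf{lin},\mathsf{un}\}$ (linear/unrestricted input, $y$ bound) $\mid P\mid Q\mid (\nu xy)P$ (restriction binding co-variables $x,y$) $\mid\mathbf 0$. Structural congruence $\equiv$: $\mid$ commutative, associative, unit $\mathbf 0$; $(\nu xy)\mathbf 0\equiv\mathbf 0$; $(\nu xy)(\nu zw)P\equiv(\nu zw)(\nu xy)P$; $(\nu xy)P\equiv(\nu yx)P$; $((\nu xy)P)\mid Q\equiv(\nu xy)(P\mid Q)$ if $x,y\notin\mathrm{fv}(Q)$. Reduction: $(\nu xy)(\overline x\langle v\rangle.P\mid \mathsf{lin}\,y(z).Q\mid R)\longrightarrow(\nu xy)(P\mid Q\{v/z\}\mid R)$; $(\nu xy)(\overline x\langle v\rangle.P\mid\mathsf{un}\,y(z).Q\mid R)\longrightarrow(\nu xy)(P\mid Q\{v/z\}\mid \mathsf{un}\,y(z).Q\mid R)$; closed under $\mid$, restriction and $\equiv$. Session types: $T,S ::= \mathbf{end}\mid q\,p\mid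 a\mid \mu a.T$, $p::= ?T.S\mid !T.S$ (receive/send); recursive types contractive and equi-recursive; only tail-recursive ones are used: server type $\ast?T:=\mu a.\mathsf{un}\,?T.a$ and client type $\ast!T:=\mu a.\mathsf{un}\,!T.a$ ($a$ not in $T$). Duality: $\overline{\mathbf{end}}=\mathbf{end}$, $\overline{q\,p}=q\,\overline p$, $\overline{!T.S}=?T.\overline S$, $\overline{?T.S}=!T.\overline S$, $\overline{\ast?T}=\ast!T$, $\overline{\ast!T}=\ast?T$. $\mathrm{un}(T)$ iff $T=\mathbf{end}$ or $T=\mathsf{un}\,p$; $\mathrm{lin}(T)$ always; $q(\Gamma)$ iff $q(T)$ for every $x:T\in\Gamma$. Split: $\emptyset=\emptyset\circ\emptyset$; given $\Gamma=\Gamma_1\circ\Gamma_2$: if $\mathrm{un}(T)$, $\Gamma,x:T=(\Gamma_1,x:T)\circ(\Gamma_2,x:T)$; $\Gamma,x:\mathsf{lin}\,p=(\Gamma_1,x:\mathsf{lin}\,p)\circ\Gamma_2=\Gamma_1\circ(\Gamma_2,x:\mathsf{lin}\,p)$. Update: $\Gamma+x:T=\Gamma,x:T$ if $x\notin\mathrm{dom}(\Gamma)$; $(\Gamma,x:T)+x:T=\Gamma,x:T$ if $\mathrm{un}(T)$. Typing rules: Var: $\mathrm{un}(\Gamma)\Rightarrow\Gamma,x:T\vdash_{\mathsf s}x:T$; Nil: $\mathrm{un}(\Gamma)\Rightarrow\Gamma\vdash_{\mathsf s}\mathbf 0$; Par: $\Gamma_1\vdash_{\mathsf s}P,\Gamma_2\vdash_{\mathsf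 s}Q\Rightarrow\Gamma_1\circ\Gamma_2\vdash_{\mathsf s}P\mid Q$; Res: $\Gamma,x:T,y:\overline T\vdash_{\mathsf s}P\Rightarrow\Gamma\vdash_{\mathsf s}(\nu xy)P$; In: $q_1(\Gamma_1\circ\Gamma_2)$, $\Gamma_1\vdash_{\mathsf s}x:q_2\,?T.S$, $(\Gamma_2+x:S),y:T\vdash_{\mathsf s}P\Rightarrow\Gamma_1\circ\Gamma_2\vdash_{\mathsf s}q_1\,x(y).P$; Out: $\Gamma_1\vdash_{\mathsf s}x:q\,!T.S$, $\Gamma_2\vdash_{\mathsf s}v:T$, $\Gamma_3+x:S\vdash_{\mathsf s}P\Rightarrow\Gamma_1\circ\Gamma_2\circ\Gamma_3\vdash_{\mathsf s}\overline x\langle v\rangle.P$. The calculus $\pi_{\mathsf W}$: processes $P ::= \overline{x}\langle y_1,y_2\rangle.P\mid x(y_1,y_2).P\mid\ !x(y_1,y_2).P\mid P\mid Q\mid(\nu x)P\mid\mathbf 0$; standard early LTS with $\tau$-transitions arising from an output (possibly bound, with scope extrusion) synchronizing with a linear input $x(\tilde y).P\xrightarrow{x(\tilde v)}P\{\tilde v/\tilde y\}$ or a replicated input $!x(\tilde y).P\xrightarrow{x(\tilde v)}!x(\tilde y).P\mid P\{\tilde v/\tilde y\}$, closed under parallel composition and restriction. Types: $V::=\mathsf i^n[V_1,V_2]\mid\mathsf o^n[V_1,V_2]\mid\mathsf S^n[V]\mid\mathsf C^n[V]\mid\mathbf{unit}$ (linear input, linear output, server, client, unit; $n\ge1$ a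 weight); duality swaps $\mathsf i/\mathsf o$ and $\mathsf S/\mathsf C$ componentwise, $\overline{\mathbf{unit}}=\mathbf{unit}$. Contexts contain $x:V$ or $x::V$ (the latter meaning $x:(V,\overline V)$). $\mathrm{un}$ holds for $\mathsf S^n,\mathsf C^n,\mathbf{unit}$ and for $x::V$ with $\mathrm{un}(V)$. Split: unrestricted entries are copied to both sides; a linear $x:T$ goes to exactly one side; a linear $x::V$ goes entirely to one side or is split as $x:V$ and $x:\overline V$. Level function $l$: names $\to\mathbb N$, $l(x)$ is the weight of $x$'s type (arbitrary for $\mathbf{unit}$). $\mathrm{os}(\overline x\langle\tilde y\rangle.P)=\{x\}\cup\mathrm{os}(P)$, $\mathrm{os}(x(\tilde y).P)=\mathrm{os}(P)$, $\mathrm{os}(P\mid Q)=\mathrm{os}(P)\cup\mathrm{os}(Q)$, $\mathrm{os}((\nu x)P)=\mathrm{os}(P)$, $\mathrm{os}(\mathbf 0)=\mathrm{os}(!x(\tilde y).P)=\emptyset$. Typing rules: Var$_{1,2}$: $\mathrm{un}(\Gamma)\Rightarrow\Gamma,x:V\vdash x:V$ and $\Gamma,x::V\vdash x:V$; Nil: $\mathrm{un}(\Gamma)\Rightarrow\Gamma\vdash\mathbf 0$; Par: $\Gamma_1\vdash P,\Gamma_2\vdash Q\Rightarrow\Gamma_1\circ\Gamma_2\vdash P\mid Q$; Res: $\Gamma,x::V\vdash P\Rightarrow\Gamma\vdash(\nu x)P$; Lin-In$_1$: $\Gamma_1,x:\mathsf i^n[V_1,V_2]\vdash x:\mathsf i^n[V_1,V_2]$,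 $\Gamma_2,y_1:V_1,y_2:V_2\vdash P$, $l(x)=l(y_2)\Rightarrow(\Gamma_1,x:\mathsf i^n[V_1,V_2])\circ\Gamma_2\vdash x(y_1,y_2).P$; Lin-In$_2$: $\Gamma_1,x:\mathsf S^n[V]\vdash x:\mathsf S^n[V]$, $\Gamma_2,x:\mathsf S^n[V],y_1:V,y_2:\mathbf{unit}\vdash P\Rightarrow(\Gamma_1,x:\mathsf S^n[V])\circ(\Gamma_2,x:\mathsf S^n[V])\vdash x(y_1,y_2).P$; Lin-In$_3$: as Lin-In$_2$ with $x::\mathsf S^n[V]$ in a single shared $\Gamma$; Lin-Out: $\Gamma_1,x:\mathsf o^n[V_1,V_2]\vdash x:\mathsf o^n[V_1,V_2]$, $\Gamma_2,y_1:V_1\vdash y_1:V_1$, $\Gamma_3,y_2:V_2\vdash P$, $l(x)=l(y_2)\Rightarrow(\Gamma_1,x:\mathsf o^n[V_1,V_2])\circ(\Gamma_2,y_1:V_1)\circ(\Gamma_3,y_2::V_2)\vdash\overline x\langle y_1,y_2\rangle.P$; Un-Out$_{1,2}$: $\Gamma_1,x\diamond\mathsf C^n[V]\vdash x:\mathsf C^n[V]$, $\Gamma_2,x\diamond\mathsf C^n[V],y_1:V\vdash y_1:V$, $\Gamma_3,x\diamond\mathsf C^n[V],y_2:\mathbf{unit}\vdash P\Rightarrow(\Gamma_1,x\diamond\mathsf C^n[V])\circ(\Gamma_2,x\diamond\mathsf C^n[V],y_1:V)\circ(\Gamma_3,x\diamond\mathsf C^n[V])\vdash\overline x\langle y_1,y_2\rangle.P$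 with $\diamond\in\{:,::\}$; Un-In$_{1,2}$: $\Gamma,x\diamond\mathsf S^n[V]\vdash x:\mathsf S^n[V]$, $\Gamma,x\diamond\mathsf S^n[V],y_1:V,y_2:\mathbf{unit}\vdash P$, $l(b)<n$ for all $b\in\mathrm{os}(P)\Rightarrow\Gamma,x\diamond\mathsf S^n[V]\vdash\ !x(y_1,y_2).P$. Translation $[\![\cdot]\!]:\pi_{\mathsf S}\to\pi_{\mathsf W}$, relative to the $\pi_{\mathsf S}$ typing (cases by the type of $x$; $z$ fresh): $[\![\mathbf 0]\!]=\mathbf 0$; $[\![P\mid Q]\!]=[\![P]\!]\mid[\![Q]\!]$; $[\![(\nu xy)P]\!]=(\nu z)[\![P\{z/x\}\{z/y\}]\!]$; $[\![\mathsf{lin}\,x(y).P]\!]=x(y,z).[\![P\{z/x\}]\!]$ if $x:\mathsf{lin}\,?T.S$, and $x(y,z).[\![P]\!]$ if $x:\ast?T$; $[\![\mathsf{un}\,x(y).P]\!]=\ !x(y,z).[\![P]\!]$; $[\![\overline x\langle y\rangle.P]\!]=(\nu z)\overline x\langle y,z\rangle.[\![P\{z/x\}]\!]$ if $x:\mathsf{lin}\,!T.S$, and $\overline x\langle y,z\rangle.[\![P]\!]$ if $x:\ast!T$. Types, relative to $l$: $[\![\mathbf{end}]\!]^l_x=\mathbf{unit}$; $[\![\mathsf{lin}\,?T.S]\!]^l_x=\mathsf i^{l(x)}[[\![T]\!]^l_\alpha,[\![S]\!]^l_x]$; $[\![\mathsf{lin}\,!T.S]\!]^l_x=\mathsf o^{l(x)}[[\![T]\!]^l_\beta,[\![S]\!]^l_x]$;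 $[\![\ast?T]\!]^l_x=\mathsf S^{l(x)}[[\![T]\!]^l_\gamma]$; $[\![\ast!T]\!]^l_x=\mathsf C^{l(x)}[[\![T]\!]^l_\gamma]$, with $\alpha,\beta,\gamma$ auxiliary names (the names that occupy the corresponding positions). $[\![x_1:T_1,\dots,x_n:T_n]\!]^l=x_1:[\![T_1]\!]^l_{x_1},\dots,x_n:[\![T_n]\!]^l_{x_n}$. $[\![\Gamma]\!]^l\vdash_{\mathsf w}[\![P]\!]$ means this judgment is derivable in $\pi_{\mathsf W}$ with level function $l$. $\mathcal W:=\{P\in\pi_{\mathsf S}:\exists\Gamma,l.\ \Gamma\vdash_{\mathsf s}P\text{ and }[\![\Gamma]\!]^l\vdash_{\mathsf w}[\![P]\!]\}$.
   Formalization: False with the literal rules, so 𝒲 uses mended π_W typing: Lin-In₃ splits its context as Lin-In₂ does; outputs may also send y₁::V₁ when V₁ is unrestricted; duality keeps the payload type; x::V and x::V̄ are the same entry. *)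

theory Defs
  imports Main
begin

text \<open>
  Both calculi are in de Bruijn style: names are natural numbers, an index below the
  number of enclosing binders is bound, and alpha-equivalent processes are equal.  In a context
  for the body of a binder the bound names come first, the names of the outer context are shifted.
\<close>

type_synonym name = nat

primrec up :: "(name \<Rightarrow> name) \<Rightarrow> name \<Rightarrow> name" where
  "up f 0 = 0"
| "up f (Suc n) = Suc (f n)"

definition ext :: "'a \<Rightarrow> (name \<Rightarrow> 'a option) \<Rightarrow> name \<Rightarrow> 'a option" where
  "ext a \<Gamma> = case_nat (Some a) \<Gamma>"


section \<open>The session calculus\<close>

datatype qual = QLin | QUn
datatype pol = Recv | Send

text \<open>
  \<open>SOut x v P\<close> is the output of \<open>v\<close> on \<open>x\<close>; \<open>SIn q x P\<close> is \<open>q x(y).P\<close> with \<open>y\<close> the index 0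
  of \<open>P\<close>; \<open>SRes P\<close> is \<open>(\<nu>xy)P\<close> with \<open>x\<close>, \<open>y\<close> the indices 0, 1 of \<open>P\<close>.
\<close>
datatype sproc =
    SNil
  | SOut name name sproc
  | SIn qual name sproc
  | SPar sproc sproc
  | SRes sproc

primrec sren :: "(name \<Rightarrow> name) \<Rightarrow> sproc \<Rightarrow> sproc" where
  "sren f SNil = SNil"
| "sren f (SOut x v P) = SOut (f x) (f v) (sren f P)"
| "sren f (SIn q x P) = SIn q (f x) (sren (up f) P)"
| "sren f (SPar P Q) = SPar (sren f P) (sren f Q)"
| "sren f (SRes P) = SRes (sren (up (up f)) P)"

definition swap_co :: "name \<Rightarrow> name" where
  "swap_co = id(0 := 1, 1 := 0)"

definition swap_res :: "name \<Rightarrow> name" where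
  "swap_res = id(0 := 2, 1 := 3, 2 := 0, 3 := 1)"

inductive scong :: "sproc \<Rightarrow> sproc \<Rightarrow> bool" (infix \<open>\<equiv>\<^sub>s\<close> 50) where
  sc_refl: "P \<equiv>\<^sub>s P"
| sc_sym: "P \<equiv>\<^sub>s Q \<Longrightarrow> Q \<equiv>\<^sub>s P"
| sc_trans: "P \<equiv>\<^sub>s Q \<Longrightarrow> Q \<equiv>\<^sub>s R \<Longrightarrow> P \<equiv>\<^sub>s R"
| sc_out: "P \<equiv>\<^sub>s P' \<Longrightarrow> SOut x v P \<equiv>\<^sub>s SOut x v P'"
| sc_in: "P \<equiv>\<^sub>s P' \<Longrightarrow> SIn q x P \<equiv>\<^sub>s SIn q x P'"
| sc_par: "P \<equiv>\<^sub>s P' \<Longrightarrow> Q \<equiv>\<^sub>s Q' \<Longrightarrow> SPar P Q \<equiv>\<^sub>s SPar P' Q'"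
| sc_res: "P \<equiv>\<^sub>s P' \<Longrightarrow> SRes P \<equiv>\<^sub>s SRes P'"
| sc_par_comm: "SPar P Q \<equiv>\<^sub>s SPar Q P"
| sc_par_assoc: "SPar (SPar P Q) R \<equiv>\<^sub>s SPar P (SPar Q R)"
| sc_par_unit: "SPar P SNil \<equiv>\<^sub>s P"
| sc_res_nil: "SRes SNil \<equiv>\<^sub>s SNil"
| sc_res_swap: "SRes (SRes P) \<equiv>\<^sub>s SRes (SRes (sren swap_res P))"
| sc_res_co: "SRes P \<equiv>\<^sub>s SRes (sren swap_co P)"
| sc_res_ext: "SPar (SRes P) Q \<equiv>\<^sub>s SRes (SPar P (sren (\<lambda>n. n + 2) Q))"

inductive sred :: "sproc \<Rightarrow> sproc \<Rightarrow> bool" (infix \<open>\<longrightarrow>\<^sub>s\<close> 50) where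
  sr_lin: "SRes (SPar (SPar (SOut 0 v P) (SIn QLin 1 Q)) R) \<longrightarrow>\<^sub>s
           SRes (SPar (SPar P (sren (case_nat v id) Q)) R)"
| sr_un: "SRes (SPar (SPar (SOut 0 v P) (SIn QUn 1 Q)) R) \<longrightarrow>\<^sub>s
          SRes (SPar (SPar (SPar P (sren (case_nat v id) Q)) (SIn QUn 1 Q)) R)"
| sr_par: "P \<longrightarrow>\<^sub>s P' \<Longrightarrow> SPar P Q \<longrightarrow>\<^sub>s SPar P' Q"
| sr_res: "P \<longrightarrow>\<^sub>s P' \<Longrightarrow> SRes P \<longrightarrow>\<^sub>s SRes P'"
| sr_cong: "P \<equiv>\<^sub>s P' \<Longrightarrow> P' \<longrightarrow>\<^sub>s Q' \<Longrightarrow> Q' \<equiv>\<^sub>s Q \<Longrightarrow> P \<longrightarrow>\<^sub>s Q"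

text \<open>
  Equi-recursive contractive types are represented by their infinite unfoldings, so that
  a recursive type and its unfolding are equal.  \<open>SPre q Recv T S\<close> is \<open>q ?T.S\<close>.
\<close>
codatatype stype = SEnd | SPre qual pol stype stype

primrec flip :: "pol \<Rightarrow> pol" where
  "flip Recv = Send"
| "flip Send = Recv"

primcorec sdual :: "stype \<Rightarrow> stype" where
  "sdual T = (case T of SEnd \<Rightarrow> SEnd | SPre q p T1 S \<Rightarrow> SPre q (flip p) T1 (sdual S))"

text \<open>\<open>star Recv T\<close> is the server type \<open>*?T\<close>, \<open>star Send T\<close> the client type \<open>*!T\<close>.\<close>
primcorec star :: "pol \<Rightarrow> stype \<Rightarrow> stype" where
  "star p T = SPre QUn p T (star p T)"

text \<open>The types of the grammar in which all recursion is tail-recursive.\<close>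
inductive session_type :: "stype \<Rightarrow> bool" where
  "session_type SEnd"
| "session_type T \<Longrightarrow> session_type S \<Longrightarrow> session_type (SPre q p T S)"
| "session_type T \<Longrightarrow> session_type (star p T)"

type_synonym sctx = "name \<Rightarrow> stype option"

definition session_ctx :: "sctx \<Rightarrow> bool" where
  "session_ctx \<Gamma> \<longleftrightarrow> finite (dom \<Gamma>) \<and> (\<forall>T\<in>ran \<Gamma>. session_type T)"

definition s_un :: "stype \<Rightarrow> bool" where
  "s_un T \<longleftrightarrow> T = SEnd \<or> (\<exists>p T1 S. T = SPre QUn p T1 S)"

definition s_qual_ctx :: "qual \<Rightarrow> sctx \<Rightarrow> bool" where
  "s_qual_ctx q \<Gamma> \<longleftrightarrow> (q = QUn \<longrightarrow> (\<forall>T\<in>ran \<Gamma>. s_un T))"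

inductive s_split_entry :: "stype option \<Rightarrow> stype option \<Rightarrow> stype option \<Rightarrow> bool" where
  "s_split_entry None None None"
| "s_un T \<Longrightarrow> s_split_entry (Some T) (Some T) (Some T)"
| "s_split_entry (Some (SPre QLin p T S)) (Some (SPre QLin p T S)) None"
| "s_split_entry (Some (SPre QLin p T S)) None (Some (SPre QLin p T S))"

definition s_split :: "sctx \<Rightarrow> sctx \<Rightarrow> sctx \<Rightarrow> bool" where
  "s_split \<Gamma> \<Gamma>1 \<Gamma>2 \<longleftrightarrow> (\<forall>x. s_split_entry (\<Gamma> x) (\<Gamma>1 x) (\<Gamma>2 x))"

text \<open>\<open>\<Gamma> + x:S\<close> is defined iff \<open>s_upd_ok \<Gamma> x S\<close>, and is then \<open>\<Gamma>(x \<mapsto> S)\<close>.\<close>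
definition s_upd_ok :: "sctx \<Rightarrow> name \<Rightarrow> stype \<Rightarrow> bool" where
  "s_upd_ok \<Gamma> x S \<longleftrightarrow> x \<notin> dom \<Gamma> \<or> (\<Gamma> x = Some S \<and> s_un S)"

definition s_var :: "sctx \<Rightarrow> name \<Rightarrow> stype \<Rightarrow> bool" where
  "s_var \<Gamma> x T \<longleftrightarrow> \<Gamma> x = Some T \<and> s_qual_ctx QUn (\<Gamma>(x := None))"

inductive styped :: "sctx \<Rightarrow> sproc \<Rightarrow> bool" (infix \<open>\<turnstile>\<^sub>s\<close> 50) where
  st_nil: "s_qual_ctx QUn \<Gamma> \<Longrightarrow> \<Gamma> \<turnstile>\<^sub>s SNil"
| st_par: "s_split \<Gamma> \<Gamma>1 \<Gamma>2 \<Longrightarrow> \<Gamma>1 \<turnstile>\<^sub>s P \<Longrightarrow> \<Gamma>2 \<turnstile>\<^sub>s Q \<Longrightarrow> \<Gamma> \<turnstile>\<^sub>s SPar P Q"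
| st_res: "session_type T \<Longrightarrow> ext T (ext (sdual T) \<Gamma>) \<turnstile>\<^sub>s P \<Longrightarrow> \<Gamma> \<turnstile>\<^sub>s SRes P"
| st_in: "s_split \<Gamma> \<Gamma>1 \<Gamma>2 \<Longrightarrow> s_qual_ctx q1 \<Gamma> \<Longrightarrow> s_var \<Gamma>1 x (SPre q2 Recv T S) \<Longrightarrow>
          s_upd_ok \<Gamma>2 x S \<Longrightarrow> ext T (\<Gamma>2(x \<mapsto> S)) \<turnstile>\<^sub>s P \<Longrightarrow> \<Gamma> \<turnstile>\<^sub>s SIn q1 x P"
| st_out: "s_split \<Gamma> \<Gamma>1 \<Gamma>' \<Longrightarrow> s_split \<Gamma>' \<Gamma>2 \<Gamma>3 \<Longrightarrow> s_var \<Gamma>1 x (SPre q Send T S) \<Longrightarrow>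
          s_var \<Gamma>2 v T \<Longrightarrow> s_upd_ok \<Gamma>3 x S \<Longrightarrow> \<Gamma>3(x \<mapsto> S) \<turnstile>\<^sub>s P \<Longrightarrow> \<Gamma> \<turnstile>\<^sub>s SOut x v P"


section \<open>The calculus with weights\<close>

text \<open>
  \<open>WIn x P\<close> is \<open>x(y1,y2).P\<close> and \<open>WRep x P\<close> is \<open>!x(y1,y2).P\<close>, with \<open>y1\<close>, \<open>y2\<close> the indices
  0, 1 of \<open>P\<close>; \<open>WNu P\<close> binds the index 0 of \<open>P\<close>.
\<close>
datatype wproc =
    WNil
  | WOut name name name wproc
  | WIn name wproc
  | WRep name wproc
  | WPar wproc wproc
  | WNu wproc

primrec wren :: "(name \<Rightarrow> name) \<Rightarrow> wproc \<Rightarrow> wproc" where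
  "wren f WNil = WNil"
| "wren f (WOut x y1 y2 P) = WOut (f x) (f y1) (f y2) (wren f P)"
| "wren f (WIn x P) = WIn (f x) (wren (up (up f)) P)"
| "wren f (WRep x P) = WRep (f x) (wren (up (up f)) P)"
| "wren f (WPar P Q) = WPar (wren f P) (wren f Q)"
| "wren f (WNu P) = WNu (wren (up f) P)"

primrec wfn :: "wproc \<Rightarrow> name set" where
  "wfn WNil = {}"
| "wfn (WOut x y1 y2 P) = {x, y1, y2} \<union> wfn P"
| "wfn (WIn x P) = insert x {n. Suc (Suc n) \<in> wfn P}"
| "wfn (WRep x P) = insert x {n. Suc (Suc n) \<in> wfn P}"
| "wfn (WPar P Q) = wfn P \<union> wfn Q"
| "wfn (WNu P) = {n. Suc n \<in> wfn P}"

text \<open>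
  \<open>LOut k x y1 y2\<close> is an output that extrudes \<open>k\<close> names (\<open>k = 0\<close> is the free output); these are
  the indices below \<open>k\<close> both of the label and of the residual, all other indices there are shifted
  by \<open>k\<close>.
\<close>
datatype label = Tau | LIn name name name | LOut nat name name name

definition skip :: "nat \<Rightarrow> name \<Rightarrow> name" where
  "skip k n = (if n < k then n else Suc n)"

definition rot :: "nat \<Rightarrow> name \<Rightarrow> name" where
  "rot k n = (if n < k then Suc n else if n = k then 0 else n)"

inductive wtrans :: "wproc \<Rightarrow> label \<Rightarrow> wproc \<Rightarrow> bool"
    (\<open>_ \<midarrow>_\<rightarrow>\<^sub>w _\<close> [51, 0, 51] 50) where
  wt_out: "WOut x y1 y2 P \<midarrow>LOut 0 x y1 y2\<rightarrow>\<^sub>w P"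
| wt_in: "WIn x P \<midarrow>LIn x v1 v2\<rightarrow>\<^sub>w wren (case_nat v1 (case_nat v2 id)) P"
| wt_rep: "WRep x P \<midarrow>LIn x v1 v2\<rightarrow>\<^sub>w WPar (WRep x P) (wren (case_nat v1 (case_nat v2 id)) P)"
| wt_open: "P \<midarrow>LOut k x y1 y2\<rightarrow>\<^sub>w P' \<Longrightarrow> x \<noteq> k \<Longrightarrow> k = y1 \<or> k = y2 \<Longrightarrow>
     WNu P \<midarrow>LOut (Suc k) x y1 y2\<rightarrow>\<^sub>w P'"
| wt_res_tau: "P \<midarrow>Tau\<rightarrow>\<^sub>w P' \<Longrightarrow> WNu P \<midarrow>Tau\<rightarrow>\<^sub>w WNu P'"
| wt_res_in: "P \<midarrow>LIn (Suc x) (Suc v1) (Suc v2)\<rightarrow>\<^sub>w P' \<Longrightarrow> WNu P \<midarrow>LIn x v1 v2\<rightarrow>\<^sub>w WNu P'"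
| wt_res_out: "P \<midarrow>LOut k (skip k x) (skip k y1) (skip k y2)\<rightarrow>\<^sub>w P' \<Longrightarrow>
     WNu P \<midarrow>LOut k x y1 y2\<rightarrow>\<^sub>w WNu (wren (rot k) P')"
| wt_parL_tau: "P \<midarrow>Tau\<rightarrow>\<^sub>w P' \<Longrightarrow> WPar P Q \<midarrow>Tau\<rightarrow>\<^sub>w WPar P' Q"
| wt_parR_tau: "Q \<midarrow>Tau\<rightarrow>\<^sub>w Q' \<Longrightarrow> WPar P Q \<midarrow>Tau\<rightarrow>\<^sub>w WPar P Q'"
| wt_parL_in: "P \<midarrow>LIn x v1 v2\<rightarrow>\<^sub>w P' \<Longrightarrow> WPar P Q \<midarrow>LIn x v1 v2\<rightarrow>\<^sub>w WPar P' Q"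
| wt_parR_in: "Q \<midarrow>LIn x v1 v2\<rightarrow>\<^sub>w Q' \<Longrightarrow> WPar P Q \<midarrow>LIn x v1 v2\<rightarrow>\<^sub>w WPar P Q'"
| wt_parL_out: "P \<midarrow>LOut k x y1 y2\<rightarrow>\<^sub>w P' \<Longrightarrow>
     WPar P Q \<midarrow>LOut k x y1 y2\<rightarrow>\<^sub>w WPar P' (wren (\<lambda>n. n + k) Q)"
| wt_parR_out: "Q \<midarrow>LOut k x y1 y2\<rightarrow>\<^sub>w Q' \<Longrightarrow>
     WPar P Q \<midarrow>LOut k x y1 y2\<rightarrow>\<^sub>w WPar (wren (\<lambda>n. n + k) P) Q'"
| wt_comL: "P \<midarrow>LOut k (x + k) y1 y2\<rightarrow>\<^sub>w P' \<Longrightarrow>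
     wren (\<lambda>n. n + k) Q \<midarrow>LIn (x + k) y1 y2\<rightarrow>\<^sub>w Q' \<Longrightarrow>
     WPar P Q \<midarrow>Tau\<rightarrow>\<^sub>w (WNu ^^ k) (WPar P' Q')"
| wt_comR: "wren (\<lambda>n. n + k) P \<midarrow>LIn (x + k) y1 y2\<rightarrow>\<^sub>w P' \<Longrightarrow>
     Q \<midarrow>LOut k (x + k) y1 y2\<rightarrow>\<^sub>w Q' \<Longrightarrow>
     WPar P Q \<midarrow>Tau\<rightarrow>\<^sub>w (WNu ^^ k) (WPar P' Q')"

text \<open>Linear input and output, server, client, unit; the number is the weight.\<close>
datatype wtype = TIn nat wtype wtype | TOut nat wtype wtype | TSrv nat wtype | TCli nat wtype | TUnit

text \<open>As for session types, duality acts on the continuation and keeps the payload.\<close>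
primrec wdual :: "wtype \<Rightarrow> wtype" where
  "wdual (TIn n V1 V2) = TOut n V1 (wdual V2)"
| "wdual (TOut n V1 V2) = TIn n V1 (wdual V2)"
| "wdual (TSrv n V) = TCli n V"
| "wdual (TCli n V) = TSrv n V"
| "wdual TUnit = TUnit"

primrec weights_pos :: "wtype \<Rightarrow> bool" where
  "weights_pos (TIn n V1 V2) \<longleftrightarrow> n \<ge> 1 \<and> weights_pos V1 \<and> weights_pos V2"
| "weights_pos (TOut n V1 V2) \<longleftrightarrow> n \<ge> 1 \<and> weights_pos V1 \<and> weights_pos V2"
| "weights_pos (TSrv n V) \<longleftrightarrow> n \<ge> 1 \<and> weights_pos V"
| "weights_pos (TCli n V) \<longleftrightarrow> n \<ge> 1 \<and> weights_pos V"
| "weights_pos TUnit \<longleftrightarrow> True"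

text \<open>\<open>level_of V k\<close>: a name of type \<open>V\<close> may have level \<open>k\<close>.\<close>
primrec level_of :: "wtype \<Rightarrow> nat \<Rightarrow> bool" where
  "level_of (TIn n V1 V2) k \<longleftrightarrow> k = n"
| "level_of (TOut n V1 V2) k \<longleftrightarrow> k = n"
| "level_of (TSrv n V) k \<longleftrightarrow> k = n"
| "level_of (TCli n V) k \<longleftrightarrow> k = n"
| "level_of TUnit k \<longleftrightarrow> True"

primrec w_un :: "wtype \<Rightarrow> bool" where
  "w_un (TIn n V1 V2) \<longleftrightarrow> False"
| "w_un (TOut n V1 V2) \<longleftrightarrow> False"
| "w_un (TSrv n V) \<longleftrightarrow> True"
| "w_un (TCli n V) \<longleftrightarrow> True"
| "w_un TUnit \<longleftrightarrow> True"

text \<open>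
  \<open>One V\<close> is the entry \<open>x:V\<close> and \<open>both V\<close> the entry \<open>x::V\<close>.  The latter is the unordered pair of
  \<open>V\<close> and its dual, so \<open>x::V\<close> and \<open>x::V'\<close> are the same entry for \<open>V'\<close> the dual of \<open>V\<close>: an
  unrestricted \<open>x::V\<close> must be usable as a server on one side of a split and as a client on the
  other.
\<close>
datatype wentry = One wtype | Both "wtype set"

abbreviation both :: "wtype \<Rightarrow> wentry" where
  "both V \<equiv> Both {V, wdual V}"

primrec e_un :: "wentry \<Rightarrow> bool" where
  "e_un (One V) \<longleftrightarrow> w_un V"
| "e_un (Both A) \<longleftrightarrow> (\<forall>V\<in>A. w_un V)"

type_synonym wctx = "name \<Rightarrow> wentry option"

definition w_un_ctx :: "wctx \<Rightarrow> bool" where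
  "w_un_ctx \<Delta> \<longleftrightarrow> (\<forall>e\<in>ran \<Delta>. e_un e)"

inductive w_split_entry :: "wentry option \<Rightarrow> wentry option \<Rightarrow> wentry option \<Rightarrow> bool" where
  "w_split_entry None None None"
| "e_un e \<Longrightarrow> w_split_entry (Some e) (Some e) (Some e)"
| "\<not> e_un e \<Longrightarrow> w_split_entry (Some e) (Some e) None"
| "\<not> e_un e \<Longrightarrow> w_split_entry (Some e) None (Some e)"
| "\<not> w_un V \<Longrightarrow> w_split_entry (Some (both V)) (Some (One V)) (Some (One (wdual V)))"

definition w_split :: "wctx \<Rightarrow> wctx \<Rightarrow> wctx \<Rightarrow> bool" where
  "w_split \<Delta> \<Delta>1 \<Delta>2 \<longleftrightarrow> (\<forall>x. w_split_entry (\<Delta> x) (\<Delta>1 x) (\<Delta>2 x))"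

definition w_var :: "wctx \<Rightarrow> name \<Rightarrow> wtype \<Rightarrow> bool" where
  "w_var \<Delta> x V \<longleftrightarrow> \<Delta> x \<in> {Some (One V), Some (both V)} \<and> w_un_ctx (\<Delta>(x := None))"

text \<open>
  The judgment for a name transmitted at type \<open>V\<close>: its entry is \<open>y:V\<close>, or \<open>y::V\<close> with \<open>V\<close>
  unrestricted.  The second form is needed because splitting never turns an unrestricted \<open>y::V\<close>
  into \<open>y:V\<close>; a linear \<open>y::V\<close> has to be split into \<open>y:V\<close> and its dual before \<open>y\<close> is sent.
\<close>
definition w_payload :: "wctx \<Rightarrow> name \<Rightarrow> wtype \<Rightarrow> bool" where
  "w_payload \<Delta> y V \<longleftrightarrow> w_var \<Delta> y V \<and> (\<Delta> y = Some (One V) \<or> w_un V)"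

text \<open>
  \<open>wtyped l \<Delta> P L\<close>: \<open>P\<close> is typable in \<open>\<Delta>\<close> with level function \<open>l\<close>, and \<open>L\<close> is
  the set of the levels \<open>l(b)\<close> of the names \<open>b\<close> in \<open>os(P)\<close>.  As \<open>os(P)\<close> contains bound names, whose
  levels are those of the types given to them in the derivation, \<open>L\<close> is computed along with it.
  The level function is extended at each binder, consistently with the type of the bound name.

  The rules for servers and clients have \<open>x:V\<close> and \<open>x::V\<close> as variants, both covered by \<open>w_var\<close>.
  The input on a server with entry \<open>x::V\<close> splits its context as the one with entry \<open>x:V\<close>: if the
  judgment for \<open>x\<close> were over the context of the continuation, no linear name could be used there.
\<close>
inductive wtyped :: "(name \<Rightarrow> nat) \<Rightarrow> wctx \<Rightarrow> wproc \<Rightarrow> nat set \<Rightarrow> bool" where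
  wty_nil: "w_un_ctx \<Delta> \<Longrightarrow> wtyped l \<Delta> WNil {}"
| wty_par: "w_split \<Delta> \<Delta>1 \<Delta>2 \<Longrightarrow> wtyped l \<Delta>1 P L1 \<Longrightarrow> wtyped l \<Delta>2 Q L2 \<Longrightarrow>
     wtyped l \<Delta> (WPar P Q) (L1 \<union> L2)"
| wty_res: "weights_pos V \<Longrightarrow> level_of V k \<Longrightarrow> wtyped (case_nat k l) (ext (both V) \<Delta>) P L \<Longrightarrow>
     wtyped l \<Delta> (WNu P) L"
| wty_lin_in: "w_split \<Delta> \<Delta>1 \<Delta>2 \<Longrightarrow> \<Delta>1 x = Some (One (TIn n V1 V2)) \<Longrightarrow>
     w_var \<Delta>1 x (TIn n V1 V2) \<Longrightarrow>
     level_of V1 k1 \<Longrightarrow> level_of V2 k2 \<Longrightarrow> l x = k2 \<Longrightarrow>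
     wtyped (case_nat k1 (case_nat k2 l)) (ext (One V1) (ext (One V2) \<Delta>2)) P L \<Longrightarrow>
     wtyped l \<Delta> (WIn x P) L"
| wty_srv_in: "w_split \<Delta> \<Delta>1 \<Delta>2 \<Longrightarrow> w_var \<Delta>1 x (TSrv n V) \<Longrightarrow>
     level_of V k1 \<Longrightarrow> level_of TUnit k2 \<Longrightarrow>
     wtyped (case_nat k1 (case_nat k2 l)) (ext (One V) (ext (One TUnit) \<Delta>2)) P L \<Longrightarrow>
     wtyped l \<Delta> (WIn x P) L"
| wty_lin_out: "w_split \<Delta> \<Delta>1 \<Delta>' \<Longrightarrow> w_split \<Delta>' \<Delta>2 \<Delta>3 \<Longrightarrow>
     \<Delta>1 x = Some (One (TOut n V1 V2)) \<Longrightarrow> w_var \<Delta>1 x (TOut n V1 V2) \<Longrightarrow>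
     w_payload \<Delta>2 y1 V1 \<Longrightarrow> y1 \<noteq> y2 \<Longrightarrow> \<Delta>3 y2 = Some (both V2) \<Longrightarrow> l x = l y2 \<Longrightarrow>
     wtyped l (\<Delta>3(y2 \<mapsto> One V2)) P L \<Longrightarrow> wtyped l \<Delta> (WOut x y1 y2 P) (insert (l x) L)"
| wty_cli_out: "w_split \<Delta> \<Delta>1 \<Delta>' \<Longrightarrow> w_split \<Delta>' \<Delta>2 \<Delta>3 \<Longrightarrow> w_var \<Delta>1 x (TCli n V) \<Longrightarrow>
     w_payload \<Delta>2 y1 V \<Longrightarrow> y2 \<notin> dom \<Delta> \<Longrightarrow>
     wtyped l (\<Delta>3(y2 \<mapsto> One TUnit)) P L \<Longrightarrow> wtyped l \<Delta> (WOut x y1 y2 P) (insert (l x) L)"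
| wty_rep: "w_var \<Delta> x (TSrv n V) \<Longrightarrow> level_of V k1 \<Longrightarrow> level_of TUnit k2 \<Longrightarrow>
     wtyped (case_nat k1 (case_nat k2 l)) (ext (One V) (ext (One TUnit) \<Delta>)) P L \<Longrightarrow>
     \<forall>m\<in>L. m < n \<Longrightarrow> wtyped l \<Delta> (WRep x P) {}"


section \<open>The translation\<close>

definition scope :: "name set \<Rightarrow> name set" where
  "scope N = insert 0 (Suc ` N)"

text \<open>
  \<open>strans N \<Gamma> P W\<close>: \<open>W\<close> is the translation of \<open>P\<close> relative to a typing of \<open>P\<close> in \<open>\<Gamma>\<close>; its
  rules follow those of \<open>\<turnstile>\<^sub>s\<close>.  \<open>N\<close> is the set of names in scope; it
  may be larger than \<open>dom \<Gamma>\<close>, as linear names go to one side of a split only.  The fresh \<open>z\<close> of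
  an output on a client name is free in the translation, hence an arbitrary name not in scope.

  In the translation of \<open>(\<nu>xy)P\<close> the substitution of \<open>z\<close> for \<open>x\<close> and \<open>y\<close> is applied to the translation
  of \<open>P\<close> instead of \<open>P\<close>, since the translation refers to the distinct types of \<open>x\<close> and \<open>y\<close>.
  Likewise for the substitution of \<open>z\<close> for the subject of a linear prefix.
\<close>
inductive strans :: "name set \<Rightarrow> sctx \<Rightarrow> sproc \<Rightarrow> wproc \<Rightarrow> bool" where
  tr_nil: "s_qual_ctx QUn \<Gamma> \<Longrightarrow> strans N \<Gamma> SNil WNil"
| tr_par: "s_split \<Gamma> \<Gamma>1 \<Gamma>2 \<Longrightarrow> strans N \<Gamma>1 P W1 \<Longrightarrow> strans N \<Gamma>2 Q W2 \<Longrightarrow>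
     strans N \<Gamma> (SPar P Q) (WPar W1 W2)"
| tr_res: "session_type T \<Longrightarrow> strans (scope (scope N)) (ext T (ext (sdual T) \<Gamma>)) P W \<Longrightarrow>
     strans N \<Gamma> (SRes P) (WNu (wren (case_nat 0 id) W))"
| tr_lin_in: "s_split \<Gamma> \<Gamma>1 \<Gamma>2 \<Longrightarrow> s_var \<Gamma>1 x (SPre QLin Recv T S) \<Longrightarrow>
     s_upd_ok \<Gamma>2 x S \<Longrightarrow> strans (scope N) (ext T (\<Gamma>2(x \<mapsto> S))) P W \<Longrightarrow>
     strans N \<Gamma> (SIn QLin x P) (WIn x (wren (case_nat 0 ((\<lambda>n. n + 2)(x := 1))) W))"
| tr_srv_in: "s_split \<Gamma> \<Gamma>1 \<Gamma>2 \<Longrightarrow> s_var \<Gamma>1 x (star Recv T) \<Longrightarrow>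
     s_upd_ok \<Gamma>2 x (star Recv T) \<Longrightarrow> strans (scope N) (ext T (\<Gamma>2(x \<mapsto> star Recv T))) P W \<Longrightarrow>
     strans N \<Gamma> (SIn QLin x P) (WIn x (wren (case_nat 0 (\<lambda>n. n + 2)) W))"
| tr_un_in: "s_split \<Gamma> \<Gamma>1 \<Gamma>2 \<Longrightarrow> s_qual_ctx QUn \<Gamma> \<Longrightarrow> s_var \<Gamma>1 x (SPre q Recv T S) \<Longrightarrow>
     s_upd_ok \<Gamma>2 x S \<Longrightarrow> strans (scope N) (ext T (\<Gamma>2(x \<mapsto> S))) P W \<Longrightarrow>
     strans N \<Gamma> (SIn QUn x P) (WRep x (wren (case_nat 0 (\<lambda>n. n + 2)) W))"
| tr_lin_out: "s_split \<Gamma> \<Gamma>1 \<Gamma>' \<Longrightarrow> s_split \<Gamma>' \<Gamma>2 \<Gamma>3 \<Longrightarrow> s_var \<Gamma>1 x (SPre QLin Send T S) \<Longrightarrow>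
     s_var \<Gamma>2 v T \<Longrightarrow> s_upd_ok \<Gamma>3 x S \<Longrightarrow> strans N (\<Gamma>3(x \<mapsto> S)) P W \<Longrightarrow>
     strans N \<Gamma> (SOut x v P) (WNu (WOut (Suc x) (Suc v) 0 (wren (Suc(x := 0)) W)))"
| tr_cli_out: "s_split \<Gamma> \<Gamma>1 \<Gamma>' \<Longrightarrow> s_split \<Gamma>' \<Gamma>2 \<Gamma>3 \<Longrightarrow> s_var \<Gamma>1 x (star Send T) \<Longrightarrow>
     s_var \<Gamma>2 v T \<Longrightarrow> s_upd_ok \<Gamma>3 x (star Send T) \<Longrightarrow> strans N (\<Gamma>3(x \<mapsto> star Send T)) P W \<Longrightarrow>
     z \<notin> N \<Longrightarrow> z \<notin> wfn W \<Longrightarrow>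
     strans N \<Gamma> (SOut x v P) (WOut x v z W)"

definition translates :: "sctx \<Rightarrow> sproc \<Rightarrow> wproc \<Rightarrow> bool" where
  "translates \<Gamma> P W \<longleftrightarrow> strans (dom \<Gamma>) \<Gamma> P W"

text \<open>
  \<open>type_trans l x T V\<close>: \<open>V\<close> is the translation of \<open>T\<close> for the name \<open>x\<close>.  The auxiliary names \<open>a\<close>
  of payloads are chosen anew at each position; only their levels \<open>l a\<close> matter.
\<close>
inductive type_trans :: "(name \<Rightarrow> nat) \<Rightarrow> name \<Rightarrow> stype \<Rightarrow> wtype \<Rightarrow> bool" for l where
  "type_trans l x SEnd TUnit"
| "l x \<ge> 1 \<Longrightarrow> type_trans l a T V \<Longrightarrow> type_trans l x S V' \<Longrightarrow>
     type_trans l x (SPre QLin Recv T S) (TIn (l x) V V')"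
| "l x \<ge> 1 \<Longrightarrow> type_trans l a T V \<Longrightarrow> type_trans l x S V' \<Longrightarrow>
     type_trans l x (SPre QLin Send T S) (TOut (l x) V V')"
| "l x \<ge> 1 \<Longrightarrow> type_trans l a T V \<Longrightarrow> type_trans l x (star Recv T) (TSrv (l x) V)"
| "l x \<ge> 1 \<Longrightarrow> type_trans l a T V \<Longrightarrow> type_trans l x (star Send T) (TCli (l x) V)"

definition ctx_trans :: "(name \<Rightarrow> nat) \<Rightarrow> sctx \<Rightarrow> wctx \<Rightarrow> bool" where
  "ctx_trans l \<Gamma> \<Delta> \<longleftrightarrow> dom \<Delta> = dom \<Gamma> \<and>
     (\<forall>x T. \<Gamma> x = Some T \<longrightarrow> (\<exists>V. type_trans l x T V \<and> \<Delta> x = Some (One V)))"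

text \<open>The judgment that \<open>W\<close> is typable in the translation of \<open>\<Gamma>\<close> relative to \<open>l\<close>.\<close>
definition w_derivable :: "(name \<Rightarrow> nat) \<Rightarrow> sctx \<Rightarrow> wproc \<Rightarrow> bool" where
  "w_derivable l \<Gamma> W \<longleftrightarrow> (\<exists>\<Delta> L. ctx_trans l \<Gamma> \<Delta> \<and> wtyped l \<Delta> W L)"

definition calW :: "sproc set" where
  "calW = {P. \<exists>\<Gamma> l W. session_ctx \<Gamma> \<and> \<Gamma> \<turnstile>\<^sub>s P \<and> translates \<Gamma> P W \<and> w_derivable l \<Gamma> W}"

end

(*
A translated process identifies the co-variables x, y of a restriction, so a communication of the
translation is between prefixes whose subjects are co-variables.  An output that extrudes its payload
is first brought to the front by moving the restriction of the payload outwards; then the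
communication is matched with one of the session process.  After a linear communication both endpoints
of the channel are dead and the translation continues on the fresh name sent along, which is the
translation of a process that restricts the two continuations on their own; this process is
structurally congruent to the reduct.  For R one can therefore take Q.

That R is again in the class amounts to subject reduction of the calculus with weights.  It fails for
arbitrary processes: the second name sent to a server is not in the context.  But in a translated process a
server ignores this name, so it can be replaced by a fresh name of type unit.
*)
theory Submission
  imports Defs
begin

section \<open>Renamings\<close>

text \<open>The translation merges the co-variables of a restriction but refers to their different
  types, so it cannot be followed on merged names. The inductions therefore run over the translation
  \<open>W\<close> before merging and analyse \<open>wren f W\<close>, where \<open>f\<close> merges
  the co-variables of the restrictions passed so far. The session process and its context keep these
  names apart, under the invariant that merged names have dual types. Below its restriction a
  communication is not yet a reduction; \<open>comm\<close> describes it as one under every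
  restriction that may bind its subjects. The residual has to be a translation on the nose, so
  congruence may rearrange the session process but not the shape of its translation. Splits are a
  further obstacle: a linear entry may turn unrestricted after an action, as with
  \<open>end\<close>, and then has to appear on both sides. Contexts are made explicit functions of
  the context of the conclusion, and the renaming lemmas have weakening by unrestricted entries
  built in.\<close>

lemma up_up [simp]: "up f (up g n) = up (\<lambda>n. f (g n)) n"
  by (cases n) auto

lemma up_id [simp]: "up (\<lambda>n. n) = (\<lambda>n. n)"
  by (rule ext) (case_tac n; simp)

lemma up_agree: "(\<And>m. n = Suc m \<Longrightarrow> f m = g m) \<Longrightarrow> up f n = up g n"
  by (cases n) auto

lemma wren_wren [simp]: "wren f (wren g P) = wren (\<lambda>n. f (g n)) P"
  by (induction P arbitrary: f g) simp_all

lemma wren_id [simp]: "wren (\<lambda>n. n) P = P"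
  by (induction P) simp_all

lemma wren_cong: "(\<And>n. n \<in> wfn P \<Longrightarrow> f n = g n) \<Longrightarrow> wren f P = wren g P"
proof (induction P arbitrary: f g)
  case (WIn x P)
  have "wren (up (up f)) P = wren (up (up g)) P"
    by (rule WIn.IH) (auto intro!: up_agree WIn.prems)
  then show ?case using WIn.prems by simp
next
  case (WRep x P)
  have "wren (up (up f)) P = wren (up (up g)) P"
    by (rule WRep.IH) (auto intro!: up_agree WRep.prems)
  then show ?case using WRep.prems by simp
next
  case (WNu P)
  have "wren (up f) P = wren (up g) P"
    by (rule WNu.IH) (auto intro!: up_agree WNu.prems)
  then show ?case by simp
next
  case (WPar P Q)
  have "wren f P = wren g P" "wren f Q = wren g Q"
    by (rule WPar.IH, simp add: WPar.prems)+
  then show ?case by simp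
next
  case (WOut x v z P)
  have "wren f P = wren g P"
    by (rule WOut.IH, simp add: WOut.prems)
  then show ?case using WOut.prems by simp
qed simp

lemma Suc_eq_up: "Suc n = up f m \<longleftrightarrow> (\<exists>k. m = Suc k \<and> n = f k)"
  by (cases m) auto

lemma Suc_mem_up_image: "Suc n \<in> up f ` X \<longleftrightarrow> n \<in> f ` {m. Suc m \<in> X}"
  by (force simp: Suc_eq_up)

lemma wfn_wren [simp]: "wfn (wren f P) = f ` wfn P"
  by (induction P arbitrary: f) (simp_all add: Suc_mem_up_image image_Un)

text \<open>Supplies fresh names: a finite scope and the free names of a process never exhaust the
  naturals, so that \<open>comm_cli_typed\<close> can choose a second object occurring
  nowhere.\<close>

lemma finite_wfn: "finite (wfn P)"
proof (induction P)
  case (WIn x P)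
  have "{n. Suc (Suc n) \<in> wfn P} = (\<lambda>n. Suc (Suc n)) -` wfn P" by auto
  then show ?case using WIn by (auto intro!: finite_vimageI simp: inj_def)
next
  case (WRep x P)
  have "{n. Suc (Suc n) \<in> wfn P} = (\<lambda>n. Suc (Suc n)) -` wfn P" by auto
  then show ?case using WRep by (auto intro!: finite_vimageI simp: inj_def)
next
  case (WNu P)
  have "{n. Suc n \<in> wfn P} = Suc -` wfn P" by auto
  then show ?case using WNu by (auto intro!: finite_vimageI)
qed auto

section \<open>Free names and structural congruence of session processes\<close>

primrec sfn :: "sproc \<Rightarrow> name set" where
  "sfn SNil = {}"
| "sfn (SOut x v P) = {x, v} \<union> sfn P"
| "sfn (SIn q x P) = insert x {n. Suc n \<in> sfn P}"
| "sfn (SPar P Q) = sfn P \<union> sfn Q"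
| "sfn (SRes P) = {n. Suc (Suc n) \<in> sfn P}"

lemma sren_sren [simp]: "sren f (sren g P) = sren (\<lambda>n. f (g n)) P"
  by (induction P arbitrary: f g) simp_all

lemma sren_id [simp]: "sren (\<lambda>n. n) P = P"
  by (induction P) simp_all

lemma sren_cong: "(\<And>n. n \<in> sfn P \<Longrightarrow> f n = g n) \<Longrightarrow> sren f P = sren g P"
proof (induction P arbitrary: f g)
  case (SRes P)
  have "sren (up (up f)) P = sren (up (up g)) P"
    by (rule SRes.IH) (auto intro!: up_agree SRes.prems)
  then show ?case by simp
next
  case (SIn q x P)
  have "sren (up f) P = sren (up g) P"
    by (rule SIn.IH) (auto intro!: up_agree SIn.prems)
  then show ?case using SIn.prems by simp
next
  case (SPar P Q)
  have "sren f P = sren g P" "sren f Q = sren g Q"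
    by (rule SPar.IH, simp add: SPar.prems)+
  then show ?case by simp
next
  case (SOut x v P)
  have "sren f P = sren g P"
    by (rule SOut.IH, simp add: SOut.prems)
  then show ?case using SOut.prems by simp
qed simp

lemma sfn_sren [simp]: "sfn (sren f P) = f ` sfn P"
  by (induction P arbitrary: f) (simp_all add: Suc_mem_up_image image_Un)

abbreviation shift2 :: "name \<Rightarrow> name" where "shift2 \<equiv> \<lambda>n. n + 2"

text \<open>A process that avoids the two indices bound by a restriction has the form required by
  \<open>sc_res_ext\<close> read from right to left, so it can leave the scope.\<close>

lemma shift2_inverse:
  assumes "0 \<notin> sfn P" "1 \<notin> sfn P"
  shows "P = sren shift2 (sren (\<lambda>n. n - 2) P)"
proof -
  have "sren shift2 (sren (\<lambda>n. n - 2) P) = sren (\<lambda>n. n) P"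
    unfolding sren_sren using assms
    by (intro sren_cong) (metis One_nat_def Suc_1 le_add_diff_inverse2 less_2_cases not_less)
  then show ?thesis by simp
qed

text \<open>The renaming need not be injective, since substitutions are renamings too. The exchange
  laws survive because \<open>swap_co\<close> and \<open>swap_res\<close> permute bound indices
  only, on which the lifted renaming is the identity.\<close>

lemma scong_sren: "P \<equiv>\<^sub>s Q \<Longrightarrow> sren f P \<equiv>\<^sub>s sren f Q"
proof (induction arbitrary: f rule: scong.induct)
  case (sc_sym P Q)
  then show ?case by (blast intro: scong.sc_sym)
next
  case (sc_trans P Q R)
  then show ?case by (blast intro: scong.sc_trans)
next
  case (sc_res_swap P)
  have *: "(\<lambda>n. up (up (up (up f))) (swap_res n)) = (\<lambda>n. swap_res (up (up (up (up f))) n))"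
  proof
    fix n show "up (up (up (up f))) (swap_res n) = swap_res (up (up (up (up f))) n)"
      by (cases n; cases "n - 1"; cases "n - 2"; cases "n - 3")
        (auto simp: swap_res_def numeral_eq_Suc)
  qed
  show ?case
    using scong.sc_res_swap[of "sren (up (up (up (up f)))) P"] by (simp add: *)
next
  case (sc_res_co P)
  have *: "(\<lambda>n. up (up f) (swap_co n)) = (\<lambda>n. swap_co (up (up f) n))"
  proof
    fix n show "up (up f) (swap_co n) = swap_co (up (up f) n)"
      by (cases n; cases "n - 1") (auto simp: swap_co_def)
  qed
  show ?case using scong.sc_res_co[of "sren (up (up f)) P"] by (simp add: *)
next
  case (sc_res_ext P Q)
  show ?case using scong.sc_res_ext[of "sren (up (up f)) P" "sren f Q"] by simp
next
  case (sc_par_assoc P Q R)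
  then show ?case by (simp add: scong.sc_par_assoc)
qed (simp_all add: sc_refl sc_out sc_in sc_par sc_res sc_par_comm sc_par_unit sc_res_nil)

lemma scong_par_cong1: "P \<equiv>\<^sub>s P' \<Longrightarrow> SPar P Q \<equiv>\<^sub>s SPar P' Q"
  and scong_par_cong2: "P \<equiv>\<^sub>s P' \<Longrightarrow> SPar Q P \<equiv>\<^sub>s SPar Q P'"
  by (simp_all add: sc_par sc_refl)

lemma scong_par_unit_left: "SPar SNil P \<equiv>\<^sub>s P"
  using sc_par_comm sc_par_unit by (rule sc_trans)

text \<open>With a unit \<open>SNil\<close> beside the shifted process, scope extension read
  backwards shrinks the restriction to \<open>SNil\<close>, where it vanishes.\<close>

lemma scong_res_dead: "SRes (sren shift2 P) \<equiv>\<^sub>s P"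
proof -
  have "SRes (sren shift2 P) \<equiv>\<^sub>s SRes (SPar SNil (sren shift2 P))"
    by (rule sc_res, rule sc_sym, rule scong_par_unit_left)
  moreover have "SRes (SPar SNil (sren shift2 P)) \<equiv>\<^sub>s SPar (SRes SNil) P"
    by (rule sc_sym, rule sc_res_ext)
  moreover have "SPar (SRes SNil) P \<equiv>\<^sub>s SPar SNil P"
    by (rule scong_par_cong1, rule sc_res_nil)
  ultimately show ?thesis
    by (rule sc_trans[OF _ sc_trans[OF _ sc_trans[OF _ scong_par_unit_left]]])
qed

lemma scong_res_ext_right: "SPar Q (SRes P) \<equiv>\<^sub>s SRes (SPar (sren shift2 Q) P)"
  using sc_par_comm sc_res_ext sc_res[OF sc_par_comm] by (rule sc_trans[OF _ sc_trans])

lemma sred_cong_left: "P \<equiv>\<^sub>s P' \<Longrightarrow> P' \<longrightarrow>\<^sub>s Q \<Longrightarrow> P \<longrightarrow>\<^sub>s Q"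
  by (erule (1) sr_cong, rule sc_refl)

lemma sred_cong_right: "P \<longrightarrow>\<^sub>s Q \<Longrightarrow> Q \<equiv>\<^sub>s Q' \<Longrightarrow> P \<longrightarrow>\<^sub>s Q'"
  by (erule (1) sr_cong[OF sc_refl])

lemma sred_par_right: "P \<longrightarrow>\<^sub>s P' \<Longrightarrow> SPar Q P \<longrightarrow>\<^sub>s SPar Q P'"
  by (rule sr_cong[OF sc_par_comm sr_par sc_par_comm])

section \<open>Communication in the session calculus\<close>

text \<open>A communication whose subjects are still free in \<open>P\<close>, as their restriction
  lies further out. The renaming \<open>g\<close> accounts for the restrictions met on the way
  there, the process \<open>C\<close> for what is put in parallel; quantifying over both makes the
  notion closed under these constructors. With \<open>b\<close>, nothing outside \<open>P\<close>
  may use the two endpoints, as is the case for linear ones.\<close>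

definition comm :: "bool \<Rightarrow> name \<Rightarrow> name \<Rightarrow> sproc \<Rightarrow> sproc \<Rightarrow> bool" where
  "comm b x y P P' \<longleftrightarrow> (\<forall>g C. g x = 0 \<longrightarrow> g y = 1 \<longrightarrow>
     (b \<longrightarrow> inj g \<and> 0 \<notin> sfn C \<and> 1 \<notin> sfn C) \<longrightarrow>
     SRes (SPar (sren g P) C) \<longrightarrow>\<^sub>s SRes (SPar (sren g P') C))"

lemma commI:
  assumes "\<And>g C. g x = 0 \<Longrightarrow> g y = 1 \<Longrightarrow> (b \<Longrightarrow> inj g \<and> 0 \<notin> sfn C \<and> 1 \<notin> sfn C) \<Longrightarrow>
     SRes (SPar (sren g P) C) \<longrightarrow>\<^sub>s SRes (SPar (sren g P') C)"
  shows "comm b x y P P'"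
  using assms unfolding comm_def by blast

lemma commD:
  assumes "comm b x y P P'" "g x = 0" "g y = 1" "b \<Longrightarrow> inj g \<and> 0 \<notin> sfn C \<and> 1 \<notin> sfn C"
  shows "SRes (SPar (sren g P) C) \<longrightarrow>\<^sub>s SRes (SPar (sren g P') C)"
  using assms unfolding comm_def by blast

lemma comm_cong:
  assumes "P \<equiv>\<^sub>s P1" "comm b x y P1 P1'" "P1' \<equiv>\<^sub>s P'"
  shows "comm b x y P P'"
proof (rule commI)
  fix g :: "name \<Rightarrow> name" and C assume "g x = 0" "g y = 1" "b \<Longrightarrow> inj g \<and> 0 \<notin> sfn C \<and> 1 \<notin> sfn C"
  with assms(2) have "SRes (SPar (sren g P1) C) \<longrightarrow>\<^sub>s SRes (SPar (sren g P1') C)"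
    by (rule commD)
  then show "SRes (SPar (sren g P) C) \<longrightarrow>\<^sub>s SRes (SPar (sren g P') C)"
    by (rule sr_cong[OF sc_res[OF scong_par_cong1[OF scong_sren[OF assms(1)]]]
          _ sc_res[OF scong_par_cong1[OF scong_sren[OF assms(3)]]]])
qed

text \<open>\<open>Q\<close> is absorbed into the surrounding process \<open>C\<close>. With
  \<open>b\<close>, injectivity of \<open>g\<close> turns the absence of \<open>x\<close> and
  \<open>y\<close> from \<open>Q\<close> into the absence of 0 and 1 from the renamed
  \<open>Q\<close>.\<close>

lemma comm_par:
  assumes "comm b x y P P'" "b \<Longrightarrow> x \<notin> sfn Q \<and> y \<notin> sfn Q"
  shows "comm b x y (SPar P Q) (SPar P' Q)"
proof (rule commI)
  fix g :: "name \<Rightarrow> name" and C assume g: "g x = 0" "g y = 1" and b: "b \<Longrightarrow> inj g \<and> 0 \<notin> sfn C \<and> 1 \<notin> sfn C"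
  have *: "SRes (SPar (SPar A B) C) \<equiv>\<^sub>s SRes (SPar A (SPar B C))" for A B
    by (intro sc_res sc_par_assoc)
  have "SRes (SPar (sren g P) (SPar (sren g Q) C)) \<longrightarrow>\<^sub>s SRes (SPar (sren g P') (SPar (sren g Q) C))"
  proof (rule commD[OF assms(1) g])
    assume bT: b
    then show "inj g \<and> 0 \<notin> sfn (SPar (sren g Q) C) \<and> 1 \<notin> sfn (SPar (sren g Q) C)"
      using b[OF bT] assms(2)[OF bT] inj_image_mem_iff[of g x "sfn Q"] inj_image_mem_iff[of g y "sfn Q"] g by simp
  qed
  then show "SRes (SPar (sren g (SPar P Q)) C) \<longrightarrow>\<^sub>s SRes (SPar (sren g (SPar P' Q)) C)"
    unfolding sren.simps by (rule sr_cong[OF * _ sc_sym[OF *]])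
qed

lemma comm_par_right:
  assumes "comm b x y P P'" "b \<Longrightarrow> x \<notin> sfn Q \<and> y \<notin> sfn Q"
  shows "comm b x y (SPar Q P) (SPar Q P')"
  by (rule comm_cong[OF sc_par_comm comm_par[OF assms] sc_par_comm])

lemma inj_up: "inj f \<Longrightarrow> inj (up f)"
  by (rule injI) (metis Suc_eq_up injD nat.exhaust nat.inject up.simps)

lemma swap_res_swap_res [simp]: "swap_res (swap_res n) = n"
  by (simp add: swap_res_def)

lemma inj_swap_res: "inj swap_res"
  by (metis injI swap_res_swap_res)

lemma swap_co_swap_co [simp]: "swap_co (swap_co n) = n"
  by (simp add: swap_co_def)

lemma inj_swap_co: "inj swap_co"
  by (metis injI swap_co_swap_co)

text \<open>The restriction inside has to leave the scope of the one that will bind \<open>x\<close>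
  and \<open>y\<close>: \<open>C\<close> is brought under it, then the two restrictions are
  exchanged. Hence the new renaming is \<open>swap_res\<close> after the lifting of
  \<open>g\<close>.\<close>

lemma comm_res:
  assumes "comm b (x + 2) (y + 2) P P'"
  shows "comm b x y (SRes P) (SRes P')"
proof (rule commI)
  fix g :: "name \<Rightarrow> name" and C assume g: "g x = 0" "g y = 1" and b: "b \<Longrightarrow> inj g \<and> 0 \<notin> sfn C \<and> 1 \<notin> sfn C"
  let ?g = "\<lambda>n. swap_res (up (up g) n)" and ?C = "sren (\<lambda>n. swap_res (n + 2)) C"
  have *: "SRes (SPar (sren g (SRes Q)) C) \<equiv>\<^sub>s SRes (SRes (SPar (sren ?g Q) ?C))" for Q
  proof -
    have "SRes (SPar (sren g (SRes Q)) C) \<equiv>\<^sub>s SRes (SRes (SPar (sren (up (up g)) Q) (sren shift2 C)))"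
      unfolding sren.simps by (rule sc_res, rule sc_res_ext)
    moreover have "\<dots> \<equiv>\<^sub>s SRes (SRes (SPar (sren ?g Q) ?C))"
      using sc_res_swap[of "SPar (sren (up (up g)) Q) (sren shift2 C)"] by simp
    ultimately show ?thesis by (rule sc_trans)
  qed
  have "SRes (SPar (sren ?g P) ?C) \<longrightarrow>\<^sub>s SRes (SPar (sren ?g P') ?C)"
  proof (rule commD[OF assms])
    show "?g (x + 2) = 0" "?g (y + 2) = 1"
      using g by (simp_all add: swap_res_def)
  next
    assume bT: b
    have "inj ?g"
      using inj_up[OF inj_up[of g]] b[OF bT] inj_swap_res inj_compose[of swap_res "up (up g)"]
      by (simp add: comp_def)
    then show "inj ?g \<and> 0 \<notin> sfn ?C \<and> 1 \<notin> sfn ?C"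
      using b[OF bT] by (auto simp: swap_res_def split: if_splits)
  qed
  then show "SRes (SPar (sren g (SRes P)) C) \<longrightarrow>\<^sub>s SRes (SPar (sren g (SRes P')) C)"
    by (rule sr_cong[OF * sr_res sc_sym[OF *]])
qed

lemma comm_lin_base:
  "comm False x y (SPar (SOut x v P) (SIn QLin y Q)) (SPar P (sren (case_nat v id) Q))"
proof (rule commI)
  fix g :: "name \<Rightarrow> name" and C assume g: "g x = 0" "g y = 1"
  have *: "(\<lambda>n. g (case n of 0 \<Rightarrow> v | Suc m \<Rightarrow> id m)) = (\<lambda>n. case up g n of 0 \<Rightarrow> g v | Suc m \<Rightarrow> id m)"
  proof
    fix n show "g (case n of 0 \<Rightarrow> v | Suc m \<Rightarrow> id m) = (case up g n of 0 \<Rightarrow> g v | Suc m \<Rightarrow> id m)"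
      by (cases n) auto
  qed
  show "SRes (SPar (sren g (SPar (SOut x v P) (SIn QLin y Q))) C) \<longrightarrow>\<^sub>s
    SRes (SPar (sren g (SPar P (sren (case_nat v id) Q))) C)"
    using sr_lin[of "g v" "sren g P" "sren (up g) Q" C] g by (simp add: *)
qed

text \<open>\<open>sr_un\<close> leaves the server behind the instantiated body, whereas the
  residual of a replicated input in the target calculus has it in front. The congruence only repairs
  this order.\<close>

lemma comm_un_base:
  "comm False x y (SPar (SOut x v P) (SIn QUn y Q)) (SPar P (SPar (SIn QUn y Q) (sren (case_nat v id) Q)))"
proof (rule comm_cong[OF sc_refl])
  show "comm False x y (SPar (SOut x v P) (SIn QUn y Q)) (SPar (SPar P (sren (case_nat v id) Q)) (SIn QUn y Q))"
  proof (rule commI)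
    fix g :: "name \<Rightarrow> name" and C assume g: "g x = 0" "g y = 1"
    have *: "(\<lambda>n. g (case n of 0 \<Rightarrow> v | Suc m \<Rightarrow> id m)) = (\<lambda>n. case up g n of 0 \<Rightarrow> g v | Suc m \<Rightarrow> id m)"
    proof
      fix n show "g (case n of 0 \<Rightarrow> v | Suc m \<Rightarrow> id m) = (case up g n of 0 \<Rightarrow> g v | Suc m \<Rightarrow> id m)"
        by (cases n) auto
    qed
    show "SRes (SPar (sren g (SPar (SOut x v P) (SIn QUn y Q))) C) \<longrightarrow>\<^sub>s
      SRes (SPar (sren g (SPar (SPar P (sren (case_nat v id) Q)) (SIn QUn y Q))) C)"
      using sr_un[of "g v" "sren g P" "sren (up g) Q" C] g by (simp add: *)
  qed
  show "SPar (SPar P (sren (case_nat v id) Q)) (SIn QUn y Q) \<equiv>\<^sub>s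
    SPar P (SPar (SIn QUn y Q) (sren (case_nat v id) Q))"
    by (rule sc_trans[OF sc_par_assoc scong_par_cong2[OF sc_par_comm]])
qed

section \<open>Input and output of session processes beneath parallel composition and
  restriction\<close>

inductive sin :: "name \<Rightarrow> name \<Rightarrow> sproc \<Rightarrow> sproc \<Rightarrow> bool" where
  sin_lin: "sin y v (SIn QLin y Q) (sren (case_nat v id) Q)"
| sin_un: "sin y v (SIn QUn y Q) (SPar (SIn QUn y Q) (sren (case_nat v id) Q))"
| sin_parL: "sin y v P P' \<Longrightarrow> sin y v (SPar P Q) (SPar P' Q)"
| sin_parR: "sin y v P P' \<Longrightarrow> sin y v (SPar Q P) (SPar Q P')"
| sin_res: "sin (y + 2) (v + 2) P P' \<Longrightarrow> sin y v (SRes P) (SRes P')"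

text \<open>Neither this relation nor \<open>sin\<close> works up to congruence: the residual keeps
  every parallel component and restriction in its place, exactly as the transition of the
  translation does. The payload is free here; extruded payloads are brought to this situation by
  moving restrictions.\<close>

inductive sout :: "name \<Rightarrow> name \<Rightarrow> sproc \<Rightarrow> sproc \<Rightarrow> bool" where
  sout_base: "sout x v (SOut x v P) P"
| sout_parL: "sout x v P P' \<Longrightarrow> sout x v (SPar P Q) (SPar P' Q)"
| sout_parR: "sout x v P P' \<Longrightarrow> sout x v (SPar Q P) (SPar Q P')"
| sout_res: "sout (x + 2) (v + 2) P P' \<Longrightarrow> sout x v (SRes P) (SRes P')"

text \<open>For the steps that move a restriction around the output outwards over the receiver,
  whose names are then shifted.\<close>

lemma sin_sren: "sin y v Q Q' \<Longrightarrow> sin (g y) (g v) (sren g Q) (sren g Q')"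
proof (induction arbitrary: g rule: sin.induct)
  case (sin_lin y v Q)
  have "(\<lambda>n. g (case n of 0 \<Rightarrow> v | Suc m \<Rightarrow> id m)) = (\<lambda>n. case up g n of 0 \<Rightarrow> g v | Suc m \<Rightarrow> id m)"
    by (auto simp: fun_eq_iff split: nat.splits)
  then show ?case using sin.sin_lin[of "g y" "g v" "sren (up g) Q"] by simp
next
  case (sin_un y v Q)
  have "(\<lambda>n. g (case n of 0 \<Rightarrow> v | Suc m \<Rightarrow> id m)) = (\<lambda>n. case up g n of 0 \<Rightarrow> g v | Suc m \<Rightarrow> id m)"
    by (auto simp: fun_eq_iff split: nat.splits)
  then show ?case using sin.sin_un[of "g y" "g v" "sren (up g) Q"] by simp
next
  case (sin_res y v P P')
  have "sin (g y + 2) (g v + 2) (sren (up (up g)) P) (sren (up (up g)) P')"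
    using sin_res.IH[of "up (up g)"] by simp
  then show ?case unfolding sren.simps by (rule sin.sin_res)
qed (simp_all add: sin.sin_parL sin.sin_parR)

text \<open>The restrictions around the input are moved outwards over the output, which is shifted
  for that. The output is still a bare prefix here; \<open>comm_sout_sin\<close> lifts this by an
  induction on the output.\<close>

lemma comm_out_sin: "sin y v Q Q' \<Longrightarrow> comm False x y (SPar (SOut x v P) Q) (SPar P Q')"
proof (induction arbitrary: x P rule: sin.induct)
  case (sin_lin y v Q)
  show ?case by (rule comm_lin_base)
next
  case (sin_un y v Q)
  show ?case by (rule comm_un_base)
next
  case (sin_parL y v Q Q' R)
  show ?case
    using sc_sym[OF sc_par_assoc] comm_par[OF sin_parL.IH] sc_par_assoc by (rule comm_cong) simp
next
  case (sin_parR y v Q Q' R)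
  have *: "SPar A (SPar R B) \<equiv>\<^sub>s SPar (SPar A B) R" for A B
    by (rule sc_trans[OF scong_par_cong2[OF sc_par_comm] sc_sym[OF sc_par_assoc]])
  show ?case
    using * comm_par[OF sin_parR.IH] sc_sym[OF *] by (rule comm_cong) simp
next
  case (sin_res y v Q Q')
  have "comm False x y (SRes (SPar (sren shift2 (SOut x v P)) Q)) (SRes (SPar (sren shift2 P) Q'))"
    using comm_res[OF sin_res.IH[of "x + 2" "sren shift2 P"]] by simp
  with scong_res_ext_right show ?case
    using sc_sym[OF scong_res_ext_right] by (rule comm_cong)
qed

lemma comm_sout_sin: "sout x v P P' \<Longrightarrow> sin y v Q Q' \<Longrightarrow> comm False x y (SPar P Q) (SPar P' Q')"
proof (induction arbitrary: y Q Q' rule: sout.induct)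
  case (sout_base x v P)
  then show ?case by (rule comm_out_sin)
next
  case (sout_parL x v P P' R)
  have *: "SPar (SPar A R) B \<equiv>\<^sub>s SPar (SPar A B) R" for A B
    by (rule sc_trans[OF sc_par_assoc sc_trans[OF scong_par_cong2[OF sc_par_comm] sc_sym[OF sc_par_assoc]]])
  show ?case
    using * comm_par[OF sout_parL.IH[OF sout_parL.prems]] sc_sym[OF *] by (rule comm_cong) simp
next
  case (sout_parR x v P P' R)
  show ?case
    using sc_par_assoc comm_par_right[OF sout_parR.IH[OF sout_parR.prems]] sc_sym[OF sc_par_assoc]
    by (rule comm_cong) simp
next
  case (sout_res x v P P')
  have "sin (y + 2) (v + 2) (sren shift2 Q) (sren shift2 Q')"
    using sout_res.prems by (rule sin_sren)
  from sc_res_ext comm_res[OF sout_res.IH[OF this]] sc_sym[OF sc_res_ext]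
  show ?case by (rule comm_cong)
qed

text \<open>The restriction of the co-variables \<open>x\<close>, \<open>y\<close> after a linear communication on them.\<close>
definition push :: "name \<Rightarrow> name \<Rightarrow> name \<Rightarrow> name" where
  "push x y n = (if n = x then 0 else if n = y then 1 else n + 2)"

text \<open>After the communication the old endpoints occur only in the continuations. So the
  restriction is narrowed to these, and a dead one is put where it was. For this \<open>C\<close>
  must avoid 0 and 1, and \<open>g\<close> must send no other name to them: the conditions that the
  flag stands for.\<close>

lemma comm_push:
  assumes "comm False x y P P'"
  shows "comm True x y P (SRes (sren (push x y) P'))"
proof (rule commI)
  fix g :: "name \<Rightarrow> name" and C assume g: "g x = 0" "g y = 1" and "True \<Longrightarrow> inj g \<and> 0 \<notin> sfn C \<and> 1 \<notin> sfn C"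
  then have inj: "inj g" and C: "0 \<notin> sfn C" "1 \<notin> sfn C" by auto
  obtain C0 where C0: "C = sren shift2 C0" using shift2_inverse[OF C] by blast
  have up_push: "(\<lambda>n. up (up g) (push x y n)) = (\<lambda>n. up (up shift2) (g n))"
  proof
    fix n
    consider "n = x" | "n \<noteq> x" "n = y" | "n \<noteq> x" "n \<noteq> y" by blast
    then show "up (up g) (push x y n) = up (up shift2) (g n)"
    proof cases
      case 3
      \<comment> \<open>By injectivity 0 and 1 are taken by \<open>x\<close> and \<open>y\<close>,
        so \<open>g n\<close> is at least 2.\<close>
      then have "g n \<noteq> g x" "g n \<noteq> g y" using inj by (simp_all add: inj_eq)
      then obtain k where "g n = Suc (Suc k)" using g by (metis One_nat_def not0_implies_Suc)
      with 3 show ?thesis by (simp add: push_def)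
    qed (use g in \<open>simp_all add: push_def\<close>)
  qed
  have "SRes (SPar (sren g P) C) \<longrightarrow>\<^sub>s SRes (SPar (sren g P') C)"
    using assms g by (rule commD) simp
  moreover have "SRes (SPar (sren g P') C) \<equiv>\<^sub>s SPar (SRes (sren g P')) C0"
    unfolding C0 by (rule sc_sym, rule sc_res_ext)
  moreover have "\<dots> \<equiv>\<^sub>s SRes (sren shift2 (SPar (SRes (sren g P')) C0))"
    by (rule sc_sym, rule scong_res_dead)
  moreover have "\<dots> = SRes (SPar (sren g (SRes (sren (push x y) P'))) C)"
    by (simp add: C0 up_push)
  ultimately show "SRes (SPar (sren g P) C) \<longrightarrow>\<^sub>s SRes (SPar (sren g (SRes (sren (push x y) P'))) C)"
    by (metis sred_cong_right)
qed

lemma comm_red: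
  assumes "comm b x y P P'" "{x, y} = {0, 1}"
  shows "SRes P \<longrightarrow>\<^sub>s SRes P'"
proof -
  have *: "SRes (SPar Q SNil) \<equiv>\<^sub>s SRes Q" for Q
    by (rule sc_res, rule sc_par_unit)
  \<comment> \<open>The reduction rules want the output on index 0; if it is on 1, the co-variables
    are exchanged by \<open>sc_res_co\<close>.\<close>
  have "\<exists>g. inj g \<and> g x = 0 \<and> g y = 1 \<and> (\<forall>Q. SRes Q \<equiv>\<^sub>s SRes (sren g Q))"
  proof (cases "x = 0")
    case True
    then have "y = 1" using assms(2) by (auto simp: doubleton_eq_iff)
    then show ?thesis using True sc_refl by (intro exI[of _ "\<lambda>n. n"]) auto
  next
    case False
    then have "x = 1" "y = 0" using assms(2) by (auto simp: doubleton_eq_iff)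
    then show ?thesis
      by (intro exI[of _ swap_co]) (simp add: inj_swap_co sc_res_co, simp add: swap_co_def)
  qed
  then obtain g where g: "inj g" "g x = 0" "g y = 1" and Q: "\<And>Q. SRes Q \<equiv>\<^sub>s SRes (sren g Q)"
    by blast
  have "SRes (SPar (sren g P) SNil) \<longrightarrow>\<^sub>s SRes (SPar (sren g P') SNil)"
    by (rule commD[OF assms(1)]) (simp_all add: g)
  then show ?thesis
    by (rule sr_cong[OF sc_trans[OF Q sc_sym[OF *]] _ sc_trans[OF * sc_sym[OF Q]]])
qed

section \<open>The translation and renamings\<close>

lemma sdual_simps [simp]:
  "sdual SEnd = SEnd"
  "sdual (SPre q p T S) = SPre q (flip p) T (sdual S)"
  by (subst sdual.code, simp)+

lemma flip_flip [simp]: "flip (flip p) = p"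
  by (cases p) auto

lemma sdual_sdual [simp]: "sdual (sdual T) = T"
proof (coinduction arbitrary: T rule: stype.coinduct_strong)
  case Eq_stype
  show ?case by (cases T) auto
qed

text \<open>Types are infinite trees, so the equation has only one solution. It turns the update
  condition of the input rule, which equates the continuation with the type itself, into the star
  form.\<close>

lemma eq_starI: "S = SPre QUn p T S \<Longrightarrow> S = star p T"
proof (coinduction arbitrary: S rule: stype.coinduct_strong)
  case Eq_stype
  moreover have "star p T = SPre QUn p T (star p T)" by (rule star.code)
  ultimately show ?case by (metis stype.sel stype.distinct(1))
qed

lemma sdual_star [simp]: "sdual (star p T) = star (flip p) T"
  by (rule eq_starI) (metis sdual_simps(2) star.code)

lemma star_neq_lin [simp]: "star p T \<noteq> SPre QLin p' T' S'" "SPre QLin p' T' S' \<noteq> star p T"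
  by (metis qual.distinct(1) star.code stype.inject)+

lemma star_inject [simp]: "star p T = star p' T' \<longleftrightarrow> p = p' \<and> T = T'"
  by (metis star.code stype.inject)

lemma s_un_simps [simp]: "s_un SEnd" "s_un (SPre q p T S) \<longleftrightarrow> q = QUn" "s_un (star p T)"
proof -
  show "s_un (star p T)" unfolding s_un_def by (metis star.code)
qed (auto simp: s_un_def)

lemma not_s_unE: "\<not> s_un T \<Longrightarrow> (\<And>p T' S. T = SPre QLin p T' S \<Longrightarrow> thesis) \<Longrightarrow> thesis"
  by (cases T) (auto intro: qual.exhaust)

lemma s_un_sdual [simp]: "s_un (sdual T) \<longleftrightarrow> s_un T"
  by (cases T) auto

lemma session_type_sdual: "session_type T \<Longrightarrow> session_type (sdual T)"
  by (induction rule: session_type.induct) (auto intro: session_type.intros)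

lemma session_type_cont: "session_type (SPre QLin p T S) \<Longrightarrow> session_type S"
  by (erule session_type.cases) auto

section \<open>Extension and splitting of session contexts\<close>

lemma ext_simps [simp]: "ext a \<Gamma> 0 = Some a" "ext a \<Gamma> (Suc n) = \<Gamma> n"
  by (simp_all add: ext_def)

lemma Suc_mem_dom_ext [simp]: "Suc n \<in> dom (ext a \<Gamma>) \<longleftrightarrow> n \<in> dom \<Gamma>"
  by (simp add: dom_def)

lemma ext_upd_Suc [simp]: "(ext a \<Gamma>)(Suc n := e) = ext a (\<Gamma>(n := e))"
  by (auto simp: fun_eq_iff ext_def split: nat.splits)

lemma ext_upd_0 [simp]: "(ext a \<Gamma>)(0 \<mapsto> b) = ext b \<Gamma>"
  by (auto simp: fun_eq_iff ext_def split: nat.splits)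

lemma mem_scope [simp]: "0 \<in> scope N" "Suc n \<in> scope N \<longleftrightarrow> n \<in> N"
  by (auto simp: scope_def)

lemma dom_ext_subset: "dom \<Gamma> \<subseteq> N \<Longrightarrow> dom (ext a \<Gamma>) \<subseteq> scope N"
  by (rule subsetI) (case_tac x; auto simp: subset_iff)

lemma s_qual_ctx_QUn: "s_qual_ctx QUn \<Gamma> \<longleftrightarrow> (\<forall>x T. \<Gamma> x = Some T \<longrightarrow> s_un T)"
  by (auto simp: s_qual_ctx_def ran_def)

text \<open>What is left of a context after \<open>v\<close> has been given away at type
  \<open>T\<close>.\<close>

definition s_take :: "name \<Rightarrow> stype \<Rightarrow> sctx \<Rightarrow> sctx" where
  "s_take v T \<Gamma> = (if s_un T then \<Gamma> else \<Gamma>(v := None))"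

lemma dom_s_take: "dom (s_take v T \<Gamma>) \<subseteq> dom \<Gamma>"
  by (auto simp: s_take_def)

lemma s_split_entry_iff: "s_split_entry a b c \<longleftrightarrow> (case a of None \<Rightarrow> b = None \<and> c = None
   | Some T \<Rightarrow> if s_un T then b = a \<and> c = a else (b = a \<and> c = None) \<or> (b = None \<and> c = a))"
  by (cases a) (auto simp: s_split_entry.simps elim: not_s_unE)

lemma s_split_D: "s_split \<Gamma> \<Gamma>1 \<Gamma>2 \<Longrightarrow> s_split_entry (\<Gamma> x) (\<Gamma>1 x) (\<Gamma>2 x)"
  by (simp add: s_split_def)

lemma s_split_entry_sym: "s_split_entry a b c \<Longrightarrow> s_split_entry a c b"
  by (auto simp: s_split_entry_iff split: option.splits if_splits)

lemma s_split_sym: "s_split \<Gamma> \<Gamma>1 \<Gamma>2 \<Longrightarrow> s_split \<Gamma> \<Gamma>2 \<Gamma>1"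
  unfolding s_split_def by (metis s_split_entry_sym)

lemma s_split_dom: assumes "s_split \<Gamma> \<Gamma>1 \<Gamma>2" shows "dom \<Gamma>1 \<subseteq> dom \<Gamma>" "dom \<Gamma>2 \<subseteq> dom \<Gamma>"
proof -
  have A: "\<Gamma>1 x \<noteq> None \<Longrightarrow> \<Gamma> x \<noteq> None" "\<Gamma>2 x \<noteq> None \<Longrightarrow> \<Gamma> x \<noteq> None" for x
    using s_split_D[OF assms, of x] by (auto simp: s_split_entry_iff split: option.splits)
  show "dom \<Gamma>1 \<subseteq> dom \<Gamma>" by (intro subsetI, unfold domIff) (rule A(1))
  show "dom \<Gamma>2 \<subseteq> dom \<Gamma>" by (intro subsetI, unfold domIff) (rule A(2))
qed

lemma s_split_le: assumes "s_split \<Gamma> \<Gamma>1 \<Gamma>2"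
  shows "\<Gamma>1 x = Some T \<Longrightarrow> \<Gamma> x = Some T" "\<Gamma>2 x = Some T \<Longrightarrow> \<Gamma> x = Some T"
  using s_split_D[OF assms, of x] by (auto simp: s_split_entry_iff split: option.splits if_splits)

lemma s_split_lin: assumes "s_split \<Gamma> \<Gamma>1 \<Gamma>2" "\<Gamma>1 x = Some T" "\<not> s_un T"
  shows "\<Gamma>2 x = None"
  using s_split_D[OF assms(1), of x] assms(2,3) by (auto simp: s_split_entry_iff split: option.splits if_splits)

lemma s_split_un: assumes "s_split \<Gamma> \<Gamma>1 \<Gamma>2" "\<Gamma>1 x = Some T" "s_un T"
  shows "\<Gamma>2 x = Some T"
  using s_split_D[OF assms(1), of x] assms(2,3) by (auto simp: s_split_entry_iff split: option.splits if_splits)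

text \<open>The judgment for a name leaves only unrestricted entries beside it, and these are on
  both sides of a split anyway. So the side of the continuation is a function of the whole
  context.\<close>

lemma split_s_var:
  assumes "s_split \<Gamma> \<Gamma>1 \<Gamma>2" "s_var \<Gamma>1 x T"
  shows "\<Gamma> x = Some T" "\<Gamma>2 = s_take x T \<Gamma>"
proof -
  have x: "\<Gamma>1 x = Some T" and un: "\<And>y T. y \<noteq> x \<Longrightarrow> \<Gamma>1 y = Some T \<Longrightarrow> s_un T"
    using assms(2) by (auto simp: s_var_def s_qual_ctx_QUn) (metis)
  show "\<Gamma> x = Some T" using s_split_le(1)[OF assms(1) x] .
  show "\<Gamma>2 = s_take x T \<Gamma>"
  proof
    fix y show "\<Gamma>2 y = s_take x T \<Gamma> y"
      using s_split_D[OF assms(1), of y] x un[of y]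
      by (cases "y = x") (auto simp: s_take_def s_split_entry_iff split: option.splits if_splits)
  qed
qed

lemma ex_split_s_var:
  assumes "\<Gamma> x = Some T"
  obtains \<Gamma>1 where "s_split \<Gamma> \<Gamma>1 (s_take x T \<Gamma>)" "s_var \<Gamma>1 x T"
proof
  let ?\<Gamma>1 = "\<lambda>y. if y = x then Some T else case \<Gamma> y of None \<Rightarrow> None | Some T \<Rightarrow> if s_un T then Some T else None"
  show "s_split \<Gamma> ?\<Gamma>1 (s_take x T \<Gamma>)"
    using assms by (auto simp: s_take_def s_split_def s_split_entry_iff split: option.splits)
  show "s_var ?\<Gamma>1 x T"
    by (auto simp: s_var_def s_qual_ctx_QUn split: option.splits if_splits)
qed

text \<open>
  The rules of \<open>strans\<close> with the contexts of the premises made explicit: the context of a name is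
  determined up to unrestricted entries, so only the split of a parallel composition is a choice.
\<close>
inductive str :: "name set \<Rightarrow> sctx \<Rightarrow> sproc \<Rightarrow> wproc \<Rightarrow> bool" where
  str_nil: "s_qual_ctx QUn \<Gamma> \<Longrightarrow> str N \<Gamma> SNil WNil"
| str_par: "s_split \<Gamma> \<Gamma>1 \<Gamma>2 \<Longrightarrow> str N \<Gamma>1 P W1 \<Longrightarrow> str N \<Gamma>2 Q W2 \<Longrightarrow>
     str N \<Gamma> (SPar P Q) (WPar W1 W2)"
| str_res: "session_type T \<Longrightarrow> str (scope (scope N)) (ext T (ext (sdual T) \<Gamma>)) P W \<Longrightarrow>
     str N \<Gamma> (SRes P) (WNu (wren (case_nat 0 id) W))"
| str_lin_in: "\<Gamma> x = Some (SPre QLin Recv T S) \<Longrightarrow> str (scope N) (ext T (\<Gamma>(x \<mapsto> S))) P W \<Longrightarrow>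
     str N \<Gamma> (SIn QLin x P) (WIn x (wren (case_nat 0 ((\<lambda>n. Suc (Suc n))(x := Suc 0))) W))"
| str_srv_in: "\<Gamma> x = Some (star Recv T) \<Longrightarrow> str (scope N) (ext T \<Gamma>) P W \<Longrightarrow>
     str N \<Gamma> (SIn QLin x P) (WIn x (wren (case_nat 0 (\<lambda>n. Suc (Suc n))) W))"
| str_un_in: "s_qual_ctx QUn \<Gamma> \<Longrightarrow> \<Gamma> x = Some (star Recv T) \<Longrightarrow> str (scope N) (ext T \<Gamma>) P W \<Longrightarrow>
     str N \<Gamma> (SIn QUn x P) (WRep x (wren (case_nat 0 (\<lambda>n. Suc (Suc n))) W))"
| str_lin_out: "\<Gamma> x = Some (SPre QLin Send T S) \<Longrightarrow> v \<noteq> x \<Longrightarrow> \<Gamma> v = Some T \<Longrightarrow>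
     str N ((s_take v T \<Gamma>)(x \<mapsto> S)) P W \<Longrightarrow>
     str N \<Gamma> (SOut x v P) (WNu (WOut (Suc x) (Suc v) 0 (wren (Suc(x := 0)) W)))"
| str_cli_out: "\<Gamma> x = Some (star Send T) \<Longrightarrow> \<Gamma> v = Some T \<Longrightarrow>
     str N (s_take v T \<Gamma>) P W \<Longrightarrow> z \<notin> N \<Longrightarrow> z \<notin> wfn W \<Longrightarrow>
     str N \<Gamma> (SOut x v P) (WOut x v z W)"

lemma strans_imp_str: "strans N \<Gamma> P W \<Longrightarrow> str N \<Gamma> P W"
proof (induction rule: strans.induct)
  case (tr_lin_in \<Gamma> \<Gamma>1 \<Gamma>2 x T S N P W)
  then show ?case using split_s_var[OF tr_lin_in(1,2)] by (auto intro!: str_lin_in simp: s_take_def)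
next
  case (tr_srv_in \<Gamma> \<Gamma>1 \<Gamma>2 x T N P W)
  have "\<Gamma>(x \<mapsto> star Recv T) = \<Gamma>" using split_s_var[OF tr_srv_in(1,2)] by auto
  then show ?case
    using split_s_var[OF tr_srv_in(1,2)] tr_srv_in by (auto intro!: str_srv_in simp: s_take_def)
next
  case (tr_un_in \<Gamma> \<Gamma>1 \<Gamma>2 x q T S N P W)
  have x: "\<Gamma> x = Some (SPre q Recv T S)" using split_s_var[OF tr_un_in(1,3)] by simp
  \<comment> \<open>An unrestricted context forces \<open>q = QUn\<close>, so \<open>x\<close> is
    still in \<open>\<Gamma>2\<close>, and the update is defined only if \<open>S\<close> is the
    type of \<open>x\<close> itself. Hence this is a star type.\<close>
  then have "s_un (SPre q Recv T S)" using tr_un_in(2) unfolding s_qual_ctx_QUn by blast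
  then have "q = QUn" by simp
  then have "\<Gamma>2 = \<Gamma>" using split_s_var[OF tr_un_in(1,3)] by (simp add: s_take_def)
  then have "S = SPre QUn Recv T S" using tr_un_in(4) x \<open>q = QUn\<close> by (auto simp: s_upd_ok_def)
  then have S: "S = star Recv T" by (rule eq_starI)
  then have "SPre q Recv T S = star Recv T" using \<open>S = SPre QUn Recv T S\<close> \<open>q = QUn\<close> by simp
  then have x: "\<Gamma> x = Some (star Recv T)" using x by simp
  then have "\<Gamma>(x \<mapsto> star Recv T) = \<Gamma>" by auto
  then show ?case using x tr_un_in S \<open>\<Gamma>2 = \<Gamma>\<close> by (auto intro!: str_un_in)
next
  case (tr_lin_out \<Gamma> \<Gamma>1 \<Gamma>' \<Gamma>2 \<Gamma>3 x T S v N P W)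
  note 1 = split_s_var[OF tr_lin_out(1,3)] and 2 = split_s_var[OF tr_lin_out(2,4)]
  have "\<Gamma>3(x \<mapsto> S) = (s_take v T \<Gamma>)(x \<mapsto> S)" using 1 2 by (auto simp: s_take_def)
  then have "str N ((s_take v T \<Gamma>)(x \<mapsto> S)) P W" using tr_lin_out.IH by metis
  \<comment> \<open>The linear \<open>x\<close> is already gone from \<open>\<Gamma>'\<close>, in
    which \<open>v\<close> is looked up.\<close>
  moreover have "v \<noteq> x" "\<Gamma> v = Some T" using 1 2(1) by (auto simp: s_take_def split: if_splits)
  ultimately show ?case using 1(1) by (intro str_lin_out)
next
  case (tr_cli_out \<Gamma> \<Gamma>1 \<Gamma>' \<Gamma>2 \<Gamma>3 x T v N P W z)
  note 1 = split_s_var[OF tr_cli_out(1,3)] and 2 = split_s_var[OF tr_cli_out(2,4)]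
  have "\<Gamma>' = \<Gamma>" using 1 by (simp add: s_take_def)
  \<comment> \<open>If the payload is the channel itself, \<open>T\<close> is its star type, so
    taking \<open>v\<close> leaves \<open>x\<close> in place.\<close>
  moreover from this have un: "v = x \<Longrightarrow> s_un T"
    using 1(1) 2(1) by (metis option.inject s_un_simps(3))
  moreover have "\<Gamma>3(x \<mapsto> star Send T) = \<Gamma>3"
    using 1 2 \<open>\<Gamma>' = \<Gamma>\<close> un by (auto simp: s_take_def fun_upd_idem_iff)
  ultimately show ?case using 1 2 tr_cli_out by (auto intro!: str_cli_out)
qed (auto intro: str.intros)

lemma str_imp_strans: "str N \<Gamma> P W \<Longrightarrow> strans N \<Gamma> P W"
proof (induction rule: str.induct)
  case (str_lin_in \<Gamma> x T S N P W)
  obtain \<Gamma>1 where 1: "s_split \<Gamma> \<Gamma>1 (s_take x (SPre QLin Recv T S) \<Gamma>)" "s_var \<Gamma>1 x (SPre QLin Recv T S)"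
    using str_lin_in(1) by (rule ex_split_s_var)
  then show ?case
    using str_lin_in tr_lin_in[OF 1, of N P W] by (auto simp: s_take_def s_upd_ok_def)
next
  case (str_srv_in \<Gamma> x T N P W)
  obtain \<Gamma>1 where 1: "s_split \<Gamma> \<Gamma>1 (s_take x (star Recv T) \<Gamma>)" "s_var \<Gamma>1 x (star Recv T)"
    using str_srv_in(1) by (rule ex_split_s_var)
  moreover have "\<Gamma>(x \<mapsto> star Recv T) = \<Gamma>" using str_srv_in by auto
  ultimately show ?case
    using str_srv_in tr_srv_in[OF 1, of N P W] by (auto simp: s_take_def s_upd_ok_def)
next
  case (str_un_in \<Gamma> x T N P W)
  obtain \<Gamma>1 where 1: "s_split \<Gamma> \<Gamma>1 (s_take x (star Recv T) \<Gamma>)" "s_var \<Gamma>1 x (star Recv T)"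
    using str_un_in(2) by (rule ex_split_s_var)
  moreover have "\<Gamma>(x \<mapsto> star Recv T) = \<Gamma>" using str_un_in by auto
  moreover have "star Recv T = SPre QUn Recv T (star Recv T)" by (rule star.code)
  ultimately show ?case
    using str_un_in tr_un_in[OF 1(1), where q = QUn and T = T and S = "star Recv T" and N = N and P = P and W = W]
    by (auto simp: s_take_def s_upd_ok_def)
next
  case (str_lin_out \<Gamma> x T S v N P W)
  obtain \<Gamma>1 where 1: "s_split \<Gamma> \<Gamma>1 (s_take x (SPre QLin Send T S) \<Gamma>)" "s_var \<Gamma>1 x (SPre QLin Send T S)"
    using str_lin_out(1) by (rule ex_split_s_var)
  have "s_take x (SPre QLin Send T S) \<Gamma> v = Some T" using str_lin_out by (auto simp: s_take_def)
  then obtain \<Gamma>2 where 2: "s_split (s_take x (SPre QLin Send T S) \<Gamma>) \<Gamma>2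
      (s_take v T (s_take x (SPre QLin Send T S) \<Gamma>))" "s_var \<Gamma>2 v T"
    by (rule ex_split_s_var)
  have "(s_take v T (s_take x (SPre QLin Send T S) \<Gamma>))(x \<mapsto> S) = (s_take v T \<Gamma>)(x \<mapsto> S)"
    by (auto simp: s_take_def)
  then have "strans N ((s_take v T (s_take x (SPre QLin Send T S) \<Gamma>))(x \<mapsto> S)) P W"
    using str_lin_out.IH by metis
  moreover have "s_upd_ok (s_take v T (s_take x (SPre QLin Send T S) \<Gamma>)) x S"
    by (simp add: s_upd_ok_def s_take_def)
  ultimately show ?case using 1 2 by (intro tr_lin_out)
next
  case (str_cli_out \<Gamma> x T v N P W z)
  obtain \<Gamma>1 where 1: "s_split \<Gamma> \<Gamma>1 (s_take x (star Send T) \<Gamma>)" "s_var \<Gamma>1 x (star Send T)"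
    using str_cli_out(1) by (rule ex_split_s_var)
  obtain \<Gamma>2 where 2: "s_split \<Gamma> \<Gamma>2 (s_take v T \<Gamma>)" "s_var \<Gamma>2 v T"
    using str_cli_out(2) by (rule ex_split_s_var)
  have "v = x \<Longrightarrow> s_un T"
    using str_cli_out(1,2) by (metis option.inject s_un_simps(3))
  then have "(s_take v T \<Gamma>) x = Some (star Send T)"
    using str_cli_out(1,2) by (auto simp: s_take_def)
  moreover from this have "(s_take v T \<Gamma>)(x \<mapsto> star Send T) = s_take v T \<Gamma>" by auto
  moreover have "s_take x (star Send T) \<Gamma> = \<Gamma>" by (simp add: s_take_def)
  ultimately show ?case
    using 1 2 str_cli_out by (intro tr_cli_out) (auto simp: s_upd_ok_def)
qed (auto intro: strans.intros)

text \<open>The source of the session typing of the reduct: it is read off its translation, whose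
  rules carry the premises of the typing rules. Only star types have to be unfolded once.\<close>

lemma strans_styped: "strans N \<Gamma> P W \<Longrightarrow> \<Gamma> \<turnstile>\<^sub>s P"
proof (induction rule: strans.induct)
  case (tr_srv_in \<Gamma> \<Gamma>1 \<Gamma>2 x T N P W)
  then have "s_var \<Gamma>1 x (SPre QUn Recv T (star Recv T))" using star.code by metis
  with tr_srv_in show ?case by (auto intro!: st_in simp: s_qual_ctx_def)
next
  case (tr_cli_out \<Gamma> \<Gamma>1 \<Gamma>' \<Gamma>2 \<Gamma>3 x T v N P W z)
  then have "s_var \<Gamma>1 x (SPre QUn Send T (star Send T))" using star.code by metis
  with tr_cli_out show ?case by (intro st_out)
next
  case (tr_lin_in \<Gamma> \<Gamma>1 \<Gamma>2 x T S N P W)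
  then show ?case by (intro st_in) (simp_all add: s_qual_ctx_def)
next
  case (tr_un_in \<Gamma> \<Gamma>1 \<Gamma>2 x q T S N P W)
  then show ?case by (intro st_in)
next
  case (tr_lin_out \<Gamma> \<Gamma>1 \<Gamma>' \<Gamma>2 \<Gamma>3 x T S v N P W)
  then show ?case by (intro st_out)
qed (auto intro: styped.intros)

lemma str_sfn: "str N \<Gamma> P W \<Longrightarrow> n \<in> sfn P \<Longrightarrow> n \<in> dom \<Gamma>"
proof (induction arbitrary: n rule: str.induct)
  case (str_par \<Gamma> \<Gamma>1 \<Gamma>2 N P W1 Q W2)
  then show ?case using s_split_dom[OF str_par(1)] by (auto dest!: subsetD)
next
  case (str_res T N \<Gamma> P W)
  then show ?case using str_res.IH[of "Suc (Suc n)"] by simp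
next
  case (str_lin_in \<Gamma> x T S N P W)
  then show ?case using str_lin_in.IH[of "Suc n"] by (auto simp del: domIff)
next
  case (str_srv_in \<Gamma> x T N P W)
  then show ?case using str_srv_in.IH[of "Suc n"] by (auto simp del: domIff)
next
  case (str_un_in \<Gamma> x T N P W)
  then show ?case using str_un_in.IH[of "Suc n"] by (auto simp del: domIff)
qed (auto simp: s_take_def split: if_splits)

text \<open>The only free names of a translation outside the context are the objects
  \<open>z\<close> of client outputs, and these are out of scope. In particular a linear name that
  went to the other side of a split does not occur, so replacing it has no effect.\<close>

lemma str_wfn: "str N \<Gamma> P W \<Longrightarrow> n \<in> wfn W \<Longrightarrow> n \<in> N \<Longrightarrow> n \<in> dom \<Gamma>"
proof (induction arbitrary: n rule: str.induct)
  case (str_par \<Gamma> \<Gamma>1 \<Gamma>2 N P W1 Q W2)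
  then show ?case using s_split_dom[OF str_par(1)] by (auto dest!: subsetD)
next
  case (str_res T N \<Gamma> P W)
  obtain m where m: "m \<in> wfn W" "Suc n = case_nat 0 id m" using str_res.prems(1) by auto
  from m(2) have "m = Suc (Suc n)" by (cases m) simp_all
  then show ?case using str_res.IH[of m] m(1) str_res.prems(2) by (simp del: domIff)
next
  case (str_lin_in \<Gamma> x T S N P W)
  show ?case
  proof (cases "n = x")
    case False
    then obtain m where m: "m \<in> wfn W" "Suc (Suc n) = case_nat 0 ((\<lambda>n. Suc (Suc n))(x := Suc 0)) m"
      using str_lin_in.prems by auto
    from m(2) have "m = Suc n" by (cases m) (simp_all split: if_splits)
    then show ?thesis using str_lin_in.IH[of m] m str_lin_in.prems False by auto
  qed (use str_lin_in in auto)
next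
  case (str_srv_in \<Gamma> x T N P W)
  show ?case
  proof (cases "n = x")
    case False
    then obtain m where m: "m \<in> wfn W" "Suc (Suc n) = case_nat 0 (\<lambda>n. Suc (Suc n)) m"
      using str_srv_in.prems by auto
    from m(2) have "m = Suc n" by (cases m) simp_all
    then show ?thesis using str_srv_in.IH[of m] m str_srv_in.prems by auto
  qed (use str_srv_in in auto)
next
  case (str_un_in \<Gamma> x T N P W)
  show ?case
  proof (cases "n = x")
    case False
    then obtain m where m: "m \<in> wfn W" "Suc (Suc n) = case_nat 0 (\<lambda>n. Suc (Suc n)) m"
      using str_un_in.prems by auto
    from m(2) have "m = Suc n" by (cases m) simp_all
    then show ?thesis using str_un_in.IH[of m] m str_un_in.prems by auto
  qed (use str_un_in in auto)
next
  case (str_lin_out \<Gamma> x T S v N P W)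
  show ?case
  proof (cases "n = x \<or> n = v")
    case False
    then have "n \<in> wfn W" using str_lin_out.prems by (auto split: if_splits)
    then have "s_take v T \<Gamma> n \<noteq> None"
      using str_lin_out.IH[of n] str_lin_out.prems(2) False by auto
    then show ?thesis using dom_s_take[of v T \<Gamma>] by blast
  qed (use str_lin_out in auto)
next
  case (str_cli_out \<Gamma> x T v N P W z)
  then show ?case using dom_s_take[of v T \<Gamma>] by (auto simp del: domIff)
qed auto

section \<open>Renaming of session processes together with their translations\<close>

definition sren_ok :: "(name \<Rightarrow> name) \<Rightarrow> sctx \<Rightarrow> sctx \<Rightarrow> bool" where
  "sren_ok f \<Gamma> \<Gamma>' \<longleftrightarrow>
     (\<forall>x T. \<Gamma> x = Some T \<longrightarrow> \<Gamma>' (f x) = Some T) \<and>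
     (\<forall>x T x'. \<Gamma> x = Some T \<longrightarrow> \<not> s_un T \<longrightarrow> f x' = f x \<longrightarrow> \<Gamma> x' \<noteq> None \<longrightarrow> x' = x) \<and>
     (\<forall>y T. \<Gamma>' y = Some T \<longrightarrow> \<not> s_un T \<longrightarrow> (\<exists>x. f x = y \<and> \<Gamma> x = Some T))"

lemma sren_okD:
  assumes "sren_ok f \<Gamma> \<Gamma>'"
  shows "\<Gamma> x = Some T \<Longrightarrow> \<Gamma>' (f x) = Some T"
    and "\<Gamma> x = Some T \<Longrightarrow> \<not> s_un T \<Longrightarrow> f x' = f x \<Longrightarrow> \<Gamma> x' = Some T' \<Longrightarrow> x' = x"
    and "\<Gamma>' y = Some T \<Longrightarrow> \<not> s_un T \<Longrightarrow> \<exists>x. f x = y \<and> \<Gamma> x = Some T"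
  using assms unfolding sren_ok_def by blast+

text \<open>Under these conditions linear entries are mapped one to one and none is added, while
  unrestricted entries of the same type may be identified and others added. This covers substitution
  of a received name and weakening at once.\<close>

lemma sren_okI:
  assumes "\<And>x T. \<Gamma> x = Some T \<Longrightarrow> \<Gamma>' (f x) = Some T"
    and "\<And>x T x' T'. \<Gamma> x = Some T \<Longrightarrow> \<not> s_un T \<Longrightarrow> f x' = f x \<Longrightarrow> \<Gamma> x' = Some T' \<Longrightarrow> x' = x"
    and "\<And>y T. \<Gamma>' y = Some T \<Longrightarrow> \<not> s_un T \<Longrightarrow> \<exists>x. f x = y \<and> \<Gamma> x = Some T"
  shows "sren_ok f \<Gamma> \<Gamma>'"
  using assms unfolding sren_ok_def by blast

lemma sren_ok_qual: "sren_ok f \<Gamma> \<Gamma>' \<Longrightarrow> s_qual_ctx QUn \<Gamma> \<Longrightarrow> s_qual_ctx QUn \<Gamma>'"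
  unfolding s_qual_ctx_QUn by (metis sren_okD(3))

lemma ext_eq_Some: "ext a \<Gamma> n = Some T \<longleftrightarrow> (n = 0 \<and> T = a) \<or> (\<exists>m. n = Suc m \<and> \<Gamma> m = Some T)"
  by (cases n) auto

lemma up_eq_0 [simp]: "up f n = 0 \<longleftrightarrow> n = 0" "0 = up f n \<longleftrightarrow> n = 0"
  by (cases n; simp)+

lemma sren_ok_ext:
  assumes "sren_ok f \<Gamma> \<Gamma>'"
  shows "sren_ok (up f) (ext T \<Gamma>) (ext T \<Gamma>')"
proof (rule sren_okI)
  show "ext T \<Gamma>' (up f x) = Some U" if "ext T \<Gamma> x = Some U" for x U
    using that sren_okD(1)[OF assms] by (auto simp: ext_eq_Some)
  show "x' = x" if "ext T \<Gamma> x = Some U" "\<not> s_un U" "up f x' = up f x" "ext T \<Gamma> x' = Some U'" for x U x' U'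
    using that sren_okD(2)[OF assms] by (auto simp: ext_eq_Some)
  show "\<exists>x. up f x = y \<and> ext T \<Gamma> x = Some U" if y: "ext T \<Gamma>' y = Some U" "\<not> s_un U" for y U
  proof (cases y)
    case (Suc m)
    then obtain x where "f x = m" "\<Gamma> x = Some U" using y sren_okD(3)[OF assms, of m U] by auto
    then show ?thesis using Suc by (intro exI[of _ "Suc x"]) simp
  qed (use y in \<open>auto intro: exI[of _ 0]\<close>)
qed

lemma sren_ok_upd:
  assumes "sren_ok f \<Gamma> \<Gamma>'" "\<Gamma> x = Some T" "\<not> s_un T"
  shows "sren_ok f (\<Gamma>(x := e)) (\<Gamma>'(f x := e))"
proof (rule sren_okI)
  note D = sren_okD[OF assms(1)]
  show "(\<Gamma>'(f x := e)) (f y) = Some U" if "(\<Gamma>(x := e)) y = Some U" for y U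
    using that D(1) D(2)[OF assms(2,3)] by (auto split: if_splits)
  show "z = y" if "(\<Gamma>(x := e)) y = Some U" "\<not> s_un U" "f z = f y" "(\<Gamma>(x := e)) z = Some U'" for y U z U'
    using that D(2) D(2)[OF assms(2,3)] by (auto split: if_splits)
  show "\<exists>z. f z = y \<and> (\<Gamma>(x := e)) z = Some U" if y: "(\<Gamma>'(f x := e)) y = Some U" "\<not> s_un U" for y U
  proof (cases "y = f x")
    case False
    then obtain z where "f z = y" "\<Gamma> z = Some U" using y D(3)[of y U] by auto
    then show ?thesis using False by (intro exI[of _ z]) auto
  qed (use y in \<open>auto intro: exI[of _ x]\<close>)
qed

lemma sren_ok_take:
  assumes "sren_ok f \<Gamma> \<Gamma>'" "\<Gamma> v = Some T"
  shows "sren_ok f (s_take v T \<Gamma>) (s_take (f v) T \<Gamma>')"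
  using assms sren_ok_upd[OF assms(1,2)] by (simp add: s_take_def)

lemma sren_ok_split:
  assumes "sren_ok f \<Gamma> \<Gamma>'" "s_split \<Gamma> \<Gamma>1 \<Gamma>2"
  obtains \<Gamma>1' \<Gamma>2' where "s_split \<Gamma>' \<Gamma>1' \<Gamma>2'" "sren_ok f \<Gamma>1 \<Gamma>1'" "sren_ok f \<Gamma>2 \<Gamma>2'"
proof
  note D = sren_okD[OF assms(1)]
  \<comment> \<open>A linear entry of \<open>\<Gamma>'\<close> has just one preimage in
    \<open>\<Gamma>\<close> and goes to the side owning that; unrestricted entries go to both
    sides.\<close>
  define r where "r \<Delta> y = (case \<Gamma>' y of None \<Rightarrow> None | Some T \<Rightarrow>
      if s_un T \<or> (\<exists>x. f x = y \<and> \<Delta> x = Some T) then Some T else None)" for \<Delta> :: sctx and y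
  have r: "sren_ok f \<Delta> (r \<Delta>)" if le: "\<And>x T. \<Delta> x = Some T \<Longrightarrow> \<Gamma> x = Some T" for \<Delta>
  proof (rule sren_okI)
    show "r \<Delta> (f x) = Some T" if "\<Delta> x = Some T" for x T
      using that D(1)[OF le[OF that]] by (auto simp: r_def)
    show "x' = x" if "\<Delta> x = Some T" "\<not> s_un T" "f x' = f x" "\<Delta> x' = Some T'" for x T x' T'
      using that le D(2) by blast
    show "\<exists>x. f x = y \<and> \<Delta> x = Some T" if "r \<Delta> y = Some T" "\<not> s_un T" for y T
      using that by (auto simp: r_def split: option.splits if_splits)
  qed
  show "sren_ok f \<Gamma>1 (r \<Gamma>1)" "sren_ok f \<Gamma>2 (r \<Gamma>2)"
    using s_split_le[OF assms(2)] by (auto intro: r)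
  show "s_split \<Gamma>' (r \<Gamma>1) (r \<Gamma>2)"
    unfolding s_split_def
  proof
    fix y
    show "s_split_entry (\<Gamma>' y) (r \<Gamma>1 y) (r \<Gamma>2 y)"
    proof (cases "\<exists>T. \<Gamma>' y = Some T \<and> \<not> s_un T")
      case True
      then obtain T where T: "\<Gamma>' y = Some T" "\<not> s_un T" by blast
      then obtain x where x: "f x = y" "\<Gamma> x = Some T" using D(3) by blast
      have uniq: "x' = x" if "f x' = y" "\<Gamma> x' = Some T'" for x' T'
        using D(2)[OF x(2) T(2), of x' T'] that x(1) by simp
      have "(\<exists>x. f x = y \<and> \<Gamma>i x = Some T) \<longleftrightarrow> \<Gamma>i x = Some T" if "\<And>x T. \<Gamma>i x = Some T \<Longrightarrow> \<Gamma> x = Some T" for \<Gamma>i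
        using uniq x(1) that by blast
      from this[OF s_split_le(1)[OF assms(2)]] this[OF s_split_le(2)[OF assms(2)]]
      show ?thesis using s_split_D[OF assms(2), of x] T x
        by (auto simp: r_def s_split_entry_iff)
    next
      case False
      then show ?thesis by (auto simp: r_def s_split_entry_iff split: option.splits)
    qed
  qed
qed

text \<open>Injectivity is demanded outside the scope only: there live the fresh objects of client
  outputs, which must stay fresh, while names in scope may be identified.\<close>

definition scope_map :: "name set \<Rightarrow> name set \<Rightarrow> (name \<Rightarrow> name) \<Rightarrow> bool" where
  "scope_map N N' f \<longleftrightarrow> (\<forall>n. f n \<in> N' \<longleftrightarrow> n \<in> N) \<and> inj_on f (- N)"

lemma scope_map_mem: "scope_map N N' f \<Longrightarrow> f n \<in> N' \<longleftrightarrow> n \<in> N"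
  by (simp add: scope_map_def)

lemma scope_map_eq: "scope_map N N' f \<Longrightarrow> n \<notin> N \<Longrightarrow> f m = f n \<longleftrightarrow> m = n"
  unfolding scope_map_def inj_on_def by (metis ComplI)

lemma mem_scope_cases: "n \<in> scope N \<longleftrightarrow> n = 0 \<or> (\<exists>m. n = Suc m \<and> m \<in> N)"
  by (cases n) auto

lemma scope_map_up: "scope_map N N' f \<Longrightarrow> scope_map (scope N) (scope N') (up f)"
proof -
  assume f: "scope_map N N' f"
  have "up f n \<in> scope N' \<longleftrightarrow> n \<in> scope N" for n
    using scope_map_mem[OF f] by (cases n) auto
  moreover have "inj_on (up f) (- scope N)"
  proof (rule inj_onI)
    fix m n assume "m \<in> - scope N" "n \<in> - scope N" "up f m = up f n"
    then show "m = n" using scope_map_eq[OF f] by (cases m; cases n) auto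
  qed
  ultimately show ?thesis by (simp add: scope_map_def)
qed

text \<open>The delicate cases are the linear prefixes, where the translated continuation has its
  subject replaced. This commutes with \<open>f\<close> only if no other name of the continuation is
  mapped to \<open>f x\<close>.\<close>

lemma str_sren:
  "str N \<Gamma> P W \<Longrightarrow> dom \<Gamma> \<subseteq> N \<Longrightarrow> scope_map N N' f \<Longrightarrow> sren_ok f \<Gamma> \<Gamma>' \<Longrightarrow>
    str N' \<Gamma>' (sren f P) (wren f W)"
proof (induction arbitrary: N' f \<Gamma>' rule: str.induct)
  case (str_nil \<Gamma> N)
  then show ?case using sren_ok_qual by (auto intro: str.str_nil)
next
  case (str_par \<Gamma> \<Gamma>1 \<Gamma>2 N P W1 Q W2)
  obtain \<Gamma>1' \<Gamma>2' where "s_split \<Gamma>' \<Gamma>1' \<Gamma>2'" "sren_ok f \<Gamma>1 \<Gamma>1'" "sren_ok f \<Gamma>2 \<Gamma>2'"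
    using sren_ok_split[OF str_par.prems(3) str_par(1)] .
  moreover have "dom \<Gamma>1 \<subseteq> N" "dom \<Gamma>2 \<subseteq> N"
    using s_split_dom[OF str_par(1)] str_par.prems(1) by simp_all
  ultimately show ?case
    using str_par.IH str_par.prems(2) by (auto intro!: str.str_par)
next
  case (str_res T N \<Gamma> P W)
  have "str (scope (scope N')) (ext T (ext (sdual T) \<Gamma>')) (sren (up (up f)) P) (wren (up (up f)) W)"
    using str_res.prems by (intro str_res.IH dom_ext_subset scope_map_up sren_ok_ext)
  from str.str_res[OF str_res(1) this]
  have "str N' \<Gamma>' (sren f (SRes P)) (WNu (wren (\<lambda>n. case_nat 0 id (up (up f) n)) W))" by simp
  moreover have "(\<lambda>n. case_nat 0 id (up (up f) n)) = (\<lambda>n. up f (case_nat 0 id n))"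
    by (auto simp: fun_eq_iff split: nat.split)
  ultimately show ?case by simp
next
  case (str_lin_in \<Gamma> x T S N P W)
  have x: "x \<in> N" using str_lin_in by auto
  have dom: "dom (ext T (\<Gamma>(x \<mapsto> S))) \<subseteq> scope N"
    using str_lin_in.prems x by (intro dom_ext_subset) auto
  have "str (scope N') (ext T (\<Gamma>'(f x \<mapsto> S))) (sren (up f) P) (wren (up f) W)"
    using str_lin_in.prems str_lin_in(1) dom
    by (intro str_lin_in.IH scope_map_up sren_ok_ext sren_ok_upd) auto
  from str.str_lin_in[OF sren_okD(1)[OF str_lin_in.prems(3) str_lin_in(1)] this]
  have "str N' \<Gamma>' (sren f (SIn QLin x P)) (WIn (f x)
     (wren (\<lambda>n. case_nat 0 ((\<lambda>n. Suc (Suc n))(f x := Suc 0)) (up f n)) W))" by simp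
  moreover have "wren (\<lambda>n. case_nat 0 ((\<lambda>n. Suc (Suc n))(f x := Suc 0)) (up f n)) W =
    wren (\<lambda>n. up (up f) (case_nat 0 ((\<lambda>n. Suc (Suc n))(x := Suc 0)) n)) W"
  proof (rule wren_cong)
    fix n assume n: "n \<in> wfn W"
    show "case_nat 0 ((\<lambda>n. Suc (Suc n))(f x := Suc 0)) (up f n) =
      up (up f) (case_nat 0 ((\<lambda>n. Suc (Suc n))(x := Suc 0)) n)"
    proof (cases n)
      case (Suc m)
      \<comment> \<open>A name mapped to \<open>f x\<close> is in scope because \<open>x\<close> is.
        By \<open>str_wfn\<close> it is then \<open>x\<close> or in the context, and a linear entry
        is not identified with another one.\<close>
      have "m = x" if "f m = f x"
      proof -
        have "m \<in> N" using that x scope_map_mem[OF str_lin_in.prems(2)] by metis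
        then have "m = x \<or> m \<in> dom \<Gamma>" using str_wfn[OF str_lin_in(2) n] Suc by auto
        then show ?thesis
          using sren_okD(2)[OF str_lin_in.prems(3) str_lin_in(1) _ that] by auto
      qed
      then show ?thesis using Suc by auto
    qed simp
  qed
  ultimately show ?case by simp
next
  case (str_srv_in \<Gamma> x T N P W)
  have "str (scope N') (ext T \<Gamma>') (sren (up f) P) (wren (up f) W)"
    using str_srv_in.prems by (intro str_srv_in.IH scope_map_up sren_ok_ext dom_ext_subset)
  from str.str_srv_in[OF sren_okD(1)[OF str_srv_in.prems(3) str_srv_in(1)] this]
  have "str N' \<Gamma>' (sren f (SIn QLin x P)) (WIn (f x)
     (wren (\<lambda>n. case_nat 0 (\<lambda>n. Suc (Suc n)) (up f n)) W))" by simp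
  moreover have "(\<lambda>n. case_nat 0 (\<lambda>n. Suc (Suc n)) (up f n)) =
    (\<lambda>n. up (up f) (case_nat 0 (\<lambda>n. Suc (Suc n)) n))"
    by (auto simp: fun_eq_iff split: nat.split)
  ultimately show ?case by simp
next
  case (str_un_in \<Gamma> x T N P W)
  have "str (scope N') (ext T \<Gamma>') (sren (up f) P) (wren (up f) W)"
    using str_un_in.prems by (intro str_un_in.IH scope_map_up sren_ok_ext dom_ext_subset)
  from str.str_un_in[OF sren_ok_qual[OF str_un_in.prems(3) str_un_in(1)]
      sren_okD(1)[OF str_un_in.prems(3) str_un_in(2)] this]
  have "str N' \<Gamma>' (sren f (SIn QUn x P)) (WRep (f x)
     (wren (\<lambda>n. case_nat 0 (\<lambda>n. Suc (Suc n)) (up f n)) W))" by simp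
  moreover have "(\<lambda>n. case_nat 0 (\<lambda>n. Suc (Suc n)) (up f n)) =
    (\<lambda>n. up (up f) (case_nat 0 (\<lambda>n. Suc (Suc n)) n))"
    by (auto simp: fun_eq_iff split: nat.split)
  ultimately show ?case by simp
next
  case (str_lin_out \<Gamma> x T S v N P W)
  note D = sren_okD[OF str_lin_out.prems(3)]
  have x: "x \<in> N" using str_lin_out by auto
  have dom: "dom ((s_take v T \<Gamma>)(x \<mapsto> S)) \<subseteq> N"
    using str_lin_out.prems x dom_s_take[of v T \<Gamma>] by auto
  have "s_take v T \<Gamma> x = Some (SPre QLin Send T S)" using str_lin_out by (simp add: s_take_def)
  then have "sren_ok f ((s_take v T \<Gamma>)(x \<mapsto> S)) ((s_take (f v) T \<Gamma>')(f x \<mapsto> S))"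
    using str_lin_out by (intro sren_ok_upd sren_ok_take) auto
  with str_lin_out.prems dom
  have IH: "str N' ((s_take (f v) T \<Gamma>')(f x \<mapsto> S)) (sren f P) (wren f W)"
    by (intro str_lin_out.IH)
  have "f v \<noteq> f x" using D(2)[OF str_lin_out(1) _ _ str_lin_out(3)] str_lin_out(2) by auto
  from str.str_lin_out[OF D(1)[OF str_lin_out(1)] this D(1)[OF str_lin_out(3)] IH]
  have "str N' \<Gamma>' (sren f (SOut x v P))
    (WNu (WOut (Suc (f x)) (Suc (f v)) 0 (wren (\<lambda>n. (Suc(f x := 0)) (f n)) W)))" by simp
  moreover have "wren (\<lambda>n. (Suc(f x := 0)) (f n)) W = wren (\<lambda>n. up f ((Suc(x := 0)) n)) W"
  proof (rule wren_cong)
    fix n assume n: "n \<in> wfn W"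
    have "n = x" if "f n = f x"
    proof -
      have "n \<in> N" using that x scope_map_mem[OF str_lin_out.prems(2)] by metis
      then have "n = x \<or> n \<in> dom \<Gamma>"
        using str_wfn[OF str_lin_out(4) n] dom_s_take[of v T \<Gamma>] by auto
      then show ?thesis using D(2)[OF str_lin_out(1) _ that] by auto
    qed
    then show "(Suc(f x := 0)) (f n) = up f ((Suc(x := 0)) n)" by auto
  qed
  ultimately show ?case by simp
next
  case (str_cli_out \<Gamma> x T v N P W z)
  note D = sren_okD[OF str_cli_out.prems(3)]
  have "str N' (s_take (f v) T \<Gamma>') (sren f P) (wren f W)"
    using str_cli_out dom_s_take[of v T \<Gamma>] by (intro str_cli_out.IH sren_ok_take) auto
  moreover have "f z \<notin> N'" using str_cli_out scope_map_mem by simp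
  moreover have "f z \<notin> wfn (wren f W)"
    using str_cli_out(5) scope_map_eq[OF str_cli_out.prems(2) str_cli_out(4)] unfolding wfn_wren
    by (metis imageE)
  ultimately show ?case
    using str.str_cli_out[of \<Gamma>' "f x" T "f v" N' "sren f P" "wren f W" "f z"]
      D(1)[OF str_cli_out(1)] D(1)[OF str_cli_out(2)] by simp
qed

lemma str_weaken:
  assumes "str N \<Gamma> P W" "dom \<Gamma> \<subseteq> N" "\<And>x T. \<Gamma> x = Some T \<Longrightarrow> \<Gamma>' x = Some T"
    "\<And>x T. \<Gamma>' x = Some T \<Longrightarrow> \<Gamma> x \<noteq> Some T \<Longrightarrow> s_un T"
  shows "str N \<Gamma>' P W"
  using str_sren[OF assms(1,2), of N "\<lambda>n. n" \<Gamma>'] assms(3,4)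
  by (auto simp: scope_map_def sren_ok_def)

section \<open>Outputs of translated processes\<close>

text \<open>The renaming \<open>f\<close> lifted past \<open>k\<close> extruded names, which occupy
  the indices below \<open>k\<close> in label and residual.\<close>

definition upk :: "nat \<Rightarrow> (name \<Rightarrow> name) \<Rightarrow> name \<Rightarrow> name" where
  "upk k f n = (if n < k then n else f (n - k) + k)"

lemma upk_0 [simp]: "upk 0 f = f"
  by (simp add: upk_def fun_eq_iff)

lemma upk_up: "upk k (up f) = upk (Suc k) f"
proof
  fix n show "upk k (up f) n = upk (Suc k) f n"
  proof (cases "n \<le> k")
    case False
    then have "n - k = Suc (n - Suc k)" by simp
    then show ?thesis using False by (simp add: upk_def del: diff_Suc_Suc)
  qed (auto simp: upk_def)
qed

lemma skip_upk: "skip k (upk k f n) = upk (Suc k) f (skip k n)"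
  by (auto simp: skip_def upk_def)

lemma rot_upk: "rot k (upk (Suc k) f n) = up (upk k f) (rot k n)"
proof -
  consider "n \<le> k" | m where "n = Suc m" "k \<le> m"
    by (metis not_less_eq_eq not0_implies_Suc le0)
  then show ?thesis by cases (auto simp: rot_def upk_def)
qed

lemma wtrans_out_wren_aux:
  "P \<midarrow>\<alpha>\<rightarrow>\<^sub>w P' \<Longrightarrow> \<alpha> = LOut k x y z \<Longrightarrow>
    wren f P \<midarrow>LOut k (upk k f x) (upk k f y) (upk k f z)\<rightarrow>\<^sub>w wren (upk k f) P'"
proof (induction arbitrary: f k x y z rule: wtrans.induct)
  case (wt_out x y1 y2 P)
  then show ?case by (auto intro: wtrans.wt_out)
next
  case (wt_open P j x' y1 y2 P')
  then have eq: "k = Suc j" "x' = x" "y1 = y" "y2 = z" by auto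
  have "wren (up f) P \<midarrow>LOut j (upk k f x) (upk k f y) (upk k f z)\<rightarrow>\<^sub>w wren (upk k f) P'"
    using wt_open.IH[of j x' y1 y2 "up f"] by (simp add: upk_up eq)
  \<comment> \<open>As the first \<open>Suc j\<close> names are kept fixed, the opened index
    \<open>j\<close> stays apart from all others even if \<open>f\<close> is not injective.\<close>
  moreover have "upk k f x \<noteq> j" "j = upk k f y \<or> j = upk k f z"
    using wt_open(2,3) by (auto simp: upk_def eq)
  ultimately show ?case unfolding eq wren.simps by (intro wtrans.wt_open)
next
  case (wt_res_out P j x' y1 y2 P')
  then have eq: "j = k" "x' = x" "y1 = y" "y2 = z" by auto
  have "wren (up f) P \<midarrow>LOut k (skip k (upk k f x)) (skip k (upk k f y)) (skip k (upk k f z))\<rightarrow>\<^sub>w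
    wren (upk (Suc k) f) P'"
    using wt_res_out.IH[of k "skip k x" "skip k y" "skip k z" "up f"] by (simp add: upk_up eq skip_upk)
  then have "wren f (WNu P) \<midarrow>LOut k (upk k f x) (upk k f y) (upk k f z)\<rightarrow>\<^sub>w
    WNu (wren (rot k) (wren (upk (Suc k) f) P'))"
    unfolding wren.simps by (rule wtrans.wt_res_out)
  then show ?case by (simp add: rot_upk eq)
next
  case (wt_parL_out P j x' y1 y2 P' Q)
  have "wren (upk k f) (wren (\<lambda>n. n + j) Q) = wren (\<lambda>n. n + k) (wren f Q)"
    using wt_parL_out.prems by (simp add: upk_def)
  then show ?case
    using wtrans.wt_parL_out[OF wt_parL_out.IH[OF wt_parL_out.prems, of f], of "wren f Q"] wt_parL_out.prems
    by simp
next
  case (wt_parR_out Q j x' y1 y2 Q' P)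
  have "wren (upk k f) (wren (\<lambda>n. n + j) P) = wren (\<lambda>n. n + k) (wren f P)"
    using wt_parR_out.prems by (simp add: upk_def)
  then show ?case
    using wtrans.wt_parR_out[OF wt_parR_out.IH[OF wt_parR_out.prems, of f], of "wren f P"] wt_parR_out.prems
    by simp
qed simp_all

lemma wtrans_out_wren:
  "P \<midarrow>LOut k x y z\<rightarrow>\<^sub>w P' \<Longrightarrow>
    wren f P \<midarrow>LOut k (upk k f x) (upk k f y) (upk k f z)\<rightarrow>\<^sub>w wren (upk k f) P'"
  by (rule wtrans_out_wren_aux) simp_all

definition swap01 :: "name \<Rightarrow> name" where
  "swap01 = id(0 := 1, 1 := 0)"

lemma upk_swap01_skip: "upk j swap01 (skip (Suc j) n) = skip j n"
proof -
  consider "n < j" | "n = j" | "j < n" by linarith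
  then show ?thesis by cases (auto simp: upk_def skip_def swap01_def)
qed

lemma rot_upk_swap01: "rot j (upk j swap01 n) = rot (Suc j) n"
proof -
  consider "n < j" | "n = j" | "n = Suc j" | "Suc j < n" by linarith
  then show ?thesis by cases (auto simp: upk_def rot_def swap01_def)
qed

text \<open>Exchanges two restrictions: the outer one is extruded last.\<close>
lemma wtrans_out_swap:
  assumes "P \<midarrow>LOut j (skip (Suc j) a) (skip (Suc j) b) (skip (Suc j) c)\<rightarrow>\<^sub>w P'"
  shows "WNu (wren swap01 P) \<midarrow>LOut j a b c\<rightarrow>\<^sub>w WNu (wren (rot (Suc j)) P')"
proof -
  have "WNu (wren swap01 P) \<midarrow>LOut j a b c\<rightarrow>\<^sub>w WNu (wren (rot j) (wren (upk j swap01) P'))"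
    using wtrans_out_wren[OF assms, of swap01] unfolding upk_swap01_skip by (rule wt_res_out)
  then show ?thesis by (simp add: rot_upk_swap01)
qed

inductive_cases wtrans_NilE: "WNil \<midarrow>\<alpha>\<rightarrow>\<^sub>w U"
inductive_cases wtrans_Out_outE: "WOut x v z P \<midarrow>LOut k a b c\<rightarrow>\<^sub>w U"
inductive_cases wtrans_Out_inE: "WOut x v z P \<midarrow>LIn a b c\<rightarrow>\<^sub>w U"
inductive_cases wtrans_Out_tauE: "WOut x v z P \<midarrow>Tau\<rightarrow>\<^sub>w U"
inductive_cases wtrans_In_outE: "WIn x P \<midarrow>LOut k a b c\<rightarrow>\<^sub>w U"
inductive_cases wtrans_In_inE: "WIn x P \<midarrow>LIn a b c\<rightarrow>\<^sub>w U"
inductive_cases wtrans_In_tauE: "WIn x P \<midarrow>Tau\<rightarrow>\<^sub>w U"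
inductive_cases wtrans_Rep_outE: "WRep x P \<midarrow>LOut k a b c\<rightarrow>\<^sub>w U"
inductive_cases wtrans_Rep_inE: "WRep x P \<midarrow>LIn a b c\<rightarrow>\<^sub>w U"
inductive_cases wtrans_Rep_tauE: "WRep x P \<midarrow>Tau\<rightarrow>\<^sub>w U"
inductive_cases wtrans_Par_outE [consumes 1, case_names left right]: "WPar P Q \<midarrow>LOut k a b c\<rightarrow>\<^sub>w U"
inductive_cases wtrans_Par_inE [consumes 1, case_names left right]: "WPar P Q \<midarrow>LIn a b c\<rightarrow>\<^sub>w U"
inductive_cases wtrans_Par_tauE [consumes 1, case_names left right comL comR]: "WPar P Q \<midarrow>Tau\<rightarrow>\<^sub>w U"
inductive_cases wtrans_Nu_outE [consumes 1, case_names opened res]: "WNu P \<midarrow>LOut k a b c\<rightarrow>\<^sub>w U"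
inductive_cases wtrans_Nu_inE: "WNu P \<midarrow>LIn a b c\<rightarrow>\<^sub>w U"
inductive_cases wtrans_Nu_tauE: "WNu P \<midarrow>Tau\<rightarrow>\<^sub>w U"

text \<open>
  The renaming under the restriction of a translated \<open>(\<nu>xy)P\<close>: both co-variables become the index 0.
\<close>
definition join :: "(name \<Rightarrow> name) \<Rightarrow> name \<Rightarrow> name" where
  "join f n = up f (case_nat 0 id n)"

lemma join_simps [simp]: "join f 0 = 0" "join f (Suc 0) = 0" "join f (Suc (Suc n)) = Suc (f n)"
  by (simp_all add: join_def)

lemma wren_res: "wren f (WNu (wren (case_nat 0 id) W)) = WNu (wren (join f) W)"
  by (simp add: join_def[abs_def])

lemma nat2_cases: "(n = 0 \<Longrightarrow> R) \<Longrightarrow> (n = Suc 0 \<Longrightarrow> R) \<Longrightarrow> (\<And>m. n = Suc (Suc m) \<Longrightarrow> R) \<Longrightarrow> R"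
  by (metis not0_implies_Suc)

lemma Suc_eq_join: "Suc a = join f x \<longleftrightarrow> (\<exists>y. x = Suc (Suc y) \<and> a = f y)"
  by (rule nat2_cases[of x]) auto

lemma not_scope2: "n \<notin> scope (scope N) \<longleftrightarrow> (\<exists>m. n = Suc (Suc m) \<and> m \<notin> N)"
  by (rule nat2_cases[of n]) auto

section \<open>Residuals of outputs of a translated process\<close>

definition s_give :: "name \<Rightarrow> stype \<Rightarrow> sctx \<Rightarrow> sctx" where
  "s_give x S \<Gamma> = (if s_un S then \<Gamma>(x \<mapsto> S) else \<Gamma>)"

text \<open>The continuation type may be unrestricted although \<open>T\<close> is linear, like
  \<open>end\<close> after the last action. Then \<open>x\<close> has to appear on the other side as
  well, which is what \<open>s_give\<close> does.\<close>

lemma s_split_upd: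
  assumes "s_split \<Gamma> \<Gamma>1 \<Gamma>2" "\<Gamma>1 x = Some T" "\<not> s_un T"
  shows "s_split (\<Gamma>(x \<mapsto> S)) (\<Gamma>1(x \<mapsto> S)) (s_give x S \<Gamma>2)"
  unfolding s_split_def
proof
  fix y show "s_split_entry ((\<Gamma>(x \<mapsto> S)) y) ((\<Gamma>1(x \<mapsto> S)) y) (s_give x S \<Gamma>2 y)"
    using s_split_D[OF assms(1), of y] s_split_lin[OF assms]
    by (cases "y = x") (auto simp: s_give_def s_split_entry_iff split: option.splits if_splits)
qed

lemma s_split_take:
  assumes "s_split \<Gamma> \<Gamma>1 \<Gamma>2" "\<Gamma>1 v = Some T"
  shows "s_split (s_take v T \<Gamma>) (s_take v T \<Gamma>1) \<Gamma>2"
  unfolding s_split_def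
proof
  fix y show "s_split_entry (s_take v T \<Gamma> y) (s_take v T \<Gamma>1 y) (\<Gamma>2 y)"
    using s_split_D[OF assms(1), of y] s_split_lin[OF assms] assms(2)
    by (cases "y = v") (auto simp: s_take_def s_split_entry_iff split: option.splits if_splits)
qed

lemma str_give:
  assumes "str N \<Gamma> P W" "dom \<Gamma> \<subseteq> N" "\<Gamma> x = None"
  shows "str N (s_give x S \<Gamma>) P W"
  by (rule str_weaken[OF assms(1,2)]) (use assms(3) in \<open>auto simp: s_give_def split: if_splits\<close>)

text \<open>The context of a parallel component that is moved under a restriction: linear endpoints
  belong to the other component, unrestricted ones are copied to both.\<close>

definition lift2 :: "stype \<Rightarrow> sctx \<Rightarrow> sctx" where
  "lift2 T \<Gamma> = case_nat (if s_un T then Some T else None)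
     (case_nat (if s_un T then Some (sdual T) else None) \<Gamma>)"

lemma s_split_lift2:
  assumes "s_split \<Gamma> \<Gamma>1 \<Gamma>2"
  shows "s_split (ext T (ext (sdual T) \<Gamma>)) (ext T (ext (sdual T) \<Gamma>1)) (lift2 T \<Gamma>2)"
  unfolding s_split_def
proof
  fix n show "s_split_entry (ext T (ext (sdual T) \<Gamma>) n) (ext T (ext (sdual T) \<Gamma>1) n) (lift2 T \<Gamma>2 n)"
    using s_split_D[OF assms] by (rule_tac nat2_cases[of n]) (auto simp: lift2_def s_split_entry_iff)
qed

lemma str_lift2:
  assumes "str N \<Gamma> P W" "dom \<Gamma> \<subseteq> N"
  shows "str (scope (scope N)) (lift2 T \<Gamma>) (sren shift2 P) (wren shift2 W)"
proof (rule str_sren[OF assms])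
  show "scope_map N (scope (scope N)) shift2"
    by (auto simp: scope_map_def inj_on_def)
  show "sren_ok shift2 \<Gamma> (lift2 T \<Gamma>)"
  proof (rule sren_okI)
    show "\<exists>x. shift2 x = y \<and> \<Gamma> x = Some U" if "lift2 T \<Gamma> y = Some U" "\<not> s_un U" for y U
      using that by (rule_tac nat2_cases[of y]) (auto simp: lift2_def split: if_splits)
  qed (auto simp: lift2_def)
qed

text \<open>The label shows images under \<open>f\<close>, which merges the co-variables of the
  restrictions passed. The names behind them are recorded in the session context, where they are
  still distinct.\<close>

definition out_cli :: "name set \<Rightarrow> sctx \<Rightarrow> (name \<Rightarrow> name) \<Rightarrow> sproc \<Rightarrow> nat \<Rightarrow> name \<Rightarrow> name \<Rightarrow> name \<Rightarrow> wproc \<Rightarrow> bool" where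
  "out_cli N \<Gamma> f P k a b c U \<longleftrightarrow> (\<exists>x v z T P' W'. k = 0 \<and> a = f x \<and> b = f v \<and> c = f z \<and> z \<notin> N \<and>
     \<Gamma> x = Some (star Send T) \<and> \<Gamma> v = Some T \<and> sout x v P P' \<and> str N (s_take v T \<Gamma>) P' W' \<and> U = wren f W')"

text \<open>One name is extruded, the one that the translation creates and sends along. It is the
  index 0 of the residual, and the continuation uses it in place of \<open>x\<close>.\<close>

definition out_lin :: "name set \<Rightarrow> sctx \<Rightarrow> (name \<Rightarrow> name) \<Rightarrow> sproc \<Rightarrow> nat \<Rightarrow> name \<Rightarrow> name \<Rightarrow> name \<Rightarrow> wproc \<Rightarrow> bool" where
  "out_lin N \<Gamma> f P k a b c U \<longleftrightarrow> (\<exists>x v T S P' W'. k = Suc 0 \<and> a = Suc (f x) \<and> b = Suc (f v) \<and> c = 0 \<and>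
     \<Gamma> x = Some (SPre QLin Send T S) \<and> v \<noteq> x \<and> \<Gamma> v = Some T \<and> sout x v P P' \<and>
     str N ((s_take v T \<Gamma>)(x \<mapsto> S)) P' W' \<and> U = wren ((\<lambda>n. Suc (f n))(x := 0)) W')"

text \<open>
  An output that extrudes its payload: the restriction of the payload is moved to the front of \<open>P\<close>.
\<close>
definition out_ext :: "name set \<Rightarrow> sctx \<Rightarrow> (name \<Rightarrow> name) \<Rightarrow> sproc \<Rightarrow> nat \<Rightarrow> name \<Rightarrow> name \<Rightarrow> name \<Rightarrow> wproc \<Rightarrow> bool" where
  "out_ext N \<Gamma> f P k a b c U \<longleftrightarrow> (\<exists>j T P1 W1. k = Suc j \<and> b = j \<and>
     (j = 0 \<and> (\<exists>z. z \<notin> N \<and> c = Suc (f z)) \<or> j = Suc 0 \<and> c = 0) \<and>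
     session_type T \<and> P \<equiv>\<^sub>s SRes P1 \<and> str (scope (scope N)) (ext T (ext (sdual T) \<Gamma>)) P1 W1 \<and>
     wren (join f) W1 \<midarrow>LOut j a b c\<rightarrow>\<^sub>w U)"

lemma out_cli_par:
  assumes "out_cli N \<Gamma>1 f P k a b c U" "s_split \<Gamma> \<Gamma>1 \<Gamma>2" "str N \<Gamma>2 Q W2"
  shows "out_cli N \<Gamma> f (SPar P Q) k a b c (WPar U (wren (\<lambda>n. n + k) (wren f W2)))"
    and "out_cli N \<Gamma> f (SPar Q P) k a b c (WPar (wren (\<lambda>n. n + k) (wren f W2)) U)"
proof -
  obtain x v z T P' W' where 1: "k = 0" "a = f x" "b = f v" "c = f z" "z \<notin> N"
     "\<Gamma>1 x = Some (star Send T)" "\<Gamma>1 v = Some T" "sout x v P P'" "str N (s_take v T \<Gamma>1) P' W'" "U = wren f W'"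
    using assms(1) unfolding out_cli_def by blast
  note 2 = s_split_le(1)[OF assms(2) 1(6)] s_split_le(1)[OF assms(2) 1(7)]
  note 3 = s_split_take[OF assms(2) 1(7)]
  show "out_cli N \<Gamma> f (SPar P Q) k a b c (WPar U (wren (\<lambda>n. n + k) (wren f W2)))"
    unfolding out_cli_def using 1 2 str_par[OF 3 1(9) assms(3)]
    by (intro exI[of _ x] exI[of _ v] exI[of _ z] exI[of _ T] exI[of _ "SPar P' Q"] exI[of _ "WPar W' W2"])
      (simp add: sout_parL)
  show "out_cli N \<Gamma> f (SPar Q P) k a b c (WPar (wren (\<lambda>n. n + k) (wren f W2)) U)"
    unfolding out_cli_def using 1 2 str_par[OF s_split_sym[OF 3] assms(3) 1(9)]
    by (intro exI[of _ x] exI[of _ v] exI[of _ z] exI[of _ T] exI[of _ "SPar Q P'"] exI[of _ "WPar W2 W'"])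
      (simp add: sout_parR)
qed

lemma out_lin_par:
  assumes "out_lin N \<Gamma>1 f P k a b c U" "s_split \<Gamma> \<Gamma>1 \<Gamma>2" "str N \<Gamma>2 Q W2" "dom \<Gamma> \<subseteq> N"
  shows "out_lin N \<Gamma> f (SPar P Q) k a b c (WPar U (wren (\<lambda>n. n + k) (wren f W2)))"
    and "out_lin N \<Gamma> f (SPar Q P) k a b c (WPar (wren (\<lambda>n. n + k) (wren f W2)) U)"
proof -
  obtain x v T S P' W' where 1: "k = Suc 0" "a = Suc (f x)" "b = Suc (f v)" "c = 0"
     "\<Gamma>1 x = Some (SPre QLin Send T S)" "v \<noteq> x" "\<Gamma>1 v = Some T" "sout x v P P'"
     "str N ((s_take v T \<Gamma>1)(x \<mapsto> S)) P' W'" "U = wren ((\<lambda>n. Suc (f n))(x := 0)) W'"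
    using assms(1) unfolding out_lin_def by blast
  note 2 = s_split_le(1)[OF assms(2) 1(5)] s_split_le(1)[OF assms(2) 1(7)]
  have "s_take v T \<Gamma>1 x = Some (SPre QLin Send T S)" using 1(5,6) by (simp add: s_take_def)
  from s_split_upd[OF s_split_take[OF assms(2) 1(7)] this]
  have 3: "s_split ((s_take v T \<Gamma>)(x \<mapsto> S)) ((s_take v T \<Gamma>1)(x \<mapsto> S)) (s_give x S \<Gamma>2)" by simp
  have x2: "\<Gamma>2 x = None" using s_split_lin[OF assms(2) 1(5)] by simp
  have "dom \<Gamma>2 \<subseteq> N" using s_split_dom[OF assms(2)] assms(4) by simp
  then have 4: "str N (s_give x S \<Gamma>2) Q W2" using str_give[OF assms(3)] x2 by blast
  \<comment> \<open>The linear \<open>x\<close> belongs to the sender, so replacing it by 0 leaves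
    the translation of \<open>Q\<close> unaffected.\<close>
  have "x \<notin> wfn W2"
    using str_wfn[OF assms(3), of x] x2 2(1) assms(4) by (auto simp: domI subset_iff)
  then have 5: "wren ((\<lambda>n. Suc (f n))(x := 0)) W2 = wren (\<lambda>n. n + k) (wren f W2)"
    using 1(1) by (auto intro!: wren_cong)
  show "out_lin N \<Gamma> f (SPar P Q) k a b c (WPar U (wren (\<lambda>n. n + k) (wren f W2)))"
    unfolding out_lin_def 5[symmetric] using 1 2 str_par[OF 3 1(9) 4]
    by (intro exI[of _ x] exI[of _ v] exI[of _ T] exI[of _ S] exI[of _ "SPar P' Q"] exI[of _ "WPar W' W2"])
      (simp add: sout_parL)
  show "out_lin N \<Gamma> f (SPar Q P) k a b c (WPar (wren (\<lambda>n. n + k) (wren f W2)) U)"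
    unfolding out_lin_def 5[symmetric] using 1 2 str_par[OF s_split_sym[OF 3] 4 1(9)]
    by (intro exI[of _ x] exI[of _ v] exI[of _ T] exI[of _ S] exI[of _ "SPar Q P'"] exI[of _ "WPar W2 W'"])
      (simp add: sout_parR)
qed

text \<open>The other component is brought under the restriction that is opened: by scope extension
  in the session process, by one more shift in the translation.\<close>

lemma out_ext_par:
  assumes "out_ext N \<Gamma>1 f P k a b c U" "s_split \<Gamma> \<Gamma>1 \<Gamma>2" "str N \<Gamma>2 Q W2" "dom \<Gamma> \<subseteq> N"
  shows "out_ext N \<Gamma> f (SPar P Q) k a b c (WPar U (wren (\<lambda>n. n + k) (wren f W2)))"
    and "out_ext N \<Gamma> f (SPar Q P) k a b c (WPar (wren (\<lambda>n. n + k) (wren f W2)) U)"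
proof -
  obtain j T P1 W1 where 1: "k = Suc j" "b = j"
     "j = 0 \<and> (\<exists>z. z \<notin> N \<and> c = Suc (f z)) \<or> j = Suc 0 \<and> c = 0"
     "session_type T" "P \<equiv>\<^sub>s SRes P1" "str (scope (scope N)) (ext T (ext (sdual T) \<Gamma>1)) P1 W1"
     "wren (join f) W1 \<midarrow>LOut j a b c\<rightarrow>\<^sub>w U"
    using assms(1) unfolding out_ext_def by blast
  have "dom \<Gamma>2 \<subseteq> N" using s_split_dom[OF assms(2)] assms(4) by simp
  note 2 = str_lift2[OF assms(3) this, of T]
  note 3 = s_split_lift2[OF assms(2), of T]
  have 4: "wren (\<lambda>n. n + j) (wren (join f) (wren shift2 W2)) = wren (\<lambda>n. n + k) (wren f W2)"
    by (simp add: 1(1))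
  have c1: "SPar P Q \<equiv>\<^sub>s SRes (SPar P1 (sren shift2 Q))"
    by (rule sc_trans[OF scong_par_cong1[OF 1(5)] sc_res_ext])
  have c2: "SPar Q P \<equiv>\<^sub>s SRes (SPar (sren shift2 Q) P1)"
    by (rule sc_trans[OF scong_par_cong2[OF 1(5)] scong_res_ext_right])
  show "out_ext N \<Gamma> f (SPar P Q) k a b c (WPar U (wren (\<lambda>n. n + k) (wren f W2)))"
    unfolding out_ext_def
    using 1(1-4) c1 str_par[OF 3 1(6) 2] wt_parL_out[OF 1(7), of "wren (join f) (wren shift2 W2)"]
    unfolding 4 wren.simps(5)[symmetric] by blast
  show "out_ext N \<Gamma> f (SPar Q P) k a b c (WPar (wren (\<lambda>n. n + k) (wren f W2)) U)"
    unfolding out_ext_def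
    using 1(1-4) c2 str_par[OF s_split_sym[OF 3] 2 1(6)] wt_parR_out[OF 1(7), of "wren (join f) (wren shift2 W2)"]
    unfolding 4 wren.simps(5)[symmetric] by blast
qed

lemma scope_map_swap_res: "scope_map (scope (scope (scope (scope N)))) (scope (scope (scope (scope N)))) swap_res"
proof -
  have "swap_res n \<in> scope (scope (scope (scope N))) \<longleftrightarrow> n \<in> scope (scope (scope (scope N)))" for n
    by (rule nat2_cases[of n]; rule nat2_cases[of "n - 2"]) (auto simp: swap_res_def numeral_eq_Suc)
  then show ?thesis using inj_swap_res by (auto simp: scope_map_def intro: inj_on_subset)
qed

lemma sren_ok_swap_res: "sren_ok swap_res (ext T (ext T' (ext S (ext S' \<Gamma>)))) (ext S (ext S' (ext T (ext T' \<Gamma>))))"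
proof -
  have *: "ext S (ext S' (ext T (ext T' \<Gamma>))) (swap_res n) = ext T (ext T' (ext S (ext S' \<Gamma>))) n" for n T T' S S'
    by (rule nat2_cases[of n]; rule nat2_cases[of "n - 2"]) (auto simp: swap_res_def numeral_eq_Suc)
  show ?thesis
    by (rule sren_okI) (metis * swap_res_swap_res)+
qed

lemma join_swap_res: "join (join f) (swap_res n) = swap01 (join (join f) n)"
  by (rule nat2_cases[of n]; rule nat2_cases[of "n - 2"]) (auto simp: swap_res_def swap01_def numeral_eq_Suc)

lemma skip_0: "skip 0 n = Suc n"
  by (simp add: skip_def)

lemma rot_0: "rot 0 n = n"
  by (simp add: rot_def)

lemma dom_ext2_subset: "dom \<Gamma> \<subseteq> N \<Longrightarrow> dom (ext T (ext S \<Gamma>)) \<subseteq> scope (scope N)"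
  by (intro dom_ext_subset)

lemma s_take_ext: "s_take (Suc v) T (ext S \<Gamma>) = ext S (s_take v T \<Gamma>)"
  by (simp add: s_take_def)

lemma out_cli_res:
  assumes "out_cli (scope (scope N)) (ext T (ext (sdual T) \<Gamma>)) (join f) P k (skip k a) (skip k b) (skip k c) U"
    "session_type T"
  shows "out_cli N \<Gamma> f (SRes P) k a b c (WNu (wren (rot k) U))"
proof -
  obtain x v z T0 P' W' where 1: "k = 0" "skip k a = join f x" "skip k b = join f v" "skip k c = join f z"
     "z \<notin> scope (scope N)"
     "ext T (ext (sdual T) \<Gamma>) x = Some (star Send T0)" "ext T (ext (sdual T) \<Gamma>) v = Some T0" "sout x v P P'"
     "str (scope (scope N)) (s_take v T0 (ext T (ext (sdual T) \<Gamma>))) P' W'" "U = wren (join f) W'"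
    using assms(1) unfolding out_cli_def by blast
  then obtain x' v' z' where 2: "x = Suc (Suc x')" "v = Suc (Suc v')" "z = Suc (Suc z')"
    "a = f x'" "b = f v'" "c = f z'" by (auto simp: skip_0 Suc_eq_join)
  have "str N (s_take v' T0 \<Gamma>) (SRes P') (WNu (wren (case_nat 0 id) W'))"
    using 1(9) assms(2) by (intro str_res) (simp_all add: 2 s_take_ext)
  then show ?thesis
    unfolding out_cli_def using 1 2
    by (intro exI[of _ x'] exI[of _ v'] exI[of _ z'] exI[of _ T0] exI[of _ "SRes P'"]
        exI[of _ "WNu (wren (case_nat 0 id) W')"])
      (simp add: sout_res wren_res[unfolded wren.simps] rot_0 join_def)
qed

lemma out_lin_res:
  assumes "out_lin (scope (scope N)) (ext T (ext (sdual T) \<Gamma>)) (join f) P k (skip k a) (skip k b) (skip k c) U"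
    "session_type T"
  shows "out_lin N \<Gamma> f (SRes P) k a b c (WNu (wren (rot k) U))"
proof -
  obtain x v T0 S P' W' where 1: "k = Suc 0" "skip k a = Suc (join f x)" "skip k b = Suc (join f v)" "skip k c = 0"
     "ext T (ext (sdual T) \<Gamma>) x = Some (SPre QLin Send T0 S)" "v \<noteq> x"
     "ext T (ext (sdual T) \<Gamma>) v = Some T0" "sout x v P P'"
     "str (scope (scope N)) ((s_take v T0 (ext T (ext (sdual T) \<Gamma>)))(x \<mapsto> S)) P' W'"
     "U = wren ((\<lambda>n. Suc (join f n))(x := 0)) W'"
    using assms(1) unfolding out_lin_def by blast
  have "a = join f x" "a \<noteq> 0" "b = join f v" "b \<noteq> 0" "c = 0"
    using 1(1-4) by (auto simp: skip_def split: if_splits)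
  then obtain x' v' where 2: "x = Suc (Suc x')" "v = Suc (Suc v')" "a = Suc (f x')" "b = Suc (f v')"
    by (metis Suc_eq_join not0_implies_Suc)
  have "str N ((s_take v' T0 \<Gamma>)(x' \<mapsto> S)) (SRes P') (WNu (wren (case_nat 0 id) W'))"
    using 1(9) assms(2) by (intro str_res) (simp_all add: 2 s_take_ext)
  moreover have "WNu (wren (rot k) U) = wren ((\<lambda>n. Suc (f n))(x' := 0)) (WNu (wren (case_nat 0 id) W'))"
  proof -
    \<comment> \<open>With one extruded name \<open>rot\<close> exchanges 0 and 1: the restricted
      name returns to 0, and the transmitted one becomes 1 below the restriction.\<close>
    have "rot k (((\<lambda>n. Suc (join f n))(x := 0)) n) = join ((\<lambda>n. Suc (f n))(x' := 0)) n" for n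
      by (rule nat2_cases[of n]) (auto simp: 1(1) 2 rot_def)
    then show ?thesis unfolding wren_res 1(10) by simp
  qed
  ultimately show ?thesis
    unfolding out_lin_def using 1 2 \<open>c = 0\<close>
    by (intro exI[of _ x'] exI[of _ v'] exI[of _ T0] exI[of _ S] exI[of _ "SRes P'"]
        exI[of _ "WNu (wren (case_nat 0 id) W')"])
      (simp add: sout_res)
qed

text \<open>The opened restriction lies under another one that stays. The two are exchanged so that
  the opened one is outermost again: by \<open>swap_res\<close> for pairs of co-variables, by
  \<open>swap01\<close> for single names of the target.\<close>

lemma out_ext_res:
  assumes "out_ext (scope (scope N)) (ext T (ext (sdual T) \<Gamma>)) (join f) P k (skip k a) (skip k b) (skip k c) U"
    "session_type T" "dom \<Gamma> \<subseteq> N"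
  shows "out_ext N \<Gamma> f (SRes P) k a b c (WNu (wren (rot k) U))"
proof -
  obtain j T1 P1 W1 where 1: "k = Suc j" "skip k b = j"
     "j = 0 \<and> (\<exists>z. z \<notin> scope (scope N) \<and> skip k c = Suc (join f z)) \<or> j = Suc 0 \<and> skip k c = 0"
     "session_type T1" "P \<equiv>\<^sub>s SRes P1"
     "str (scope (scope (scope (scope N)))) (ext T1 (ext (sdual T1) (ext T (ext (sdual T) \<Gamma>)))) P1 W1"
     "wren (join (join f)) W1 \<midarrow>LOut j (skip k a) (skip k b) (skip k c)\<rightarrow>\<^sub>w U"
    using assms(1) unfolding out_ext_def by metis
  have b: "b = j" using 1(1,2) by (auto simp: skip_def split: if_splits)
  have c: "j = 0 \<and> (\<exists>z. z \<notin> N \<and> c = Suc (f z)) \<or> j = Suc 0 \<and> c = 0"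
    using 1(1,3) by (auto simp: skip_def not_scope2 split: if_splits)
  let ?W = "wren swap_res W1"
  have "str (scope (scope (scope (scope N)))) (ext T (ext (sdual T) (ext T1 (ext (sdual T1) \<Gamma>))))
     (sren swap_res P1) ?W"
    by (rule str_sren[OF 1(6) _ scope_map_swap_res sren_ok_swap_res]) (intro dom_ext2_subset assms(3))
  then have 2: "str (scope (scope N)) (ext T1 (ext (sdual T1) \<Gamma>)) (SRes (sren swap_res P1))
     (WNu (wren (case_nat 0 id) ?W))"
    using assms(2) by (intro str_res)
  have 3: "SRes P \<equiv>\<^sub>s SRes (SRes (sren swap_res P1))"
    by (rule sc_trans[OF sc_res[OF 1(5)] sc_res_swap])
  have "wren (join f) (WNu (wren (case_nat 0 id) ?W)) = WNu (wren swap01 (wren (join (join f)) W1))"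
    unfolding wren_res by (simp add: join_swap_res)
  then have 4: "wren (join f) (WNu (wren (case_nat 0 id) ?W)) \<midarrow>LOut j a b c\<rightarrow>\<^sub>w WNu (wren (rot k) U)"
    using wtrans_out_swap[OF 1(7)[unfolded 1(1)]] 1(1) by simp
  show ?thesis
    unfolding out_ext_def using 1(1,4) b c 2 3 4 by blast
qed

text \<open>A restriction opened here always binds the payload: the second object is either the name
  created by the output itself or, for a client, a name out of scope, which no restriction binds. So
  at most two names are extruded.\<close>

lemma out_cases:
  "str N \<Gamma> P W \<Longrightarrow> dom \<Gamma> \<subseteq> N \<Longrightarrow> wren f W \<midarrow>LOut k a b c\<rightarrow>\<^sub>w U \<Longrightarrow>
    out_cli N \<Gamma> f P k a b c U \<or> out_lin N \<Gamma> f P k a b c U \<or> out_ext N \<Gamma> f P k a b c U"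
proof (induction arbitrary: f k a b c U rule: str.induct)
  case (str_nil \<Gamma> N)
  then show ?case by (auto elim: wtrans_NilE)
next
  case (str_par \<Gamma> \<Gamma>1 \<Gamma>2 N P W1 Q W2)
  have dom: "dom \<Gamma>1 \<subseteq> N" "dom \<Gamma>2 \<subseteq> N"
    using s_split_dom[OF str_par(1)] str_par.prems(1) by simp_all
  show ?case
    using str_par.prems(2) unfolding wren.simps
  proof (cases rule: wtrans_Par_outE)
    case (left U1)
    show ?thesis
      unfolding left(1) using str_par.IH(1)[OF dom(1) left(2)] out_cli_par(1)[OF _ str_par(1) str_par(3)]
        out_lin_par(1)[OF _ str_par(1) str_par(3) str_par.prems(1)]
        out_ext_par(1)[OF _ str_par(1) str_par(3) str_par.prems(1)] by metis
  next
    case (right U2)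
    note split = s_split_sym[OF str_par(1)]
    show ?thesis
      unfolding right(1) using str_par.IH(2)[OF dom(2) right(2)] out_cli_par(2)[OF _ split str_par(2)]
        out_lin_par(2)[OF _ split str_par(2) str_par.prems(1)]
        out_ext_par(2)[OF _ split str_par(2) str_par.prems(1)] by metis
  qed
next
  case (str_res T N \<Gamma> P W)
  note IH = str_res.IH[OF dom_ext2_subset[OF str_res.prems(1)]]
  show ?case
    using str_res.prems(2) unfolding wren_res
  proof (cases rule: wtrans_Nu_outE)
    case (opened j)
    from IH[OF opened(2)] show ?thesis
    proof (elim disjE)
      assume "out_cli (scope (scope N)) (ext T (ext (sdual T) \<Gamma>)) (join f) P j a b c U"
      then have j: "j = 0" and "\<exists>z. z \<notin> scope (scope N) \<and> c = join f z"
        by (auto simp: out_cli_def)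
      then obtain z where "z \<notin> N" "c = Suc (f z)" by (auto simp: not_scope2)
      then have "out_ext N \<Gamma> f (SRes P) k a b c U"
        unfolding out_ext_def using opened str_res(1,2) j sc_refl
        by (intro exI[of _ 0] exI[of _ T] exI[of _ P] exI[of _ W]) auto
      then show ?thesis by blast
    next
      assume "out_lin (scope (scope N)) (ext T (ext (sdual T) \<Gamma>)) (join f) P j a b c U"
      then have "j = Suc 0" "c = 0" by (auto simp: out_lin_def)
      then have "out_ext N \<Gamma> f (SRes P) k a b c U"
        unfolding out_ext_def using opened str_res(1,2) sc_refl
        by (intro exI[of _ "Suc 0"] exI[of _ T] exI[of _ P] exI[of _ W]) auto
      then show ?thesis by blast
    next
      \<comment> \<open>The payload has been extruded already, and the second object is extruded too
        or is out of scope; nothing is left for this restriction to open.\<close>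
      assume "out_ext (scope (scope N)) (ext T (ext (sdual T) \<Gamma>)) (join f) P j a b c U"
      then obtain i where "j = Suc i" "b = i"
        "i = 0 \<and> (\<exists>z. z \<notin> scope (scope N) \<and> c = Suc (join f z)) \<or> i = Suc 0 \<and> c = 0"
        unfolding out_ext_def by blast
      then show ?thesis using opened(4) by (auto simp: not_scope2)
    qed
  next
    case (res U0)
    show ?thesis
      unfolding res(1) using IH[OF res(2)] out_cli_res[OF _ str_res(1)] out_lin_res[OF _ str_res(1)]
        out_ext_res[OF _ str_res(1) str_res.prems(1)] by metis
  qed
next
  case (str_lin_in \<Gamma> x T S N P W)
  then show ?case by (auto elim: wtrans_In_outE)
next
  case (str_srv_in \<Gamma> x T N P W)
  then show ?case by (auto elim: wtrans_In_outE)
next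
  case (str_un_in \<Gamma> x T N P W)
  then show ?case by (auto elim: wtrans_Rep_outE)
next
  case (str_lin_out \<Gamma> x T S v N P W)
  have "k = Suc 0 \<and> a = Suc (f x) \<and> b = Suc (f v) \<and> c = 0 \<and> U = wren (\<lambda>n. up f ((Suc(x := 0)) n)) W"
    using str_lin_out.prems(2) unfolding wren.simps
    by (cases rule: wtrans_Nu_outE) (auto elim!: wtrans_Out_outE simp: skip_def)
  moreover have "(\<lambda>n. up f ((Suc(x := 0)) n)) = (\<lambda>n. Suc (f n))(x := 0)" by auto
  ultimately have "out_lin N \<Gamma> f (SOut x v P) k a b c U"
    unfolding out_lin_def using str_lin_out(1-4) sout_base by metis
  then show ?case by blast
next
  case (str_cli_out \<Gamma> x T v N P W z)
  have "k = 0 \<and> a = f x \<and> b = f v \<and> c = f z \<and> U = wren f W"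
    using str_cli_out.prems(2) unfolding wren.simps by (auto elim!: wtrans_Out_outE)
  then have "out_cli N \<Gamma> f (SOut x v P) k a b c U"
    unfolding out_cli_def using str_cli_out(1-4) sout_base by metis
  then show ?case by blast
qed

section \<open>Inputs of translated processes\<close>

text \<open>The condition for receiving \<open>v\<close> at type \<open>T\<close>: an unrestricted
  \<open>v\<close> is known to the receiver already, a linear one must be absent.\<close>

definition put_ok :: "name \<Rightarrow> stype \<Rightarrow> sctx \<Rightarrow> bool" where
  "put_ok v T \<Gamma> \<longleftrightarrow> \<Gamma> v = (if s_un T then Some T else None)"

lemma put_ok_ext [simp]: "put_ok (Suc v) T (ext S \<Gamma>) \<longleftrightarrow> put_ok v T \<Gamma>"
  by (simp add: put_ok_def)

lemma put_ok_neq_lin: "put_ok v T \<Gamma> \<Longrightarrow> \<Gamma> y = Some (SPre QLin p T' S) \<Longrightarrow> v \<noteq> y"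
  unfolding put_ok_def by (metis option.inject option.distinct(1) qual.distinct(1) s_un_simps(2))

lemma s_split_put:
  assumes "s_split \<Gamma> \<Gamma>1 \<Gamma>2" "put_ok v T \<Gamma>"
  shows "put_ok v T \<Gamma>1" "s_split (\<Gamma>(v \<mapsto> T)) (\<Gamma>1(v \<mapsto> T)) \<Gamma>2"
proof -
  show "put_ok v T \<Gamma>1"
    using assms(2) s_split_D[OF assms(1), of v]
    by (auto simp: put_ok_def s_split_entry_iff split: if_splits)
  show "s_split (\<Gamma>(v \<mapsto> T)) (\<Gamma>1(v \<mapsto> T)) \<Gamma>2"
    unfolding s_split_def
  proof
    fix y show "s_split_entry ((\<Gamma>(v \<mapsto> T)) y) ((\<Gamma>1(v \<mapsto> T)) y) (\<Gamma>2 y)"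
      using assms(2) s_split_D[OF assms(1), of y]
      by (cases "y = v") (auto simp: put_ok_def s_split_entry_iff split: if_splits)
  qed
qed

text \<open>The payload type is read off the receiver's context, and its agreement with the sender's
  is settled later; hence the residual is described only under the assumption that \<open>v\<close>
  fits. The second object \<open>c\<close> takes the place of \<open>y\<close> in it.\<close>

definition in_lin :: "name set \<Rightarrow> sctx \<Rightarrow> (name \<Rightarrow> name) \<Rightarrow> sproc \<Rightarrow> name \<Rightarrow> name \<Rightarrow> name \<Rightarrow> wproc \<Rightarrow> bool" where
  "in_lin N \<Gamma> F Q a v c U \<longleftrightarrow> (\<exists>y T S Q'. a = F y \<and> \<Gamma> y = Some (SPre QLin Recv T S) \<and> sin y v Q Q' \<and>
     (put_ok v T \<Gamma> \<longrightarrow> (\<exists>W'. str N (\<Gamma>(v \<mapsto> T, y \<mapsto> S)) Q' W' \<and> U = wren (F(y := c)) W')))"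

text \<open>The last conjunct records that a server ignores the second object: every
  \<open>c\<close> leads to the same residual. This is what \<open>stau\<close> asks for.\<close>

definition in_srv :: "name set \<Rightarrow> sctx \<Rightarrow> (name \<Rightarrow> name) \<Rightarrow> sproc \<Rightarrow> wproc \<Rightarrow> name \<Rightarrow> name \<Rightarrow> wproc \<Rightarrow> bool" where
  "in_srv N \<Gamma> F Q W a v U \<longleftrightarrow> (\<exists>y T Q'. a = F y \<and> \<Gamma> y = Some (star Recv T) \<and> sin y v Q Q' \<and>
     (put_ok v T \<Gamma> \<longrightarrow> (\<exists>W'. str N (\<Gamma>(v \<mapsto> T)) Q' W' \<and> U = wren F W')) \<and>
     (\<forall>c. wren F W \<midarrow>LIn a (F v) c\<rightarrow>\<^sub>w U))"

lemma in_lin_par: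
  assumes "in_lin N \<Gamma>1 F P a v c U" "s_split \<Gamma> \<Gamma>1 \<Gamma>2" "str N \<Gamma>2 Q W2" "dom \<Gamma> \<subseteq> N"
  shows "in_lin N \<Gamma> F (SPar P Q) a v c (WPar U (wren F W2))"
    and "in_lin N \<Gamma> F (SPar Q P) a v c (WPar (wren F W2) U)"
proof -
  obtain y T S P' where 1: "a = F y" "\<Gamma>1 y = Some (SPre QLin Recv T S)" "sin y v P P'"
     "put_ok v T \<Gamma>1 \<Longrightarrow> \<exists>W'. str N (\<Gamma>1(v \<mapsto> T, y \<mapsto> S)) P' W' \<and> U = wren (F(y := c)) W'"
    using assms(1) unfolding in_lin_def by blast
  note 2 = s_split_le(1)[OF assms(2) 1(2)]
  have y2: "\<Gamma>2 y = None" using s_split_lin[OF assms(2) 1(2)] by simp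
  have "dom \<Gamma>2 \<subseteq> N" using s_split_dom[OF assms(2)] assms(4) by simp
  then have 4: "str N (s_give y S \<Gamma>2) Q W2" using str_give[OF assms(3)] y2 by blast
  have "y \<notin> wfn W2"
    using str_wfn[OF assms(3), of y] y2 2 assms(4) by (auto simp: domI subset_iff)
  then have 5: "wren (F(y := c)) W2 = wren F W2"
    by (auto intro!: wren_cong)
  have 6: "\<exists>W1. str N (\<Gamma>1(v \<mapsto> T, y \<mapsto> S)) P' W1 \<and> U = wren (F(y := c)) W1 \<and>
     s_split (\<Gamma>(v \<mapsto> T, y \<mapsto> S)) (\<Gamma>1(v \<mapsto> T, y \<mapsto> S)) (s_give y S \<Gamma>2)" if "put_ok v T \<Gamma>"
  proof -
    have "v \<noteq> y" using that 2 by (rule put_ok_neq_lin)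
    then have "s_split (\<Gamma>(v \<mapsto> T, y \<mapsto> S)) (\<Gamma>1(v \<mapsto> T, y \<mapsto> S)) (s_give y S \<Gamma>2)"
      using s_split_upd[OF s_split_put(2)[OF assms(2) that], of y] 1(2) by simp
    with 1(4) s_split_put(1)[OF assms(2) that] show ?thesis by blast
  qed
  show "in_lin N \<Gamma> F (SPar P Q) a v c (WPar U (wren F W2))"
    unfolding in_lin_def 5[symmetric] using 1(1,3) 2 6 str_par[OF _ _ 4]
    by (intro exI[of _ y] exI[of _ T] exI[of _ S] exI[of _ "SPar P' Q"])
      (fastforce intro: sin_parL)
  show "in_lin N \<Gamma> F (SPar Q P) a v c (WPar (wren F W2) U)"
    unfolding in_lin_def 5[symmetric] using 1(1,3) 2 6 str_par[OF s_split_sym 4]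
    by (intro exI[of _ y] exI[of _ T] exI[of _ S] exI[of _ "SPar Q P'"])
      (fastforce intro: sin_parR)
qed

lemma in_srv_par:
  assumes "in_srv N \<Gamma>1 F P W1 a v U" "s_split \<Gamma> \<Gamma>1 \<Gamma>2" "str N \<Gamma>2 Q W2" "dom \<Gamma> \<subseteq> N"
  shows "in_srv N \<Gamma> F (SPar P Q) (WPar W1 W2) a v (WPar U (wren F W2))"
    and "in_srv N \<Gamma> F (SPar Q P) (WPar W2 W1) a v (WPar (wren F W2) U)"
proof -
  obtain y T P' where 1: "a = F y" "\<Gamma>1 y = Some (star Recv T)" "sin y v P P'"
     "put_ok v T \<Gamma>1 \<Longrightarrow> \<exists>W'. str N (\<Gamma>1(v \<mapsto> T)) P' W' \<and> U = wren F W'"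
     "\<And>c. wren F W1 \<midarrow>LIn a (F v) c\<rightarrow>\<^sub>w U"
    using assms(1) unfolding in_srv_def by blast
  note 2 = s_split_le(1)[OF assms(2) 1(2)]
  have 6: "\<exists>W1. str N (\<Gamma>1(v \<mapsto> T)) P' W1 \<and> U = wren F W1 \<and>
     s_split (\<Gamma>(v \<mapsto> T)) (\<Gamma>1(v \<mapsto> T)) \<Gamma>2" if "put_ok v T \<Gamma>"
    using 1(4) s_split_put[OF assms(2) that] by blast
  show "in_srv N \<Gamma> F (SPar P Q) (WPar W1 W2) a v (WPar U (wren F W2))"
    unfolding in_srv_def using 1(1,3,5) 2 6 str_par[OF _ _ assms(3)]
    by (intro exI[of _ y] exI[of _ T] exI[of _ "SPar P' Q"])
      (fastforce intro: sin_parL wt_parL_in)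
  show "in_srv N \<Gamma> F (SPar Q P) (WPar W2 W1) a v (WPar (wren F W2) U)"
    unfolding in_srv_def using 1(1,3,5) 2 6 str_par[OF s_split_sym assms(3)]
    by (intro exI[of _ y] exI[of _ T] exI[of _ "SPar Q P'"])
      (fastforce intro: sin_parR wt_parR_in)
qed

lemma join_upd: "(join F)(Suc (Suc y) := Suc c) = join (F(y := c))"
proof
  fix n show "((join F)(Suc (Suc y) := Suc c)) n = join (F(y := c)) n"
    by (rule nat2_cases[of n]) auto
qed

lemma in_lin_res:
  assumes "in_lin (scope (scope N)) (ext T (ext (sdual T) \<Gamma>)) (join F) P (Suc a) (Suc (Suc v)) (Suc c) U"
    "session_type T"
  shows "in_lin N \<Gamma> F (SRes P) a v c (WNu U)"
proof -
  obtain y T0 S P' where 1: "Suc a = join F y" "ext T (ext (sdual T) \<Gamma>) y = Some (SPre QLin Recv T0 S)"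
     "sin y (Suc (Suc v)) P P'"
     "put_ok v T0 \<Gamma> \<Longrightarrow>
        \<exists>W'. str (scope (scope N)) ((ext T (ext (sdual T) \<Gamma>))(Suc (Suc v) \<mapsto> T0, y \<mapsto> S)) P' W' \<and>
             U = wren ((join F)(y := Suc c)) W'"
    using assms(1) unfolding in_lin_def put_ok_ext by blast
  then obtain y' where 2: "y = Suc (Suc y')" "a = F y'" by (auto simp: Suc_eq_join)
  have 3: "\<exists>W'. str N (\<Gamma>(v \<mapsto> T0, y' \<mapsto> S)) (SRes P') W' \<and> WNu U = wren (F(y' := c)) W'" if ok: "put_ok v T0 \<Gamma>"
  proof -
    obtain W' where "str (scope (scope N)) (ext T (ext (sdual T) (\<Gamma>(v \<mapsto> T0, y' \<mapsto> S)))) P' W'"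
      "U = wren (join (F(y' := c))) W'"
      using 1(4)[OF ok] unfolding 2(1) join_upd by auto
    then show ?thesis using str_res[OF assms(2)] wren_res by metis
  qed
  show ?thesis
    unfolding in_lin_def using 1(2,3) 2 3
    by (intro exI[of _ y'] exI[of _ T0] exI[of _ S] exI[of _ "SRes P'"]) (simp add: sin_res)
qed

lemma in_srv_res:
  assumes "in_srv (scope (scope N)) (ext T (ext (sdual T) \<Gamma>)) (join F) P W (Suc a) (Suc (Suc v)) U"
    "session_type T"
  shows "in_srv N \<Gamma> F (SRes P) (WNu (wren (case_nat 0 id) W)) a v (WNu U)"
proof -
  obtain y T0 P' where 1: "Suc a = join F y" "ext T (ext (sdual T) \<Gamma>) y = Some (star Recv T0)"
     "sin y (Suc (Suc v)) P P'"
     "put_ok v T0 \<Gamma> \<Longrightarrow>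
        \<exists>W'. str (scope (scope N)) ((ext T (ext (sdual T) \<Gamma>))(Suc (Suc v) \<mapsto> T0)) P' W' \<and>
             U = wren (join F) W'"
     "\<And>c. wren (join F) W \<midarrow>LIn (Suc a) (join F (Suc (Suc v))) c\<rightarrow>\<^sub>w U"
    using assms(1) unfolding in_srv_def put_ok_ext by blast
  then obtain y' where 2: "y = Suc (Suc y')" "a = F y'" by (auto simp: Suc_eq_join)
  have 3: "\<exists>W'. str N (\<Gamma>(v \<mapsto> T0)) (SRes P') W' \<and> WNu U = wren F W'" if ok: "put_ok v T0 \<Gamma>"
  proof -
    obtain W' where "str (scope (scope N)) (ext T (ext (sdual T) (\<Gamma>(v \<mapsto> T0)))) P' W'"
      "U = wren (join F) W'"
      using 1(4)[OF ok] by auto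
    then show ?thesis using str_res[OF assms(2)] wren_res by metis
  qed
  have "wren F (WNu (wren (case_nat 0 id) W)) \<midarrow>LIn a (F v) c\<rightarrow>\<^sub>w WNu U" for c
    unfolding wren_res using 1(5)[of "Suc c"] by (intro wt_res_in) simp
  then show ?thesis
    unfolding in_srv_def using 1(2,3) 2 3
    by (intro exI[of _ y'] exI[of _ T0] exI[of _ "SRes P'"]) (simp add: sin_res)
qed

text \<open>Identifying the received name with \<open>v\<close> is harmless: either both have the
  same unrestricted type, or \<open>v\<close> is absent from the context. As \<open>v\<close> is in
  scope, it cannot be a fresh object of a client output.\<close>

lemma str_subst:
  assumes "str (scope N) (ext T \<Gamma>) Q W" "dom \<Gamma> \<subseteq> N" "v \<in> N" "put_ok v T \<Gamma>"
  shows "str N (\<Gamma>(v \<mapsto> T)) (sren (case_nat v id) Q) (wren (case_nat v id) W)"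
proof (rule str_sren[OF assms(1)])
  show "dom (ext T \<Gamma>) \<subseteq> scope N" using assms(2) by (rule dom_ext_subset)
  have "case_nat v id n \<in> N \<longleftrightarrow> n \<in> scope N" for n using assms(3) by (cases n) auto
  moreover have "inj_on (case_nat v id) (- scope N)"
    by (rule inj_onI) (auto simp: mem_scope_cases split: nat.splits)
  ultimately show "scope_map (scope N) N (case_nat v id)" by (simp add: scope_map_def)
  show "sren_ok (case_nat v id) (ext T \<Gamma>) (\<Gamma>(v \<mapsto> T))"
  proof (rule sren_okI)
    show "(\<Gamma>(v \<mapsto> T)) (case_nat v id x) = Some U" if "ext T \<Gamma> x = Some U" for x U
      using that assms(4) by (auto simp: ext_eq_Some put_ok_def split: if_splits)
    show "x' = x" if "ext T \<Gamma> x = Some U" "\<not> s_un U" "case_nat v id x' = case_nat v id x"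
      "ext T \<Gamma> x' = Some U'" for x U x' U'
      using that assms(4) by (auto simp: ext_eq_Some put_ok_def split: if_splits)
    show "\<exists>x. case_nat v id x = y \<and> ext T \<Gamma> x = Some U" if "(\<Gamma>(v \<mapsto> T)) y = Some U" "\<not> s_un U" for y U
    proof (cases "y = v")
      case True
      then show ?thesis using that by (intro exI[of _ 0]) auto
    next
      case False
      then show ?thesis using that by (intro exI[of _ "Suc y"]) auto
    qed
  qed
qed

text \<open>The renaming used in the translation of a server never hits the index 1, so the second
  object \<open>c\<close> disappears.\<close>

lemma case_nat_shift:
  "wren (case_nat b (case_nat c id)) (wren (up (up F)) (wren (case_nat 0 (\<lambda>n. Suc (Suc n))) W)) = wren (case_nat b F) W"
proof -
  have "case_nat b (case_nat c id) (up (up F) (case_nat 0 (\<lambda>n. Suc (Suc n)) n)) = case_nat b F n" for n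
    by (cases n) auto
  then show ?thesis by simp
qed

lemma wren_case_nat: "wren (case_nat (F v) F) W = wren F (wren (case_nat v id) W)"
proof -
  have "F (case_nat v id n) = case_nat (F v) F n" for n by (cases n) auto
  then show ?thesis by simp
qed

text \<open>The payload of the label is required to be \<open>F v\<close> with \<open>v\<close> in
  scope. It comes from a sender with the same scope, and only in this form is the residual again a
  renamed translation.\<close>

lemma in_cases:
  "str N \<Gamma> Q W \<Longrightarrow> dom \<Gamma> \<subseteq> N \<Longrightarrow> v \<in> N \<Longrightarrow> wren F W \<midarrow>LIn a (F v) c\<rightarrow>\<^sub>w U \<Longrightarrow>
    in_lin N \<Gamma> F Q a v c U \<or> in_srv N \<Gamma> F Q W a v U"
proof (induction arbitrary: F a v c U rule: str.induct)
  case (str_nil \<Gamma> N)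
  then show ?case by (auto elim: wtrans_NilE)
next
  case (str_par \<Gamma> \<Gamma>1 \<Gamma>2 N P W1 Q W2)
  have dom: "dom \<Gamma>1 \<subseteq> N" "dom \<Gamma>2 \<subseteq> N"
    using s_split_dom[OF str_par(1)] str_par.prems(1) by simp_all
  show ?case
    using str_par.prems(3) unfolding wren.simps
  proof (cases rule: wtrans_Par_inE)
    case (left U1)
    show ?thesis
      unfolding left(1) using str_par.IH(1)[OF dom(1) str_par.prems(2) left(2)]
        in_lin_par(1)[OF _ str_par(1) str_par(3) str_par.prems(1)]
        in_srv_par(1)[OF _ str_par(1) str_par(3) str_par.prems(1)] by metis
  next
    case (right U2)
    note split = s_split_sym[OF str_par(1)]
    show ?thesis
      unfolding right(1) using str_par.IH(2)[OF dom(2) str_par.prems(2) right(2)]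
        in_lin_par(2)[OF _ split str_par(2) str_par.prems(1)]
        in_srv_par(2)[OF _ split str_par(2) str_par.prems(1)] by metis
  qed
next
  case (str_res T N \<Gamma> P W)
  from str_res.prems(3) obtain U0 where U: "U = WNu U0"
    and tr: "wren (join F) W \<midarrow>LIn (Suc a) (Suc (F v)) (Suc c)\<rightarrow>\<^sub>w U0"
    unfolding wren_res by (auto elim: wtrans_Nu_inE)
  have "in_lin (scope (scope N)) (ext T (ext (sdual T) \<Gamma>)) (join F) P (Suc a) (Suc (Suc v)) (Suc c) U0 \<or>
    in_srv (scope (scope N)) (ext T (ext (sdual T) \<Gamma>)) (join F) P W (Suc a) (Suc (Suc v)) U0"
    using str_res.prems(2) tr by (intro str_res.IH[OF dom_ext2_subset[OF str_res.prems(1)]]) simp_all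
  then show ?case
    unfolding U using in_lin_res[OF _ str_res(1)] in_srv_res[OF _ str_res(1)] by metis
next
  case (str_lin_in \<Gamma> x T S N P W)
  have x: "x \<in> N" using str_lin_in.prems(1) str_lin_in(1) by auto
  have "a = F x \<and> U = wren (\<lambda>n. case_nat (F v) (case_nat c id)
      (up (up F) (case_nat 0 ((\<lambda>n. Suc (Suc n))(x := Suc 0)) n))) W"
    using str_lin_in.prems(3) unfolding wren.simps by (auto elim!: wtrans_In_inE)
  moreover have "(\<lambda>n. case_nat (F v) (case_nat c id)
      (up (up F) (case_nat 0 ((\<lambda>n. Suc (Suc n))(x := Suc 0)) n))) = case_nat (F v) (F(x := c))"
    by (auto simp: fun_eq_iff split: nat.split)
  ultimately have 1: "a = F x" "U = wren (case_nat (F v) (F(x := c))) W" by auto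
  have "\<exists>W'. str N (\<Gamma>(v \<mapsto> T, x \<mapsto> S)) (sren (case_nat v id) P) W' \<and> U = wren (F(x := c)) W'"
    if "put_ok v T \<Gamma>"
  proof -
    have "v \<noteq> x" using that str_lin_in(1) by (rule put_ok_neq_lin)
    moreover have "str N ((\<Gamma>(x \<mapsto> S))(v \<mapsto> T)) (sren (case_nat v id) P) (wren (case_nat v id) W)"
      using str_lin_in.prems(1,2) x that \<open>v \<noteq> x\<close>
      by (intro str_subst[OF str_lin_in(2)]) (auto simp: put_ok_def)
    moreover have "U = wren (F(x := c)) (wren (case_nat v id) W)"
      using wren_case_nat[of "F(x := c)" v W] \<open>v \<noteq> x\<close> 1(2) by simp
    ultimately show ?thesis by (auto simp: fun_upd_twist)
  qed
  then have "in_lin N \<Gamma> F (SIn QLin x P) a v c U"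
    unfolding in_lin_def using 1(1) str_lin_in(1) sin_lin by blast
  then show ?case by blast
next
  case (str_srv_in \<Gamma> x T N P W)
  let ?W = "WIn x (wren (case_nat 0 (\<lambda>n. Suc (Suc n))) W)"
  have 1: "a = F x" "U = wren (case_nat (F v) F) W"
    using str_srv_in.prems(3) unfolding wren.simps
    by (auto elim!: wtrans_In_inE simp: case_nat_shift simp del: wren_wren)
  have 2: "wren F ?W \<midarrow>LIn a (F v) c\<rightarrow>\<^sub>w U" for c
    using wt_in[of "F x" "wren (up (up F)) (wren (case_nat 0 (\<lambda>n. Suc (Suc n))) W)" "F v" c]
    by (simp add: 1 case_nat_shift del: wren_wren)
  have "str N (\<Gamma>(v \<mapsto> T)) (sren (case_nat v id) P) (wren (case_nat v id) W)" if "put_ok v T \<Gamma>"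
    using str_srv_in.prems that by (intro str_subst[OF str_srv_in(2)])
  then have "in_srv N \<Gamma> F (SIn QLin x P) ?W a v U"
    unfolding in_srv_def using 1 2 str_srv_in(1) sin_lin wren_case_nat by blast
  then show ?case by blast
next
  case (str_un_in \<Gamma> x T N P W)
  let ?W = "WRep x (wren (case_nat 0 (\<lambda>n. Suc (Suc n))) W)"
  have 1: "a = F x" "U = WPar (wren F ?W) (wren (case_nat (F v) F) W)"
    using str_un_in.prems(3) unfolding wren.simps
    by (auto elim!: wtrans_Rep_inE simp: case_nat_shift simp del: wren_wren)
  have 2: "wren F ?W \<midarrow>LIn a (F v) c\<rightarrow>\<^sub>w U" for c
    using wt_rep[of "F x" "wren (up (up F)) (wren (case_nat 0 (\<lambda>n. Suc (Suc n))) W)" "F v" c]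
    by (simp add: 1 case_nat_shift del: wren_wren)
  have 3: "\<exists>W'. str N (\<Gamma>(v \<mapsto> T)) (SPar (SIn QUn x P) (sren (case_nat v id) P)) W' \<and> U = wren F W'"
    if "put_ok v T \<Gamma>"
  proof -
    have "str N (\<Gamma>(v \<mapsto> T)) (sren (case_nat v id) P) (wren (case_nat v id) W)"
      using str_un_in.prems that by (intro str_subst[OF str_un_in(3)])
    moreover have "str N \<Gamma> (SIn QUn x P) ?W"
      using str_un_in(1-3) by (rule str.str_un_in)
    \<comment> \<open>The context of a replicated input is unrestricted, so the server keeps all of
      it; a linear payload goes to the new copy alone.\<close>
    moreover have "s_split (\<Gamma>(v \<mapsto> T)) \<Gamma> (\<Gamma>(v \<mapsto> T))"
      unfolding s_split_def
    proof
      fix y show "s_split_entry ((\<Gamma>(v \<mapsto> T)) y) (\<Gamma> y) ((\<Gamma>(v \<mapsto> T)) y)"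
        using that str_un_in(1)
        by (auto simp: put_ok_def s_qual_ctx_QUn s_split_entry_iff split: if_splits option.splits)
    qed
    ultimately have "str N (\<Gamma>(v \<mapsto> T)) (SPar (SIn QUn x P) (sren (case_nat v id) P))
       (WPar ?W (wren (case_nat v id) W))" by (intro str.str_par)
    moreover have "U = wren F (WPar ?W (wren (case_nat v id) W))"
      unfolding 1(2) wren_case_nat by simp
    ultimately show ?thesis by blast
  qed
  have "in_srv N \<Gamma> F (SIn QUn x P) ?W a v U"
    unfolding in_srv_def using 1(1) 2 3 str_un_in(2) sin_un by blast
  then show ?case by blast
next
  case (str_lin_out \<Gamma> x T S v N P W)
  then show ?case by (auto elim!: wtrans_Nu_inE wtrans_Out_inE)
next
  case (str_cli_out \<Gamma> x T v N P W z)
  then show ?case by (auto elim: wtrans_Out_inE)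
qed

section \<open>Communications of translated processes\<close>

text \<open>Merged names are meant to be the two ends of one channel. By duality a client output
  then meets a server input only, a linear output a linear input only, and the payload types agree.
  The identity satisfies this trivially, and \<open>join\<close> preserves it.\<close>

definition coh :: "(name \<Rightarrow> name) \<Rightarrow> sctx \<Rightarrow> bool" where
  "coh f \<Gamma> \<longleftrightarrow> (\<forall>x y T U. \<Gamma> x = Some T \<longrightarrow> \<Gamma> y = Some U \<longrightarrow> f x = f y \<longrightarrow> x \<noteq> y \<longrightarrow> U = sdual T)"

definition sess :: "sctx \<Rightarrow> bool" where
  "sess \<Gamma> \<longleftrightarrow> (\<forall>x T. \<Gamma> x = Some T \<longrightarrow> session_type T)"

lemma cohD: "coh f \<Gamma> \<Longrightarrow> \<Gamma> x = Some T \<Longrightarrow> \<Gamma> y = Some U \<Longrightarrow> f x = f y \<Longrightarrow> x \<noteq> y \<Longrightarrow> U = sdual T"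
  unfolding coh_def by blast

lemma coh_ext: "coh f \<Gamma> \<Longrightarrow> coh (join f) (ext T (ext (sdual T) \<Gamma>))"
  unfolding coh_def by (auto simp: ext_eq_Some) metis

lemma coh_split: "s_split \<Gamma> \<Gamma>1 \<Gamma>2 \<Longrightarrow> coh f \<Gamma> \<Longrightarrow> coh f \<Gamma>1"
  unfolding coh_def using s_split_le(1) by blast

lemma sess_ext: "sess \<Gamma> \<Longrightarrow> session_type T \<Longrightarrow> sess (ext T (ext (sdual T) \<Gamma>))"
  unfolding sess_def by (auto simp: ext_eq_Some session_type_sdual)

lemma sess_split: "s_split \<Gamma> \<Gamma>1 \<Gamma>2 \<Longrightarrow> sess \<Gamma> \<Longrightarrow> sess \<Gamma>1"
  unfolding sess_def using s_split_le(1) by blast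

definition red_res :: "name set \<Rightarrow> sctx \<Rightarrow> (name \<Rightarrow> name) \<Rightarrow> sproc \<Rightarrow> wproc \<Rightarrow> bool" where
  "red_res N \<Gamma> f P U \<longleftrightarrow> (\<exists>R W. P \<longrightarrow>\<^sub>s R \<and> str N \<Gamma> R W \<and> U = wren f W)"

text \<open>Both endpoints are consumed and the continuations get a channel of their own, so
  \<open>x\<close> and \<open>y\<close> vanish from the context; the flag of \<open>comm\<close> is
  set accordingly.\<close>

definition lin_res :: "name set \<Rightarrow> sctx \<Rightarrow> (name \<Rightarrow> name) \<Rightarrow> sproc \<Rightarrow> wproc \<Rightarrow> bool" where
  "lin_res N \<Gamma> f P U \<longleftrightarrow> (\<exists>x y T S R W. f x = f y \<and> \<Gamma> x = Some (SPre QLin Send T S) \<and>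
     \<Gamma> y = Some (SPre QLin Recv T (sdual S)) \<and> comm True x y P R \<and>
     str N (\<Gamma>(x := None, y := None)) R W \<and> U = wren f W)"

definition un_res :: "name set \<Rightarrow> sctx \<Rightarrow> (name \<Rightarrow> name) \<Rightarrow> sproc \<Rightarrow> wproc \<Rightarrow> bool" where
  "un_res N \<Gamma> f P U \<longleftrightarrow> (\<exists>x y T R W. f x = f y \<and> \<Gamma> x = Some (star Send T) \<and>
     \<Gamma> y = Some (star Recv T) \<and> comm False x y P R \<and> str N \<Gamma> R W \<and> U = wren f W)"

text \<open>
  The communication is a reduction of \<open>P\<close>, or it is between free names \<open>x\<close>, \<open>y\<close> of \<open>P\<close> identified by
  \<open>f\<close>, and becomes a reduction under the restriction binding them.
\<close>
definition tau_res :: "name set \<Rightarrow> sctx \<Rightarrow> (name \<Rightarrow> name) \<Rightarrow> sproc \<Rightarrow> wproc \<Rightarrow> bool" where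
  "tau_res N \<Gamma> f P U \<longleftrightarrow> red_res N \<Gamma> f P U \<or> lin_res N \<Gamma> f P U \<or> un_res N \<Gamma> f P U"

lemma tau_res_cong: "P \<equiv>\<^sub>s P' \<Longrightarrow> tau_res N \<Gamma> f P' U \<Longrightarrow> tau_res N \<Gamma> f P U"
  unfolding tau_res_def red_res_def lin_res_def un_res_def
  using sred_cong_left[of P P'] comm_cong[OF _ _ sc_refl, of P P'] by blast

lemma tau_res_par:
  assumes "tau_res N \<Gamma>1 f P U" "s_split \<Gamma> \<Gamma>1 \<Gamma>2" "str N \<Gamma>2 Q W2"
  shows "tau_res N \<Gamma> f (SPar P Q) (WPar U (wren f W2))"
    and "tau_res N \<Gamma> f (SPar Q P) (WPar (wren f W2) U)"
proof -
  have sfn: "x \<notin> sfn Q" if "\<Gamma>2 x = None" for x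
    using str_sfn[OF assms(3), of x] that by auto
  have "tau_res N \<Gamma> f (SPar P Q) (WPar U (wren f W2)) \<and> tau_res N \<Gamma> f (SPar Q P) (WPar (wren f W2) U)"
    using assms(1)[unfolded tau_res_def]
  proof (elim disjE)
    assume "red_res N \<Gamma>1 f P U"
    then obtain R W where "P \<longrightarrow>\<^sub>s R" "str N \<Gamma>1 R W" "U = wren f W"
      unfolding red_res_def by blast
    then have "red_res N \<Gamma> f (SPar P Q) (WPar U (wren f W2))" "red_res N \<Gamma> f (SPar Q P) (WPar (wren f W2) U)"
      unfolding red_res_def wren.simps(5)[symmetric]
      using sr_par sred_par_right str_par[OF assms(2) _ assms(3)] str_par[OF s_split_sym[OF assms(2)] assms(3)]
      by (metis wren.simps(5))+
    then show ?thesis unfolding tau_res_def by blast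
  next
    assume "lin_res N \<Gamma>1 f P U"
    then obtain x y T S R W where 1: "f x = f y" "\<Gamma>1 x = Some (SPre QLin Send T S)"
      "\<Gamma>1 y = Some (SPre QLin Recv T (sdual S))" "comm True x y P R"
      "str N (\<Gamma>1(x := None, y := None)) R W" "U = wren f W"
      unfolding lin_res_def by blast
    have 2: "\<Gamma>2 x = None" "\<Gamma>2 y = None"
      using s_split_lin[OF assms(2) 1(2)] s_split_lin[OF assms(2) 1(3)] by simp_all
    note 3 = s_split_le(1)[OF assms(2) 1(2)] s_split_le(1)[OF assms(2) 1(3)]
    have 4: "s_split (\<Gamma>(x := None, y := None)) (\<Gamma>1(x := None, y := None)) \<Gamma>2"
      unfolding s_split_def
    proof
      fix z show "s_split_entry ((\<Gamma>(x := None, y := None)) z) ((\<Gamma>1(x := None, y := None)) z) (\<Gamma>2 z)"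
        using s_split_D[OF assms(2), of z] 2 by (cases "z = x \<or> z = y") (auto simp: s_split_entry_iff)
    qed
    \<comment> \<open>Linear endpoints are on one side of the split only, so the other component
      does not mention them, as the flag demands.\<close>
    have 5: "comm True x y (SPar P Q) (SPar R Q)" "comm True x y (SPar Q P) (SPar Q R)"
      using 1(4) sfn[OF 2(1)] sfn[OF 2(2)] by (auto intro: comm_par comm_par_right)
    have "lin_res N \<Gamma> f (SPar P Q) (WPar U (wren f W2))"
      unfolding lin_res_def using 1(1) 3 5(1) str_par[OF 4 1(5) assms(3)] 1(6)
      by (metis wren.simps(5))
    moreover have "lin_res N \<Gamma> f (SPar Q P) (WPar (wren f W2) U)"
      unfolding lin_res_def using 1(1) 3 5(2) str_par[OF s_split_sym[OF 4] assms(3) 1(5)] 1(6)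
      by (metis wren.simps(5))
    ultimately show ?thesis unfolding tau_res_def by blast
  next
    assume "un_res N \<Gamma>1 f P U"
    then obtain x y T R W where 1: "f x = f y" "\<Gamma>1 x = Some (star Send T)"
      "\<Gamma>1 y = Some (star Recv T)" "comm False x y P R"
      "str N \<Gamma>1 R W" "U = wren f W"
      unfolding un_res_def by blast
    note 3 = s_split_le(1)[OF assms(2) 1(2)] s_split_le(1)[OF assms(2) 1(3)]
    have 5: "comm False x y (SPar P Q) (SPar R Q)" "comm False x y (SPar Q P) (SPar Q R)"
      using 1(4) by (auto intro: comm_par comm_par_right)
    have "un_res N \<Gamma> f (SPar P Q) (WPar U (wren f W2))"
      unfolding un_res_def using 1(1) 3 5(1) str_par[OF assms(2) 1(5) assms(3)] 1(6)
      by (metis wren.simps(5))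
    moreover have "un_res N \<Gamma> f (SPar Q P) (WPar (wren f W2) U)"
      unfolding un_res_def using 1(1) 3 5(2) str_par[OF s_split_sym[OF assms(2)] assms(3) 1(5)] 1(6)
      by (metis wren.simps(5))
    ultimately show ?thesis unfolding tau_res_def by blast
  qed
  then show "tau_res N \<Gamma> f (SPar P Q) (WPar U (wren f W2))" "tau_res N \<Gamma> f (SPar Q P) (WPar (wren f W2) U)"
    by blast+
qed

lemma join_eq_0: "join f x = 0 \<longleftrightarrow> x = 0 \<or> x = Suc 0"
  by (rule nat2_cases[of x]) auto

lemma join_eqE:
  assumes "join f x = join f y" "x \<noteq> y"
  obtains "{x, y} = {0, 1}" | x' y' where "x = Suc (Suc x')" "y = Suc (Suc y')" "f x' = f y'"
proof (cases "join f x")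
  case 0
  then have "join f x = 0" "join f y = 0" using assms(1) by simp_all
  then have "x = 0 \<or> x = Suc 0" "y = 0 \<or> y = Suc 0" by (simp_all only: join_eq_0)
  then have "{x, y} = {0, 1}" using assms(2) by auto
  then show ?thesis by (rule that(1))
next
  case (Suc a)
  then obtain x' y' where "x = Suc (Suc x')" "a = f x'" "y = Suc (Suc y')" "a = f y'"
    using assms(1) Suc_eq_join[of a f x] Suc_eq_join[of a f y] by auto
  then show ?thesis by (intro that(2)[of x' y']) auto
qed

lemma tau_res_res:
  assumes "tau_res (scope (scope N)) (ext T (ext (sdual T) \<Gamma>)) (join f) P U" "session_type T" "dom \<Gamma> \<subseteq> N"
  shows "tau_res N \<Gamma> f (SRes P) (WNu U)"
  using assms(1) unfolding tau_res_def
proof (elim disjE)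
  let ?N = "scope (scope N)" and ?\<Gamma> = "ext T (ext (sdual T) \<Gamma>)"
  {
    assume "red_res ?N ?\<Gamma> (join f) P U"
    then obtain R W where "P \<longrightarrow>\<^sub>s R" "str ?N ?\<Gamma> R W" "U = wren (join f) W"
      unfolding red_res_def by blast
    then have "red_res N \<Gamma> f (SRes P) (WNu U)"
      unfolding red_res_def using sr_res str_res[OF assms(2)] wren_res by metis
    then show "red_res N \<Gamma> f (SRes P) (WNu U) \<or> lin_res N \<Gamma> f (SRes P) (WNu U) \<or> un_res N \<Gamma> f (SRes P) (WNu U)"
      by blast
  next
    assume "lin_res ?N ?\<Gamma> (join f) P U"
    then obtain x y T' S R W where 1: "join f x = join f y" "?\<Gamma> x = Some (SPre QLin Send T' S)"
      "?\<Gamma> y = Some (SPre QLin Recv T' (sdual S))" "comm True x y P R"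
      "str ?N (?\<Gamma>(x := None, y := None)) R W" "U = wren (join f) W"
      unfolding lin_res_def by blast
    have "x \<noteq> y" using 1(2,3) by auto
    with 1(1) show "red_res N \<Gamma> f (SRes P) (WNu U) \<or> lin_res N \<Gamma> f (SRes P) (WNu U) \<or> un_res N \<Gamma> f (SRes P) (WNu U)"
    proof (cases rule: join_eqE)
      case 1
      have "SRes P \<longrightarrow>\<^sub>s SRes R" using \<open>comm True x y P R\<close> 1 by (rule comm_red)
      moreover have "?\<Gamma>(x := None, y := None) = ?\<Gamma>(0 := None, Suc 0 := None)" (is "_ = ?\<Delta>")
        using 1 by (auto simp: doubleton_eq_iff fun_upd_twist simp del: ext_upd_Suc)
      then have "str ?N ?\<Delta> R W"
        using \<open>str ?N (?\<Gamma>(x := None, y := None)) R W\<close> by metis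
      \<comment> \<open>The dead endpoints are retyped with \<open>end\<close>, which is self-dual
        and unrestricted, so weakening restores the pair of entries that a restriction
        needs.\<close>
      then have "str ?N (ext SEnd (ext (sdual SEnd) \<Gamma>)) R W"
      proof (rule str_weaken)
        show "dom ?\<Delta> \<subseteq> ?N"
          using dom_ext2_subset[OF assms(3)] by auto
        show "ext SEnd (ext (sdual SEnd) \<Gamma>) z = Some U" if "?\<Delta> z = Some U" for z U
          using that by (rule_tac nat2_cases[of z]) simp_all
        show "s_un U" if "ext SEnd (ext (sdual SEnd) \<Gamma>) z = Some U" "?\<Delta> z \<noteq> Some U" for z U
          using that by (rule_tac nat2_cases[of z]) auto
      qed
      ultimately have "red_res N \<Gamma> f (SRes P) (WNu U)"
        unfolding red_res_def \<open>U = wren (join f) W\<close>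
        using str_res[OF session_type.intros(1)] wren_res by metis
      then show ?thesis by blast
    next
      case (2 x' y')
      then have "?\<Gamma>(x := None, y := None) = ext T (ext (sdual T) (\<Gamma>(x' := None, y' := None)))" by simp
      then have "str N (\<Gamma>(x' := None, y' := None)) (SRes R) (WNu (wren (case_nat 0 id) W))"
        using 1(5) by (intro str_res[OF assms(2)]) simp
      moreover have "comm True x' y' (SRes P) (SRes R)"
        using 1(4) 2 by (intro comm_res) simp
      moreover have "\<Gamma> x' = Some (SPre QLin Send T' S)" "\<Gamma> y' = Some (SPre QLin Recv T' (sdual S))"
        using 1(2,3) 2 by simp_all
      ultimately have "lin_res N \<Gamma> f (SRes P) (WNu U)"
        unfolding lin_res_def \<open>U = wren (join f) W\<close> using 2(3) wren_res by metis
      then show ?thesis by blast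
    qed
  next
    assume "un_res ?N ?\<Gamma> (join f) P U"
    then obtain x y T' R W where 1: "join f x = join f y" "?\<Gamma> x = Some (star Send T')"
      "?\<Gamma> y = Some (star Recv T')" "comm False x y P R" "str ?N ?\<Gamma> R W" "U = wren (join f) W"
      unfolding un_res_def by blast
    have str: "str N \<Gamma> (SRes R) (WNu (wren (case_nat 0 id) W))"
      using 1(5) by (rule str_res[OF assms(2)])
    have "x \<noteq> y" using 1(2,3) by auto
    with 1(1) show "red_res N \<Gamma> f (SRes P) (WNu U) \<or> lin_res N \<Gamma> f (SRes P) (WNu U) \<or> un_res N \<Gamma> f (SRes P) (WNu U)"
    proof (cases rule: join_eqE)
      case 1
      have "SRes P \<longrightarrow>\<^sub>s SRes R" using \<open>comm False x y P R\<close> 1 by (rule comm_red)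
      then have "red_res N \<Gamma> f (SRes P) (WNu U)"
        unfolding red_res_def \<open>U = wren (join f) W\<close> using str wren_res by metis
      then show ?thesis by blast
    next
      case (2 x' y')
      have "comm False x' y' (SRes P) (SRes R)"
        using 1(4) 2 by (intro comm_res) simp
      moreover have "\<Gamma> x' = Some (star Send T')" "\<Gamma> y' = Some (star Recv T')"
        using 1(2,3) 2 by simp_all
      ultimately have "un_res N \<Gamma> f (SRes P) (WNu U)"
        unfolding un_res_def \<open>U = wren (join f) W\<close> using 2(3) str wren_res by metis
      then show ?thesis by blast
    qed
  }
qed

text \<open>
  The residual of a linear communication on \<open>x\<close>, \<open>y\<close>: the continuations are put under a restriction of
  their own, which corresponds to the name created by the output in the translation.
\<close>
lemma str_push:
  assumes "str N \<Delta>1 P W1" "str N \<Delta>2 Q W2" "dom \<Delta>1 \<subseteq> N" "dom \<Delta>2 \<subseteq> N" "x \<in> N" "y \<in> N" "x \<noteq> y"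
    "session_type S" "\<Delta>1 x = Some S" "\<Delta>1 y = None" "\<Delta>2 x = None" "\<Delta>2 y = Some (sdual S)"
    "s_split \<Gamma> (\<Delta>1(x := None)) (\<Delta>2(y := None))"
  obtains W W' where "str N \<Gamma> (SRes (sren (push x y) (SPar P Q))) W"
    "wren f W = WNu (WPar (wren ((\<lambda>n. Suc (f n))(x := 0)) W1) (wren ((\<lambda>n. Suc (f n))(y := 0)) W2))"
    "str N \<Gamma> (SRes (sren (push x y) (SPar Q P))) W'"
    "wren f W' = WNu (WPar (wren ((\<lambda>n. Suc (f n))(y := 0)) W2) (wren ((\<lambda>n. Suc (f n))(x := 0)) W1))"
proof
  \<comment> \<open>Each continuation owns one endpoint of the new channel; \<open>?o\<close> adds
    the other one when the type is unrestricted, as splits then copy it.\<close>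
  let ?p = "push x y" and ?o = "\<lambda>U. if s_un S then Some U else None"
  let ?\<Delta>1 = "case_nat (Some S) (case_nat (?o (sdual S)) (\<Delta>1(x := None)))"
  let ?\<Delta>2 = "case_nat (?o S) (case_nat (Some (sdual S)) (\<Delta>2(y := None)))"
  let ?W = "WNu (wren (case_nat 0 id) (WPar (wren ?p W1) (wren ?p W2)))"
    and ?W' = "WNu (wren (case_nat 0 id) (WPar (wren ?p W2) (wren ?p W1)))"
  have scope: "scope_map N (scope (scope N)) ?p"
    using assms(5,6,7) by (auto simp: scope_map_def push_def inj_on_def)
  have split: "s_split (ext S (ext (sdual S) \<Gamma>)) ?\<Delta>1 ?\<Delta>2"
    unfolding s_split_def
  proof
    fix n show "s_split_entry (ext S (ext (sdual S) \<Gamma>) n) (?\<Delta>1 n) (?\<Delta>2 n)"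
      using s_split_D[OF assms(13), of "n - 2"]
      by (rule_tac nat2_cases[of n]) (simp_all add: s_split_entry_iff)
  qed
  have ok1: "sren_ok ?p \<Delta>1 ?\<Delta>1"
  proof (rule sren_okI)
    show "?\<Delta>1 (?p z) = Some U" if "\<Delta>1 z = Some U" for z U
      using that assms(9,10) by (auto simp: push_def)
    show "z' = z" if "?p z' = ?p z" for z z'
      using that assms(7) by (auto simp: push_def split: if_splits)
    show "\<exists>z. ?p z = n \<and> \<Delta>1 z = Some U" if n: "?\<Delta>1 n = Some U" "\<not> s_un U" for n U
    proof (rule nat2_cases[of n])
      assume "n = 0"
      then show ?thesis using n assms(7,9,10) by (intro exI[of _ x]) (auto simp: push_def split: if_splits)
    next
      assume "n = Suc 0"
      then show ?thesis using n assms(7,9,10) by (intro exI[of _ y]) (auto simp: push_def split: if_splits)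
    next
      fix m assume "n = Suc (Suc m)"
      then show ?thesis using n assms(7,9,10) by (intro exI[of _ m]) (auto simp: push_def split: if_splits)
    qed
  qed
  have ok2: "sren_ok ?p \<Delta>2 ?\<Delta>2"
  proof (rule sren_okI)
    show "?\<Delta>2 (?p z) = Some U" if "\<Delta>2 z = Some U" for z U
      using that assms(11,12) by (auto simp: push_def)
    show "z' = z" if "?p z' = ?p z" for z z'
      using that assms(7) by (auto simp: push_def split: if_splits)
    show "\<exists>z. ?p z = n \<and> \<Delta>2 z = Some U" if n: "?\<Delta>2 n = Some U" "\<not> s_un U" for n U
    proof (rule nat2_cases[of n])
      assume "n = 0"
      then show ?thesis using n assms(7,11,12) by (intro exI[of _ x]) (auto simp: push_def split: if_splits)
    next
      assume "n = Suc 0"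
      then show ?thesis using n assms(7,11,12) by (intro exI[of _ y]) (auto simp: push_def split: if_splits)
    next
      fix m assume "n = Suc (Suc m)"
      then show ?thesis using n assms(7,11,12) by (intro exI[of _ m]) (auto simp: push_def split: if_splits)
    qed
  qed
  have "str (scope (scope N)) (ext S (ext (sdual S) \<Gamma>)) (SPar (sren ?p P) (sren ?p Q)) (WPar (wren ?p W1) (wren ?p W2))"
    by (rule str_par[OF split str_sren[OF assms(1,3) scope ok1] str_sren[OF assms(2,4) scope ok2]])
  then show "str N \<Gamma> (SRes (sren ?p (SPar P Q))) ?W"
    unfolding sren.simps by (rule str_res[OF assms(8)])
  have "str (scope (scope N)) (ext S (ext (sdual S) \<Gamma>)) (SPar (sren ?p Q) (sren ?p P)) (WPar (wren ?p W2) (wren ?p W1))"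
    by (rule str_par[OF s_split_sym[OF split] str_sren[OF assms(2,4) scope ok2] str_sren[OF assms(1,3) scope ok1]])
  then show "str N \<Gamma> (SRes (sren ?p (SPar Q P))) ?W'"
    unfolding sren.simps by (rule str_res[OF assms(8)])
  have y: "y \<notin> wfn W1" using str_wfn[OF assms(1), of y] assms(6,10) by auto
  have x: "x \<notin> wfn W2" using str_wfn[OF assms(2), of x] assms(5,11) by auto
  have "wren (\<lambda>n. join f (?p n)) W1 = wren ((\<lambda>n. Suc (f n))(x := 0)) W1"
    using y by (intro wren_cong) (auto simp: push_def)
  moreover have "wren (\<lambda>n. join f (?p n)) W2 = wren ((\<lambda>n. Suc (f n))(y := 0)) W2"
    using x assms(7) by (intro wren_cong) (auto simp: push_def)
  ultimately show "wren f ?W = WNu (WPar (wren ((\<lambda>n. Suc (f n))(x := 0)) W1) (wren ((\<lambda>n. Suc (f n))(y := 0)) W2))"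
    "wren f ?W' = WNu (WPar (wren ((\<lambda>n. Suc (f n))(y := 0)) W2) (wren ((\<lambda>n. Suc (f n))(x := 0)) W1))"
    unfolding wren_res by simp_all
qed

section \<open>Matching an output with an input\<close>

lemma put_ok_split:
  assumes "s_split \<Gamma> \<Gamma>1 \<Gamma>2" "\<Gamma>1 v = Some T"
  shows "put_ok v T \<Gamma>2" "s_split \<Gamma> (s_take v T \<Gamma>1) (\<Gamma>2(v \<mapsto> T))"
proof -
  show "put_ok v T \<Gamma>2"
    using s_split_un[OF assms] s_split_lin[OF assms] by (simp add: put_ok_def)
  show "s_split \<Gamma> (s_take v T \<Gamma>1) (\<Gamma>2(v \<mapsto> T))"
    unfolding s_split_def
  proof
    fix y show "s_split_entry (\<Gamma> y) (s_take v T \<Gamma>1 y) ((\<Gamma>2(v \<mapsto> T)) y)"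
      using s_split_D[OF assms(1), of y] assms(2)
      by (cases "y = v") (auto simp: s_take_def s_split_entry_iff split: option.splits if_splits)
  qed
qed

text \<open>Both orders of the parallel composition are treated together, so that one induction
  serves the rules with the sender on the left and on the right. The third part is the side
  condition of \<open>stau\<close>.\<close>

definition comm_res_ok where
  "comm_res_ok N \<Gamma> f P Q W2 k a b c U1 U2 \<longleftrightarrow>
    tau_res N \<Gamma> f (SPar P Q) ((WNu ^^ k) (WPar U1 U2)) \<and>
    tau_res N \<Gamma> f (SPar Q P) ((WNu ^^ k) (WPar U2 U1)) \<and>
    (c < k \<or> (\<forall>c. wren (\<lambda>n. n + k) (wren f W2) \<midarrow>LIn (a + k) b c\<rightarrow>\<^sub>w U2))"

lemma comm_cli:
  assumes "out_cli N \<Gamma>1 f P k (a + k) b c U1" "str N \<Gamma>2 Q W2" "s_split \<Gamma> \<Gamma>1 \<Gamma>2" "dom \<Gamma> \<subseteq> N"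
    "coh f \<Gamma>" "wren (\<lambda>n. n + k) (wren f W2) \<midarrow>LIn (a + k) b c\<rightarrow>\<^sub>w U2"
  shows "comm_res_ok N \<Gamma> f P Q W2 k a b c U1 U2"
proof -
  obtain x v T P' W1' where 1: "k = 0" "a = f x" "b = f v"
     "\<Gamma>1 x = Some (star Send T)" "\<Gamma>1 v = Some T" "sout x v P P'" "str N (s_take v T \<Gamma>1) P' W1'" "U1 = wren f W1'"
    using assms(1) unfolding out_cli_def by auto
  note x = s_split_le(1)[OF assms(3) 1(4)] and v = s_split_le(1)[OF assms(3) 1(5)]
  have dom: "dom \<Gamma>2 \<subseteq> N" and "v \<in> N" using s_split_dom[OF assms(3)] assms(4) v by auto
  have tr: "wren f W2 \<midarrow>LIn a (f v) c\<rightarrow>\<^sub>w U2" using assms(6) 1 by simp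
  have "\<not> in_lin N \<Gamma>2 f Q a v c U2"
  proof
    assume "in_lin N \<Gamma>2 f Q a v c U2"
    then obtain y T' S where y: "a = f y" "\<Gamma>2 y = Some (SPre QLin Recv T' S)"
      unfolding in_lin_def by blast
    note y' = s_split_le(2)[OF assms(3) y(2)]
    have "x \<noteq> y" using x y' by auto
    \<comment> \<open>The two ends are dual by coherence, and the dual of a client type is a server
      type, never a linear one.\<close>
    then have "SPre QLin Recv T' S = sdual (star Send T)"
      using cohD[OF assms(5) x y' _ \<open>x \<noteq> y\<close>] y(1) 1(2) by metis
    then show False by simp
  qed
  then have "in_srv N \<Gamma>2 f Q W2 a v U2" using in_cases[OF assms(2) dom \<open>v \<in> N\<close> tr] by blast
  then obtain y T' Q' where 2: "a = f y" "\<Gamma>2 y = Some (star Recv T')" "sin y v Q Q'"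
     "put_ok v T' \<Gamma>2 \<Longrightarrow> \<exists>W'. str N (\<Gamma>2(v \<mapsto> T')) Q' W' \<and> U2 = wren f W'"
     "\<And>c. wren f W2 \<midarrow>LIn a (f v) c\<rightarrow>\<^sub>w U2"
    unfolding in_srv_def by blast
  note y = s_split_le(2)[OF assms(3) 2(2)]
  have "x \<noteq> y" using x y by auto
  then have "star Recv T' = sdual (star Send T)"
    using cohD[OF assms(5) x y _ \<open>x \<noteq> y\<close>] 1(2) 2(1) by metis
  then have T: "T' = T" by simp
  obtain W2' where W2': "str N (\<Gamma>2(v \<mapsto> T)) Q' W2'" "U2 = wren f W2'"
    using 2(4) put_ok_split(1)[OF assms(3) 1(5)] T by blast
  note split = put_ok_split(2)[OF assms(3) 1(5)]
  have comm: "comm False x y (SPar P Q) (SPar P' Q')" using 1(6) 2(3) by (rule comm_sout_sin)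
  have comm': "comm False x y (SPar Q P) (SPar Q' P')"
    by (rule comm_cong[OF sc_par_comm comm sc_par_comm])
  have "un_res N \<Gamma> f (SPar P Q) (WPar U1 U2)"
    unfolding un_res_def 1(8) W2'(2) wren.simps(5)[symmetric]
    using x y[unfolded T] comm str_par[OF split 1(7) W2'(1)] 1(2) 2(1) by metis
  moreover have "un_res N \<Gamma> f (SPar Q P) (WPar U2 U1)"
    unfolding un_res_def 1(8) W2'(2) wren.simps(5)[symmetric]
    using x y[unfolded T] comm' str_par[OF s_split_sym[OF split] W2'(1) 1(7)] 1(2) 2(1) by metis
  ultimately show ?thesis
    unfolding comm_res_ok_def tau_res_def using 1(1,3) 2(5) by simp
qed

lemma comm_lin:
  assumes "out_lin N \<Gamma>1 f P k (a + k) b c U1" "str N \<Gamma>2 Q W2" "s_split \<Gamma> \<Gamma>1 \<Gamma>2" "dom \<Gamma> \<subseteq> N"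
    "coh f \<Gamma>" "sess \<Gamma>" "wren (\<lambda>n. n + k) (wren f W2) \<midarrow>LIn (a + k) b c\<rightarrow>\<^sub>w U2"
  shows "comm_res_ok N \<Gamma> f P Q W2 k a b c U1 U2"
proof -
  let ?F = "\<lambda>n. Suc (f n)"
  obtain x v T S P' W1' where 1: "k = Suc 0" "a = f x" "b = ?F v" "c = 0"
     "\<Gamma>1 x = Some (SPre QLin Send T S)" "v \<noteq> x" "\<Gamma>1 v = Some T" "sout x v P P'"
     "str N ((s_take v T \<Gamma>1)(x \<mapsto> S)) P' W1'" "U1 = wren (?F(x := 0)) W1'"
    using assms(1) unfolding out_lin_def by auto
  note x = s_split_le(1)[OF assms(3) 1(5)] and v = s_split_le(1)[OF assms(3) 1(7)]
  have dom: "dom \<Gamma>1 \<subseteq> N" "dom \<Gamma>2 \<subseteq> N" and "v \<in> N" using s_split_dom[OF assms(3)] assms(4) v by auto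
  have tr: "wren ?F W2 \<midarrow>LIn (Suc a) (?F v) 0\<rightarrow>\<^sub>w U2" using assms(7) 1 by simp
  have "\<not> in_srv N \<Gamma>2 ?F Q W2 (Suc a) v U2"
  proof
    assume "in_srv N \<Gamma>2 ?F Q W2 (Suc a) v U2"
    then obtain y T' where y: "a = f y" "\<Gamma>2 y = Some (star Recv T')"
      unfolding in_srv_def by blast
    note y' = s_split_le(2)[OF assms(3) y(2)]
    have "x \<noteq> y" using x y' by auto
    then have "star Recv T' = sdual (SPre QLin Send T S)"
      using cohD[OF assms(5) x y' _ \<open>x \<noteq> y\<close>] y(1) 1(2) by metis
    then show False by simp
  qed
  then have "in_lin N \<Gamma>2 ?F Q (Suc a) v 0 U2" using in_cases[OF assms(2) dom(2) \<open>v \<in> N\<close> tr] by blast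
  then obtain y T' S' Q' where 2: "a = f y" "\<Gamma>2 y = Some (SPre QLin Recv T' S')" "sin y v Q Q'"
     "put_ok v T' \<Gamma>2 \<Longrightarrow> \<exists>W'. str N (\<Gamma>2(v \<mapsto> T', y \<mapsto> S')) Q' W' \<and> U2 = wren (?F(y := 0)) W'"
    unfolding in_lin_def by blast
  note y = s_split_le(2)[OF assms(3) 2(2)]
  have "x \<noteq> y" using x y by auto
  then have "SPre QLin Recv T' S' = sdual (SPre QLin Send T S)"
    using cohD[OF assms(5) x y _ \<open>x \<noteq> y\<close>] 1(2) 2(1) by metis
  then have T: "T' = T" "S' = sdual S" by simp_all
  obtain W2' where W2': "str N (\<Gamma>2(v \<mapsto> T, y \<mapsto> sdual S)) Q' W2'" "U2 = wren (?F(y := 0)) W2'"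
    using 2(4) put_ok_split(1)[OF assms(3) 1(7)] T by blast
  have x2: "\<Gamma>2 x = None" using s_split_lin[OF assms(3) 1(5)] by simp
  have y1: "\<Gamma>1 y = None" using s_split_lin[OF s_split_sym[OF assms(3)] 2(2)] by simp
  have "v \<noteq> y" using y1 1(7) by auto
  have N: "x \<in> N" "y \<in> N" using x y assms(4) by auto
  have dom1: "dom ((s_take v T \<Gamma>1)(x \<mapsto> S)) \<subseteq> N" using dom(1) N dom_s_take[of v T \<Gamma>1] by auto
  have dom2: "dom (\<Gamma>2(v \<mapsto> T, y \<mapsto> sdual S)) \<subseteq> N" using dom(2) N \<open>v \<in> N\<close> by auto
  \<comment> \<open>The restriction put around the continuations must have a type of the grammar,
    which linear continuations inherit.\<close>
  have S: "session_type S" using assms(6) x session_type_cont unfolding sess_def by blast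
  have split: "s_split (\<Gamma>(x := None, y := None)) (((s_take v T \<Gamma>1)(x \<mapsto> S))(x := None))
      ((\<Gamma>2(v \<mapsto> T, y \<mapsto> sdual S))(y := None))"
    unfolding s_split_def
  proof
    fix z
    show "s_split_entry ((\<Gamma>(x := None, y := None)) z) ((((s_take v T \<Gamma>1)(x \<mapsto> S))(x := None)) z)
      (((\<Gamma>2(v \<mapsto> T, y \<mapsto> sdual S))(y := None)) z)"
      using s_split_D[OF put_ok_split(2)[OF assms(3) 1(7)], of z] x2 y1 \<open>x \<noteq> y\<close> \<open>v \<noteq> x\<close> \<open>v \<noteq> y\<close>
      by (cases "z = x"; cases "z = y") (simp_all add: s_split_entry_iff s_take_def)
  qed
  have "((s_take v T \<Gamma>1)(x \<mapsto> S)) y = None" "(\<Gamma>2(v \<mapsto> T, y \<mapsto> sdual S)) x = None"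
    using x2 y1 \<open>x \<noteq> y\<close> \<open>v \<noteq> x\<close> by (auto simp: s_take_def)
  then obtain W W' where W: "str N (\<Gamma>(x := None, y := None)) (SRes (sren (push x y) (SPar P' Q'))) W"
    "wren f W = WNu (WPar U1 U2)"
    "str N (\<Gamma>(x := None, y := None)) (SRes (sren (push x y) (SPar Q' P'))) W'"
    "wren f W' = WNu (WPar U2 U1)"
    using str_push[OF 1(9) W2'(1) dom1 dom2 N \<open>x \<noteq> y\<close> S _ _ _ _ split, of f]
    unfolding 1(10) W2'(2) by auto
  have comm: "comm False x y (SPar P Q) (SPar P' Q')" using 1(8) 2(3) by (rule comm_sout_sin)
  have comm': "comm False x y (SPar Q P) (SPar Q' P')"
    by (rule comm_cong[OF sc_par_comm comm sc_par_comm])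
  have "lin_res N \<Gamma> f (SPar P Q) (WNu (WPar U1 U2))"
    unfolding lin_res_def W(2)[symmetric]
    using x y[unfolded T] comm_push[OF comm] W(1) 1(2) 2(1) by metis
  moreover have "lin_res N \<Gamma> f (SPar Q P) (WNu (WPar U2 U1))"
    unfolding lin_res_def W(4)[symmetric]
    using x y[unfolded T] comm_push[OF comm'] W(3) 1(2) 2(1) by metis
  ultimately show ?thesis
    unfolding comm_res_ok_def tau_res_def using 1(1,4) by simp
qed

lemma funpow_Suc_WNu: "(WNu ^^ Suc k) P = WNu ((WNu ^^ k) P)"
  by simp

text \<open>Moving the restriction of an extruded payload outwards over both processes lowers the
  number of extruded names by one. The induction ends at a client output that extrudes nothing or at
  a linear output that extrudes its own new name.\<close>

lemma comm_out_in:
  "str N \<Gamma>1 P W1 \<Longrightarrow> str N \<Gamma>2 Q W2 \<Longrightarrow> s_split \<Gamma> \<Gamma>1 \<Gamma>2 \<Longrightarrow> dom \<Gamma> \<subseteq> N \<Longrightarrow> coh f \<Gamma> \<Longrightarrow> sess \<Gamma> \<Longrightarrow>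
    wren f W1 \<midarrow>LOut k (a + k) b c\<rightarrow>\<^sub>w U1 \<Longrightarrow> wren (\<lambda>n. n + k) (wren f W2) \<midarrow>LIn (a + k) b c\<rightarrow>\<^sub>w U2 \<Longrightarrow>
    comm_res_ok N \<Gamma> f P Q W2 k a b c U1 U2"
proof (induction k arbitrary: N \<Gamma> \<Gamma>1 \<Gamma>2 P Q W1 W2 f a)
  case 0
  have "dom \<Gamma>1 \<subseteq> N" using s_split_dom[OF 0(3)] 0(4) by simp
  then have "out_cli N \<Gamma>1 f P 0 (a + 0) b c U1"
    using out_cases[OF 0(1) _ 0(7)] by (auto simp: out_lin_def out_ext_def)
  then show ?case using 0(2-5,8) by (rule comm_cli)
next
  case (Suc k)
  note prems = Suc.prems
  have dom: "dom \<Gamma>1 \<subseteq> N" "dom \<Gamma>2 \<subseteq> N" using s_split_dom[OF prems(3)] prems(4) by simp_all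
  have "\<not> out_cli N \<Gamma>1 f P (Suc k) (a + Suc k) b c U1" by (simp add: out_cli_def)
  with out_cases[OF prems(1) dom(1) prems(7)] consider
    "out_lin N \<Gamma>1 f P (Suc k) (a + Suc k) b c U1" | "out_ext N \<Gamma>1 f P (Suc k) (a + Suc k) b c U1" by blast
  then show ?case
  proof cases
    case 1
    then show ?thesis using prems(2-6,8) by (rule comm_lin)
  next
    case 2
    then obtain T P1 W1' where 3: "session_type T" "P \<equiv>\<^sub>s SRes P1"
      "str (scope (scope N)) (ext T (ext (sdual T) \<Gamma>1)) P1 W1'"
      "wren (join f) W1' \<midarrow>LOut k (Suc a + k) b c\<rightarrow>\<^sub>w U1"
      unfolding out_ext_def by auto
    have eq: "wren (\<lambda>n. n + k) (wren (join f) (wren shift2 W2)) = wren (\<lambda>n. n + Suc k) (wren f W2)" by simp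
    have "comm_res_ok (scope (scope N)) (ext T (ext (sdual T) \<Gamma>)) (join f) P1 (sren shift2 Q) (wren shift2 W2) k (Suc a) b c U1 U2"
      using prems(8) eq
      by (intro Suc.IH[OF 3(3) str_lift2[OF prems(2) dom(2)] s_split_lift2[OF prems(3)] dom_ext2_subset[OF prems(4)]
          coh_ext[OF prems(5)] sess_ext[OF prems(6) 3(1)] 3(4)]) simp
    then have 4: "tau_res N \<Gamma> f (SRes (SPar P1 (sren shift2 Q))) ((WNu ^^ Suc k) (WPar U1 U2))"
      "tau_res N \<Gamma> f (SRes (SPar (sren shift2 Q) P1)) ((WNu ^^ Suc k) (WPar U2 U1))"
      "c < k \<or> (\<forall>c. wren (\<lambda>n. n + Suc k) (wren f W2) \<midarrow>LIn (a + Suc k) b c\<rightarrow>\<^sub>w U2)"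
      unfolding comm_res_ok_def funpow_Suc_WNu eq using tau_res_res[OF _ 3(1) prems(4)] by auto
    have "SPar P Q \<equiv>\<^sub>s SRes (SPar P1 (sren shift2 Q))" "SPar Q P \<equiv>\<^sub>s SRes (SPar (sren shift2 Q) P1)"
      by (rule sc_trans[OF scong_par_cong1[OF 3(2)] sc_res_ext],
          rule sc_trans[OF scong_par_cong2[OF 3(2)] scong_res_ext_right])
    then show ?thesis
      unfolding comm_res_ok_def using 4 tau_res_cong less_SucI by blast
  qed
qed

text \<open>
  The \<open>\<tau>\<close>-transitions in which a transmitted second name that is not extruded is irrelevant for the
  receiver, as it is for a server of a translated process.  Without this condition, the residual
  could contain a name of type \<open>unit\<close> that is not in the context.
\<close>
inductive stau :: "wproc \<Rightarrow> wproc \<Rightarrow> bool" where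
  stau_res: "stau P P' \<Longrightarrow> stau (WNu P) (WNu P')"
| stau_parL: "stau P P' \<Longrightarrow> stau (WPar P Q) (WPar P' Q)"
| stau_parR: "stau P P' \<Longrightarrow> stau (WPar Q P) (WPar Q P')"
| stau_comL: "P \<midarrow>LOut k (a + k) b c\<rightarrow>\<^sub>w P' \<Longrightarrow> wren (\<lambda>n. n + k) Q \<midarrow>LIn (a + k) b c\<rightarrow>\<^sub>w Q' \<Longrightarrow>
    c < k \<or> (\<forall>c. wren (\<lambda>n. n + k) Q \<midarrow>LIn (a + k) b c\<rightarrow>\<^sub>w Q') \<Longrightarrow>
    stau (WPar P Q) ((WNu ^^ k) (WPar P' Q'))"
| stau_comR: "P \<midarrow>LOut k (a + k) b c\<rightarrow>\<^sub>w P' \<Longrightarrow> wren (\<lambda>n. n + k) Q \<midarrow>LIn (a + k) b c\<rightarrow>\<^sub>w Q' \<Longrightarrow>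
    c < k \<or> (\<forall>c. wren (\<lambda>n. n + k) Q \<midarrow>LIn (a + k) b c\<rightarrow>\<^sub>w Q') \<Longrightarrow>
    stau (WPar Q P) ((WNu ^^ k) (WPar Q' P'))"

text \<open>The two conclusions are proved together, because it is the session types that tell when
  the receiver is a server.\<close>

lemma tau_cases:
  "str N \<Gamma> P W \<Longrightarrow> dom \<Gamma> \<subseteq> N \<Longrightarrow> coh f \<Gamma> \<Longrightarrow> sess \<Gamma> \<Longrightarrow> wren f W \<midarrow>Tau\<rightarrow>\<^sub>w U \<Longrightarrow>
    tau_res N \<Gamma> f P U \<and> stau (wren f W) U"
proof (induction arbitrary: f U rule: str.induct)
  case (str_nil \<Gamma> N)
  then show ?case by (auto elim: wtrans_NilE)
next
  case (str_par \<Gamma> \<Gamma>1 \<Gamma>2 N P W1 Q W2)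
  have dom: "dom \<Gamma>1 \<subseteq> N" "dom \<Gamma>2 \<subseteq> N"
    using s_split_dom[OF str_par(1)] str_par.prems(1) by simp_all
  note split = str_par(1) and split' = s_split_sym[OF str_par(1)] and prems = str_par.prems
  show ?case
    using prems(4)[unfolded wren.simps]
  proof (cases rule: wtrans_Par_tauE)
    case (left U1)
    then show ?thesis
      using str_par.IH(1)[OF dom(1) coh_split[OF split prems(2)] sess_split[OF split prems(3)]]
        tau_res_par(1)[OF _ split str_par(3)] stau_parL by auto
  next
    case (right U2)
    then show ?thesis
      using str_par.IH(2)[OF dom(2) coh_split[OF split' prems(2)] sess_split[OF split' prems(3)]]
        tau_res_par(2)[OF _ split' str_par(2)] stau_parR by auto
  next
    case (comL k a b c U1 U2)
    have "comm_res_ok N \<Gamma> f P Q W2 k a b c U1 U2"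
      using comm_out_in[OF str_par(2,3) split prems(1-3) comL(2,3)] .
    then show ?thesis
      using stau_comL[OF comL(2,3)] unfolding comm_res_ok_def comL(1) by simp
  next
    case (comR k a b c U1 U2)
    have "comm_res_ok N \<Gamma> f Q P W1 k a b c U2 U1"
      using comm_out_in[OF str_par(3,2) split' prems(1-3) comR(3,2)] .
    then show ?thesis
      using stau_comR[OF comR(3,2)] unfolding comm_res_ok_def comR(1) by simp
  qed
next
  case (str_res T N \<Gamma> P W)
  from str_res.prems(4) obtain U0 where U: "U = WNu U0" and tr: "wren (join f) W \<midarrow>Tau\<rightarrow>\<^sub>w U0"
    unfolding wren_res by (auto elim: wtrans_Nu_tauE)
  show ?case
    using str_res.IH[OF dom_ext2_subset[OF str_res.prems(1)] coh_ext[OF str_res.prems(2)]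
      sess_ext[OF str_res.prems(3) str_res(1)] tr] tau_res_res[OF _ str_res(1) str_res.prems(1)]
    unfolding U wren_res by (blast intro: stau_res)
next
  case (str_lin_out \<Gamma> x T S v N P W)
  then show ?case by (auto elim!: wtrans_Nu_tauE wtrans_Out_tauE)
qed (auto elim: wtrans_In_tauE wtrans_Rep_tauE wtrans_Out_tauE)

text \<open>With the identity as \<open>f\<close> no names are merged, so a communication between
  free names would need one name with two different types. Only a reduction remains.\<close>

lemma translated_tau:
  assumes "str N \<Gamma> P W" "dom \<Gamma> \<subseteq> N" "sess \<Gamma>" "W \<midarrow>Tau\<rightarrow>\<^sub>w U"
  obtains R where "P \<longrightarrow>\<^sub>s R" "str N \<Gamma> R U" "stau W U"
proof -
  have "coh (\<lambda>n. n) \<Gamma>" by (simp add: coh_def)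
  then have "tau_res N \<Gamma> (\<lambda>n. n) P U \<and> stau W U"
    using tau_cases[OF assms(1,2) _ assms(3), of "\<lambda>n. n" U] assms(4) by simp
  moreover have "\<not> lin_res N \<Gamma> (\<lambda>n. n) P U" "\<not> un_res N \<Gamma> (\<lambda>n. n) P U"
    by (auto simp: lin_res_def un_res_def)
  ultimately show thesis
    using that unfolding tau_res_def red_res_def by auto
qed

section \<open>Typing with weights\<close>

lemma wdual_wdual [simp]: "wdual (wdual V) = V"
  by (induction V) auto

lemma w_un_wdual [simp]: "w_un (wdual V) = w_un V"
  by (cases V) auto

lemma level_of_wdual [simp]: "level_of (wdual V) k = level_of V k"
  by (cases V) auto

lemma weights_pos_wdual [simp]: "weights_pos (wdual V) = weights_pos V"
  by (induction V) auto

lemma wdual_neq: "\<not> w_un V \<Longrightarrow> wdual V \<noteq> V"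
  by (cases V) auto

lemma both_wdual: "both (wdual V) = both V"
  by auto

lemma both_eq_iff: "both V = both V' \<longleftrightarrow> V' = V \<or> V' = wdual V"
  by (auto simp: doubleton_eq_iff)

lemma w_split_entry_iff: "w_split_entry a b c \<longleftrightarrow> (case a of None \<Rightarrow> b = None \<and> c = None
   | Some e \<Rightarrow> if e_un e then b = a \<and> c = a else (b = a \<and> c = None) \<or> (b = None \<and> c = a) \<or>
      (\<exists>V. e = both V \<and> b = Some (One V) \<and> c = Some (One (wdual V))))"
  by (cases a) (auto simp: w_split_entry.simps)

lemma w_split_entry_sym: "w_split_entry a b c \<Longrightarrow> w_split_entry a c b"
  unfolding w_split_entry_iff
  by (auto split: option.splits if_splits)

lemma w_split_D: "w_split \<Delta> \<Delta>1 \<Delta>2 \<Longrightarrow> w_split_entry (\<Delta> x) (\<Delta>1 x) (\<Delta>2 x)"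
  by (simp add: w_split_def)

lemma w_split_sym: "w_split \<Delta> \<Delta>1 \<Delta>2 \<Longrightarrow> w_split \<Delta> \<Delta>2 \<Delta>1"
  unfolding w_split_def by (metis w_split_entry_sym)

lemma w_split_dom: assumes "w_split \<Delta> \<Delta>1 \<Delta>2" shows "dom \<Delta>1 \<subseteq> dom \<Delta>" "dom \<Delta>2 \<subseteq> dom \<Delta>"
proof -
  have A: "\<Delta>1 x \<noteq> None \<Longrightarrow> \<Delta> x \<noteq> None" "\<Delta>2 x \<noteq> None \<Longrightarrow> \<Delta> x \<noteq> None" for x
    using w_split_D[OF assms, of x] by (auto simp: w_split_entry_iff split: option.splits)
  show "dom \<Delta>1 \<subseteq> dom \<Delta>" by (intro subsetI, unfold domIff) (rule A(1))
  show "dom \<Delta>2 \<subseteq> dom \<Delta>" by (intro subsetI, unfold domIff) (rule A(2))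
qed

lemma w_split_upd:
  assumes "w_split \<Delta> \<Delta>1 \<Delta>2" "\<And>d. e = Some d \<Longrightarrow> e_un d"
  shows "w_split (\<Delta>(x := e)) (\<Delta>1(x := e)) (\<Delta>2(x := e))"
  unfolding w_split_def
proof
  fix y show "w_split_entry ((\<Delta>(x := e)) y) ((\<Delta>1(x := e)) y) ((\<Delta>2(x := e)) y)"
    using w_split_D[OF assms(1), of y] assms(2)
    by (cases "y = x") (auto simp: w_split_entry_iff split: option.splits)
qed

lemma w_un_ctx_iff: "w_un_ctx \<Delta> \<longleftrightarrow> (\<forall>x e. \<Delta> x = Some e \<longrightarrow> e_un e)"
  by (auto simp: w_un_ctx_def ran_def)

section \<open>Contexts of the calculus with weights as explicit functions\<close>

definition has :: "name \<Rightarrow> wtype \<Rightarrow> wctx \<Rightarrow> bool" where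
  "has x V \<Delta> \<longleftrightarrow> \<Delta> x = Some (One V) \<or> \<Delta> x = Some (both V)"

text \<open>What is left after a use of \<open>x\<close> at type \<open>V\<close>: using one half of
  a linear \<open>x::V\<close> leaves the dual half.\<close>

definition wtake :: "name \<Rightarrow> wtype \<Rightarrow> wctx \<Rightarrow> wctx" where
  "wtake x V \<Delta> = (if w_un V then \<Delta> else \<Delta>(x := if \<Delta> x = Some (One V) then None else Some (One (wdual V))))"

text \<open>The counterpart of \<open>split_s_var\<close>. The last hypothesis excludes that a
  linear \<open>x::V\<close> goes to the judgment for \<open>x\<close> as a whole, where the dual
  half would be lost.\<close>

lemma split_w_var:
  assumes "w_split \<Delta> \<Delta>1 \<Delta>2" "w_var \<Delta>1 x V" "\<Delta>1 x = Some (One V) \<or> w_un V"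
  shows "has x V \<Delta>" "\<Delta>2 = wtake x V \<Delta>"
proof -
  note x = w_split_D[OF assms(1), of x]
  show "has x V \<Delta>"
    using assms(2,3) x
    by (auto simp: w_var_def has_def w_split_entry_iff split: option.splits if_splits)
  show "\<Delta>2 = wtake x V \<Delta>"
  proof
    fix y
    show "\<Delta>2 y = wtake x V \<Delta> y"
    proof (cases "y = x")
      case True
      then show ?thesis
        using assms(2,3) x wdual_neq[of V]
        by (auto simp: w_var_def wtake_def w_split_entry_iff split: option.splits if_splits)
    next
      case False
      then have "\<Delta>1 y = Some e \<Longrightarrow> e_un e" for e
        using assms(2) by (auto simp: w_var_def w_un_ctx_iff split: if_splits)
      then show ?thesis
        using w_split_D[OF assms(1), of y] False
        by (auto simp: wtake_def w_split_entry_iff split: option.splits if_splits)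
    qed
  qed
qed

lemma ex_split_w_var:
  assumes "has x V \<Delta>"
  obtains \<Delta>1 where "w_split \<Delta> \<Delta>1 (wtake x V \<Delta>)" "w_var \<Delta>1 x V" "\<Delta>1 x = Some (One V) \<or> w_un V"
proof
  let ?\<Delta>1 = "\<lambda>y. if y = x then (if w_un V then \<Delta> x else Some (One V))
    else case \<Delta> y of None \<Rightarrow> None | Some e \<Rightarrow> if e_un e then Some e else None"
  show "w_split \<Delta> ?\<Delta>1 (wtake x V \<Delta>)"
    unfolding w_split_def
  proof
    fix y show "w_split_entry (\<Delta> y) (?\<Delta>1 y) (wtake x V \<Delta> y)"
      using assms by (cases "y = x") (auto simp: has_def wtake_def w_split_entry_iff split: option.splits)
  qed
  show "w_var ?\<Delta>1 x V"
    using assms by (auto simp: w_var_def has_def w_un_ctx_iff split: option.splits if_splits)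
  show "?\<Delta>1 x = Some (One V) \<or> w_un V" by simp
qed

text \<open>
  The rules of \<open>wtyped\<close> with explicit contexts, for processes of the shape of a translation: a linear
  output comes with the restriction of its second object, and the second object of an output on a
  client is not in the scope \<open>N\<close> (and then can be omitted from the context of the continuation).
\<close>
inductive wtyp :: "name set \<Rightarrow> (name \<Rightarrow> nat) \<Rightarrow> wctx \<Rightarrow> wproc \<Rightarrow> nat set \<Rightarrow> bool" where
  wtyp_nil: "w_un_ctx \<Delta> \<Longrightarrow> wtyp N l \<Delta> WNil {}"
| wtyp_par: "w_split \<Delta> \<Delta>1 \<Delta>2 \<Longrightarrow> wtyp N l \<Delta>1 P L1 \<Longrightarrow> wtyp N l \<Delta>2 Q L2 \<Longrightarrow>
     wtyp N l \<Delta> (WPar P Q) (L1 \<union> L2)"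
| wtyp_res: "weights_pos V \<Longrightarrow> level_of V k \<Longrightarrow> wtyp (scope N) (case_nat k l) (ext (both V) \<Delta>) P L \<Longrightarrow>
     wtyp N l \<Delta> (WNu P) L"
| wtyp_lin_in: "has x (TIn n V1 V2) \<Delta> \<Longrightarrow> level_of V1 k1 \<Longrightarrow> level_of V2 (l x) \<Longrightarrow>
     wtyp (scope (scope N)) (case_nat k1 (case_nat (l x) l))
       (ext (One V1) (ext (One V2) (wtake x (TIn n V1 V2) \<Delta>))) P L \<Longrightarrow>
     wtyp N l \<Delta> (WIn x P) L"
| wtyp_srv_in: "has x (TSrv n V) \<Delta> \<Longrightarrow> level_of V k1 \<Longrightarrow>
     wtyp (scope (scope N)) (case_nat k1 (case_nat k2 l)) (ext (One V) (ext (One TUnit) \<Delta>)) P L \<Longrightarrow>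
     wtyp N l \<Delta> (WIn x P) L"
| wtyp_rep: "w_un_ctx \<Delta> \<Longrightarrow> has x (TSrv n V) \<Delta> \<Longrightarrow> level_of V k1 \<Longrightarrow>
     wtyp (scope (scope N)) (case_nat k1 (case_nat k2 l)) (ext (One V) (ext (One TUnit) \<Delta>)) P L \<Longrightarrow>
     \<forall>m\<in>L. m < n \<Longrightarrow> wtyp N l \<Delta> (WRep x P) {}"
| wtyp_lin_out: "has x (TOut n V1 V2) \<Delta> \<Longrightarrow> has v V1 (wtake x (TOut n V1 V2) \<Delta>) \<Longrightarrow>
     weights_pos V2 \<Longrightarrow> level_of V2 (l x) \<Longrightarrow>
     wtyp (scope N) (case_nat (l x) l) (ext (One V2) (wtake v V1 (wtake x (TOut n V1 V2) \<Delta>))) P L \<Longrightarrow>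
     wtyp N l \<Delta> (WNu (WOut (Suc x) (Suc v) 0 P)) (insert (l x) L)"
| wtyp_cli_out: "has x (TCli n V) \<Delta> \<Longrightarrow> has v V \<Delta> \<Longrightarrow> z \<notin> N \<Longrightarrow> z \<notin> wfn P \<Longrightarrow>
     wtyp N l (wtake v V \<Delta>) P L \<Longrightarrow> wtyp N l \<Delta> (WOut x v z P) (insert (l x) L)"

text \<open>Provides the induction by which a typing of a translated process is brought into the
  form \<open>wtyp\<close>: a restriction directly above a linear output is treated as one unit with
  it.\<close>

inductive shape :: "name set \<Rightarrow> wproc \<Rightarrow> bool" where
  shape_nil: "shape N WNil"
| shape_par: "shape N P \<Longrightarrow> shape N Q \<Longrightarrow> shape N (WPar P Q)"
| shape_res: "shape (scope N) P \<Longrightarrow> shape N (WNu P)"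
| shape_in: "shape (scope (scope N)) P \<Longrightarrow> shape N (WIn x P)"
| shape_rep: "shape (scope (scope N)) P \<Longrightarrow> shape N (WRep x P)"
| shape_lin_out: "shape (scope N) P \<Longrightarrow> shape N (WNu (WOut (Suc x) (Suc v) 0 P))"
| shape_cli_out: "z \<notin> N \<Longrightarrow> z \<notin> wfn P \<Longrightarrow> shape N P \<Longrightarrow> shape N (WOut x v z P)"

lemma shape_wren: "shape N P \<Longrightarrow> scope_map N N' f \<Longrightarrow> shape N' (wren f P)"
proof (induction arbitrary: N' f rule: shape.induct)
  case (shape_cli_out z N P x v)
  have "f z \<notin> wfn (wren f P)"
    using shape_cli_out(2) scope_map_eq[OF shape_cli_out.prems shape_cli_out(1)] unfolding wfn_wren
    by (metis imageE)
  then show ?case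
    using shape_cli_out scope_map_mem by (auto intro!: shape.shape_cli_out)
next
  case (shape_lin_out N P x v)
  then show ?case by (simp add: shape.shape_lin_out scope_map_up)
qed (simp_all add: shape.intros scope_map_up)

lemma str_shape: "str N \<Gamma> P W \<Longrightarrow> dom \<Gamma> \<subseteq> N \<Longrightarrow> shape N W"
proof (induction rule: str.induct)
  case (str_par \<Gamma> \<Gamma>1 \<Gamma>2 N P W1 Q W2)
  then show ?case using s_split_dom[OF str_par(1)] by (auto intro!: shape_par)
next
  case (str_res T N \<Gamma> P W)
  have "case_nat 0 id n \<in> scope N \<longleftrightarrow> n \<in> scope (scope N)" for n
    by (rule nat2_cases[of n]) simp_all
  moreover have "inj_on (case_nat 0 id) (- scope (scope N))"
    by (auto simp: inj_on_def not_scope2)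
  ultimately have "scope_map (scope (scope N)) (scope N) (case_nat 0 id)"
    by (simp add: scope_map_def)
  then show ?case
    using str_res.IH[OF dom_ext2_subset[OF str_res.prems]] by (intro shape_res shape_wren)
next
  case (str_lin_in \<Gamma> x T S N P W)
  have x: "x \<in> N" using str_lin_in by auto
  let ?f = "case_nat 0 ((\<lambda>n. Suc (Suc n))(x := Suc 0))"
  have "?f n \<in> scope (scope N) \<longleftrightarrow> n \<in> scope N" for n
    using x by (cases n) auto
  moreover have "inj_on ?f (- scope N)"
    using x by (auto simp: inj_on_def mem_scope_cases split: nat.splits if_splits)
  ultimately have "scope_map (scope N) (scope (scope N)) ?f" by (simp add: scope_map_def)
  moreover have "dom (ext T (\<Gamma>(x \<mapsto> S))) \<subseteq> scope N"
    using str_lin_in.prems x by (intro dom_ext_subset) auto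
  ultimately show ?case using str_lin_in.IH by (intro shape_in shape_wren)
next
  case (str_srv_in \<Gamma> x T N P W)
  have "scope_map (scope N) (scope (scope N)) (case_nat 0 (\<lambda>n. Suc (Suc n)))"
    by (auto simp: scope_map_def inj_on_def mem_scope_cases split: nat.splits)
  then show ?case
    using str_srv_in.IH[OF dom_ext_subset[OF str_srv_in.prems]] by (intro shape_in shape_wren)
next
  case (str_un_in \<Gamma> x T N P W)
  have "scope_map (scope N) (scope (scope N)) (case_nat 0 (\<lambda>n. Suc (Suc n)))"
    by (auto simp: scope_map_def inj_on_def mem_scope_cases split: nat.splits)
  then show ?case
    using str_un_in.IH[OF dom_ext_subset[OF str_un_in.prems]] by (intro shape_rep shape_wren)
next
  case (str_lin_out \<Gamma> x T S v N P W)
  have x: "x \<in> N" using str_lin_out by auto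
  have "scope_map N (scope N) (Suc(x := 0))"
    using x by (auto simp: scope_map_def inj_on_def)
  moreover have "dom ((s_take v T \<Gamma>)(x \<mapsto> S)) \<subseteq> N"
    using str_lin_out.prems x dom_s_take[of v T \<Gamma>] by auto
  ultimately show ?case using str_lin_out.IH by (intro shape_lin_out shape_wren)
next
  case (str_cli_out \<Gamma> x T v N P W z)
  then show ?case using dom_s_take[of v T \<Gamma>] by (auto intro!: shape_cli_out)
qed (auto intro: shape.intros)

lemma wtyp_shape: "wtyp N l \<Delta> P L \<Longrightarrow> shape N P"
  by (induction rule: wtyp.induct) (auto intro: shape.intros)

lemma scope_mono: "N' \<subseteq> N \<Longrightarrow> scope N' \<subseteq> scope N"
  by (auto simp: scope_def)

lemma shape_antimono: "shape N P \<Longrightarrow> N' \<subseteq> N \<Longrightarrow> shape N' P"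
  by (induction arbitrary: N' rule: shape.induct) (auto intro!: shape.intros simp: scope_mono)

lemma shape_insert: "shape N P \<Longrightarrow> c \<notin> wfn P \<Longrightarrow> shape (insert c N) P"
proof (induction arbitrary: c rule: shape.induct)
  have insert: "scope (insert c N) = insert (Suc c) (scope N)" for c N
    by (auto simp: scope_def)
  case (shape_lin_out N P x v)
  then show ?case using insert by (auto intro!: shape.shape_lin_out)
next
  have insert: "scope (insert c N) = insert (Suc c) (scope N)" for c N
    by (auto simp: scope_def)
  {
    case (shape_res N P)
    then show ?case using insert by (auto intro!: shape.shape_res)
  next
    case (shape_in N P x)
    then show ?case using insert by (auto intro!: shape.shape_in)
  next
    case (shape_rep N P x)
    then show ?case using insert by (auto intro!: shape.shape_rep)
  }
qed (auto intro: shape.intros)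

lemma w_un_ctx_upd: "w_un_ctx \<Delta> \<Longrightarrow> (\<And>d. e = Some d \<Longrightarrow> e_un d) \<Longrightarrow> w_un_ctx (\<Delta>(y := e))"
  by (auto simp: w_un_ctx_iff)

lemma w_var_upd:
  assumes "w_var \<Delta> x V" "y \<noteq> x" "\<And>d. e = Some d \<Longrightarrow> e_un d"
  shows "w_var (\<Delta>(y := e)) x V"
  using assms w_un_ctx_upd[of "\<Delta>(x := None)" e y] by (simp add: w_var_def fun_upd_twist)

lemma w_payload_upd:
  assumes "w_payload \<Delta> x V" "y \<noteq> x" "\<And>d. e = Some d \<Longrightarrow> e_un d"
  shows "w_payload (\<Delta>(y := e)) x V"
  using assms w_var_upd[of \<Delta> x V y e] by (simp add: w_payload_def)

text \<open>Weakening, strengthening and change of an entry in one: for a name that does not occur,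
  the rules only ask its entry to be unrestricted. This removes the \<open>unit\<close> entry of the
  second object below a client output, and restores it in the converse direction.\<close>

lemma wtyped_upd_fresh:
  "wtyped l \<Delta> P L \<Longrightarrow> x \<notin> wfn P \<Longrightarrow> (\<And>d. \<Delta> x = Some d \<Longrightarrow> e_un d) \<Longrightarrow> (\<And>d. e = Some d \<Longrightarrow> e_un d) \<Longrightarrow>
    wtyped l (\<Delta>(x := e)) P L"
proof (induction arbitrary: x rule: wtyped.induct)
  case (wty_nil \<Delta> l)
  then show ?case by (auto simp: w_un_ctx_iff intro: wtyped.wty_nil)
next
  case (wty_par \<Delta> \<Delta>1 \<Delta>2 l P L1 Q L2)
  have "\<Delta>1 x = Some d \<Longrightarrow> e_un d" "\<Delta>2 x = Some d \<Longrightarrow> e_un d" for d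
    using w_split_D[OF wty_par(1), of x] wty_par.prems(2)
    by (auto simp: w_split_entry_iff split: option.splits)
  then have "wtyped l (\<Delta>1(x := e)) P L1" "wtyped l (\<Delta>2(x := e)) Q L2"
    using wty_par.prems(1,3) by (auto intro!: wty_par.IH simp del: fun_upd_apply)
  then show ?case
    using wty_par.prems(3) by (intro wtyped.wty_par[OF w_split_upd[OF wty_par(1)]])
next
  case (wty_res V k l \<Delta> P L)
  then have "wtyped (case_nat k l) (ext (both V) (\<Delta>(x := e))) P L"
    using wty_res.IH[of "Suc x"] by simp
  then show ?case using wty_res by (intro wtyped.wty_res)
next
  case (wty_lin_in \<Delta> \<Delta>1 \<Delta>2 x' n V1 V2 k1 k2 l P L)
  have un: "\<Delta>2 x = Some d \<Longrightarrow> e_un d" for d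
    using w_split_D[OF wty_lin_in(1), of x] wty_lin_in.prems(2)
    by (auto simp: w_split_entry_iff split: option.splits)
  then have "wtyped (case_nat k1 (case_nat k2 l)) (ext (One V1) (ext (One V2) (\<Delta>2(x := e)))) P L"
    using wty_lin_in.IH[of "Suc (Suc x)"] wty_lin_in.prems by simp
  moreover have "w_var (\<Delta>1(x := e)) x' (TIn n V1 V2)"
    using wty_lin_in(3) wty_lin_in.prems(1,3) by (intro w_var_upd) auto
  ultimately show ?case
    using wty_lin_in(2,4-6) wty_lin_in.prems
    by (intro wtyped.wty_lin_in[OF w_split_upd[OF wty_lin_in(1)]]) auto
next
  case (wty_srv_in \<Delta> \<Delta>1 \<Delta>2 x' n V k1 k2 l P L)
  have un: "\<Delta>2 x = Some d \<Longrightarrow> e_un d" for d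
    using w_split_D[OF wty_srv_in(1), of x] wty_srv_in.prems(2)
    by (auto simp: w_split_entry_iff split: option.splits)
  then have "wtyped (case_nat k1 (case_nat k2 l)) (ext (One V) (ext (One TUnit) (\<Delta>2(x := e)))) P L"
    using wty_srv_in.IH[of "Suc (Suc x)"] wty_srv_in.prems by simp
  moreover have "w_var (\<Delta>1(x := e)) x' (TSrv n V)"
    using wty_srv_in(2) wty_srv_in.prems(1,3) by (intro w_var_upd) auto
  ultimately show ?case
    using wty_srv_in(3,4) wty_srv_in.prems
    by (intro wtyped.wty_srv_in[OF w_split_upd[OF wty_srv_in(1)]]) auto
next
  case (wty_lin_out \<Delta> \<Delta>1 \<Delta>' \<Delta>2 \<Delta>3 x' n V1 V2 y1 y2 l P L)
  have "\<Delta>' x = Some d \<Longrightarrow> e_un d" for d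
    using w_split_D[OF wty_lin_out(1), of x] wty_lin_out.prems(2)
    by (auto simp: w_split_entry_iff split: option.splits)
  then have "\<Delta>3 x = Some d \<Longrightarrow> e_un d" for d
    using w_split_D[OF wty_lin_out(2), of x] by (auto simp: w_split_entry_iff split: option.splits)
  then have "wtyped l ((\<Delta>3(y2 \<mapsto> One V2))(x := e)) P L"
    using wty_lin_out.prems(1,3) by (intro wty_lin_out.IH) auto
  moreover have "(\<Delta>3(y2 \<mapsto> One V2))(x := e) = (\<Delta>3(x := e))(y2 \<mapsto> One V2)"
    using wty_lin_out.prems(1) by (auto simp: fun_eq_iff)
  ultimately have "wtyped l ((\<Delta>3(x := e))(y2 \<mapsto> One V2)) P L" by metis
  moreover have "w_var (\<Delta>1(x := e)) x' (TOut n V1 V2)" "w_payload (\<Delta>2(x := e)) y1 V1"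
    using wty_lin_out(4,5) wty_lin_out.prems(1,3) by (auto intro: w_var_upd w_payload_upd)
  ultimately show ?case
    using wty_lin_out(3,6-8) wty_lin_out.prems
    by (intro wtyped.wty_lin_out[OF w_split_upd[OF wty_lin_out(1)] w_split_upd[OF wty_lin_out(2)]]) auto
next
  case (wty_cli_out \<Delta> \<Delta>1 \<Delta>' \<Delta>2 \<Delta>3 x' n V y1 y2 l P L)
  have "\<Delta>' x = Some d \<Longrightarrow> e_un d" for d
    using w_split_D[OF wty_cli_out(1), of x] wty_cli_out.prems(2)
    by (auto simp: w_split_entry_iff split: option.splits)
  then have "\<Delta>3 x = Some d \<Longrightarrow> e_un d" for d
    using w_split_D[OF wty_cli_out(2), of x] by (auto simp: w_split_entry_iff split: option.splits)
  then have "wtyped l ((\<Delta>3(y2 \<mapsto> One TUnit))(x := e)) P L"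
    using wty_cli_out.prems(1,3) by (intro wty_cli_out.IH) auto
  moreover have "(\<Delta>3(y2 \<mapsto> One TUnit))(x := e) = (\<Delta>3(x := e))(y2 \<mapsto> One TUnit)"
    using wty_cli_out.prems(1) by (auto simp: fun_eq_iff)
  ultimately have "wtyped l ((\<Delta>3(x := e))(y2 \<mapsto> One TUnit)) P L" by metis
  moreover have "w_var (\<Delta>1(x := e)) x' (TCli n V)" "w_payload (\<Delta>2(x := e)) y1 V"
    using wty_cli_out(3,4) wty_cli_out.prems(1,3) by (auto intro: w_var_upd w_payload_upd)
  ultimately show ?case
    using wty_cli_out(5) wty_cli_out.prems
    by (intro wtyped.wty_cli_out[OF w_split_upd[OF wty_cli_out(1)] w_split_upd[OF wty_cli_out(2)]]) auto
next
  case (wty_rep \<Delta> x' n V k1 k2 l P L)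
  then have "wtyped (case_nat k1 (case_nat k2 l)) (ext (One V) (ext (One TUnit) (\<Delta>(x := e)))) P L"
    using wty_rep.IH[of "Suc (Suc x)"] by simp
  moreover have "w_var (\<Delta>(x := e)) x' (TSrv n V)"
    using wty_rep(1) wty_rep.prems(1,3) by (intro w_var_upd) auto
  ultimately show ?case using wtyped.wty_rep[OF _ wty_rep(2,3) _ wty_rep(5)] by metis
qed

lemma wtyped_imp_wtyp: "shape N P \<Longrightarrow> dom \<Delta> \<subseteq> N \<Longrightarrow> wtyped l \<Delta> P L \<Longrightarrow> wtyp N l \<Delta> P L"
proof (induction arbitrary: l \<Delta> L rule: shape.induct)
  case (shape_nil N)
  from shape_nil.prems(2) show ?case by cases (auto intro: wtyp_nil)
next
  case (shape_par N P Q)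
  from shape_par.prems(2) show ?case
  proof cases
    case (wty_par \<Delta>1 \<Delta>2 L1 L2)
    then show ?thesis
      using shape_par.IH shape_par.prems(1) w_split_dom[OF wty_par(2)]
      by (auto intro!: wtyp_par[OF wty_par(2)])
  qed
next
  case (shape_res N P)
  from shape_res.prems(2) show ?case
  proof cases
    case (wty_res V k)
    then show ?thesis
      using shape_res.IH[OF dom_ext_subset[OF shape_res.prems(1)]] by (intro wtyp_res)
  qed
next
  case (shape_in N P x)
  have dom: "dom (ext e1 (ext e2 \<Delta>')) \<subseteq> scope (scope N)" if "dom \<Delta>' \<subseteq> dom \<Delta>" for e1 e2 \<Delta>'
    using that shape_in.prems(1) by (intro dom_ext_subset) auto
  from shape_in.prems(2) show ?case
  proof cases
    case (wty_lin_in \<Delta>1 \<Delta>2 n V1 V2 k1 k2)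
    note 1 = split_w_var[OF wty_lin_in(1,3)]
    show ?thesis
      using 1 wty_lin_in shape_in.IH[OF dom[OF w_split_dom(2)[OF wty_lin_in(1)]] wty_lin_in(7)]
      by (auto intro: wtyp_lin_in)
  next
    case (wty_srv_in \<Delta>1 \<Delta>2 n V k1 k2)
    note 1 = split_w_var[OF wty_srv_in(1,2)]
    show ?thesis
      using 1 wty_srv_in shape_in.IH[OF dom[OF w_split_dom(2)[OF wty_srv_in(1)]] wty_srv_in(5)]
      by (auto intro: wtyp_srv_in simp: wtake_def)
  qed
next
  case (shape_rep N P x)
  have dom: "dom (ext e1 (ext e2 \<Delta>)) \<subseteq> scope (scope N)" for e1 e2
    using shape_rep.prems(1) by (intro dom_ext_subset)
  from shape_rep.prems(2) show ?case
  proof cases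
    case (wty_rep n V k1 k2 L')
    have "e_un e" if "\<Delta> y = Some e" for y e
      using wty_rep(2) that by (cases "y = x") (auto simp: w_var_def w_un_ctx_iff split: if_splits)
    moreover have "has x (TSrv n V) \<Delta>" using wty_rep(2) by (simp add: w_var_def has_def)
    ultimately have "w_un_ctx \<Delta>" "has x (TSrv n V) \<Delta>" by (auto simp: w_un_ctx_iff)
    then show ?thesis using wty_rep shape_rep.IH[OF dom wty_rep(5)] by (auto intro: wtyp_rep)
  qed
next
  case (shape_lin_out N P x v)
  from shape_lin_out.prems(2) show ?case
  proof cases
    case (wty_res V k)
    from wty_res(3) show ?thesis
    proof cases
      \<comment> \<open>Impossible: the second object is the name just restricted, so it is in the
        context.\<close>
      case (wty_cli_out \<Delta>1 \<Delta>' \<Delta>2 \<Delta>3 n V' L')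
      then show ?thesis by auto
    next
      case (wty_lin_out \<Delta>1 \<Delta>' \<Delta>2 \<Delta>3 n V1 V2 L')
      note 1 = split_w_var[OF wty_lin_out(2) wty_lin_out(5)]
      have "w_var \<Delta>2 (Suc v) V1" "\<Delta>2 (Suc v) = Some (One V1) \<or> w_un V1"
        using wty_lin_out(6) by (auto simp: w_payload_def)
      note 2 = split_w_var[OF wty_lin_out(3) this]
      let ?T = "TOut n V1 V2"
      have x: "has x ?T \<Delta>" using 1(1) wty_lin_out(4) by (simp add: has_def)
      have D': "\<Delta>' = ext (both V) (wtake x ?T \<Delta>)" using 1(2) wty_lin_out(4) by (auto simp: wtake_def)
      have v: "has v V1 (wtake x ?T \<Delta>)" using 2(1) unfolding D' by (simp add: has_def)
      have D3: "\<Delta>3 = ext (both V) (wtake v V1 (wtake x ?T \<Delta>))" using 2(2) unfolding D' by (auto simp: wtake_def)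
      \<comment> \<open>The type of the restriction is determined only up to duality, which affects
        neither levels nor the positivity of weights.\<close>
      have V: "both V = both V2" using wty_lin_out(8) unfolding D3 by simp
      then have lev: "level_of V2 (l x)" "weights_pos V2"
        using wty_res(1,2) wty_lin_out(9) both_eq_iff[of V V2] weights_pos_wdual by auto
      have k: "k = l x" using wty_lin_out(9) by simp
      have "wtyped (case_nat (l x) l) (ext (One V2) (wtake v V1 (wtake x ?T \<Delta>))) P L'"
        using wty_lin_out(10) unfolding D3 k by simp
      moreover have "dom (ext (One V2) (wtake v V1 (wtake x ?T \<Delta>))) \<subseteq> scope N"
        using x v shape_lin_out.prems(1) by (intro dom_ext_subset) (auto simp: wtake_def has_def split: if_splits)
      ultimately have "wtyp (scope N) (case_nat (l x) l) (ext (One V2) (wtake v V1 (wtake x ?T \<Delta>))) P L'"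
        by (rule shape_lin_out.IH[rotated])
      from wtyp_lin_out[OF x v lev(2,1) this] show ?thesis using wty_lin_out(1) by simp
    qed
  qed
next
  case (shape_cli_out z N P x v)
  have z: "\<Delta> z = None" using shape_cli_out by auto
  from shape_cli_out.prems(2) show ?case
  proof cases
    case (wty_lin_out \<Delta>1 \<Delta>' \<Delta>2 \<Delta>3 n V1 V2 L')
    \<comment> \<open>A linear output needs an entry for its second object, but \<open>z\<close> is
      out of scope.\<close>
    then have "z \<in> dom \<Delta>"
      using w_split_dom(2)[OF wty_lin_out(2)] w_split_dom(2)[OF wty_lin_out(3)] by (meson domI subsetD)
    then show ?thesis using z by auto
  next
    case (wty_cli_out \<Delta>1 \<Delta>' \<Delta>2 \<Delta>3 n V L')
    note 1 = split_w_var[OF wty_cli_out(2,4)]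
    have "w_var \<Delta>2 v V" "\<Delta>2 v = Some (One V) \<or> w_un V"
      using wty_cli_out(5) by (auto simp: w_payload_def)
    note 2 = split_w_var[OF wty_cli_out(3) this]
    have D': "\<Delta>' = \<Delta>" using 1(2) by (simp add: wtake_def)
    have "z \<notin> dom \<Delta>3" using w_split_dom(2)[OF wty_cli_out(3)] D' z by auto
    then have "(\<Delta>3(z \<mapsto> One TUnit))(z := None) = \<Delta>3" by auto
    with wtyped_upd_fresh[OF wty_cli_out(7) shape_cli_out(2), of None]
    have "wtyped l \<Delta>3 P L'" by simp
    moreover have "dom \<Delta>3 \<subseteq> N"
      using w_split_dom(2)[OF wty_cli_out(3)] D' shape_cli_out.prems(1) by simp
    ultimately have "wtyp N l (wtake v V \<Delta>) P L'" using shape_cli_out.IH 2(2) D' by auto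
    then show ?thesis
      using 1(1) 2(1) D' shape_cli_out(1,2) wty_cli_out(1) by (auto intro!: wtyp_cli_out)
  qed
qed

lemma wtyp_imp_wtyped: "wtyp N l \<Delta> P L \<Longrightarrow> dom \<Delta> \<subseteq> N \<Longrightarrow> wtyped l \<Delta> P L"
proof (induction rule: wtyp.induct)
  case (wtyp_par \<Delta> \<Delta>1 \<Delta>2 N l P L1 Q L2)
  then show ?case using w_split_dom[OF wtyp_par(1)] by (auto intro!: wty_par[OF wtyp_par(1)])
next
  case (wtyp_res V k N l \<Delta> P L)
  show ?case
    by (rule wty_res[OF wtyp_res(1,2) wtyp_res.IH[OF dom_ext_subset[OF wtyp_res.prems]]])
next
  case (wtyp_lin_in x n V1 V2 \<Delta> k1 l N P L)
  obtain \<Delta>1 where 1: "w_split \<Delta> \<Delta>1 (wtake x (TIn n V1 V2) \<Delta>)" "w_var \<Delta>1 x (TIn n V1 V2)"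
    "\<Delta>1 x = Some (One (TIn n V1 V2))"
    using ex_split_w_var[OF wtyp_lin_in(1)] by auto
  have "dom (wtake x (TIn n V1 V2) \<Delta>) \<subseteq> N"
    using w_split_dom(2)[OF 1(1)] wtyp_lin_in.prems by simp
  then have dom: "dom (ext (One V1) (ext (One V2) (wtake x (TIn n V1 V2) \<Delta>))) \<subseteq> scope (scope N)"
    by (rule dom_ext2_subset)
  show ?case
    by (rule wty_lin_in[OF 1(1,3,2) wtyp_lin_in(2,3) refl wtyp_lin_in.IH[OF dom]])
next
  case (wtyp_srv_in x n V \<Delta> k1 N k2 l P L)
  obtain \<Delta>1 where 1: "w_split \<Delta> \<Delta>1 (wtake x (TSrv n V) \<Delta>)" "w_var \<Delta>1 x (TSrv n V)"
    using ex_split_w_var[OF wtyp_srv_in(1)] by auto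
  then have split: "w_split \<Delta> \<Delta>1 \<Delta>" by (simp add: wtake_def)
  have lev: "level_of TUnit k2" by simp
  show ?case
    by (rule wty_srv_in[OF split 1(2) wtyp_srv_in(2) lev
        wtyp_srv_in.IH[OF dom_ext2_subset[OF wtyp_srv_in.prems]]])
next
  case (wtyp_rep \<Delta> x n V k1 N k2 l P L)
  then have "w_var \<Delta> x (TSrv n V)"
    by (auto simp: w_var_def w_un_ctx_iff has_def)
  have lev: "level_of TUnit k2" by simp
  show ?case
    by (rule wty_rep[OF \<open>w_var \<Delta> x (TSrv n V)\<close> wtyp_rep(3) lev
        wtyp_rep.IH[OF dom_ext2_subset[OF wtyp_rep.prems]] wtyp_rep(5)])
next
  case (wtyp_lin_out x n V1 V2 \<Delta> v l N P L)
  let ?T = "TOut n V1 V2" let ?\<Delta>' = "wtake x ?T \<Delta>" let ?\<Delta>3 = "wtake v V1 ?\<Delta>'" and ?E = "ext (both V2)"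
  have x: "has (Suc x) ?T (?E \<Delta>)" using wtyp_lin_out(1) by (simp add: has_def)
  obtain \<Delta>1 where 1: "w_split (?E \<Delta>) \<Delta>1 (wtake (Suc x) ?T (?E \<Delta>))" "w_var \<Delta>1 (Suc x) ?T"
    "\<Delta>1 (Suc x) = Some (One ?T)"
    using ex_split_w_var[OF x] by auto
  have eq1: "wtake (Suc x) ?T (?E \<Delta>) = ?E ?\<Delta>'" by (auto simp: wtake_def)
  have v: "has (Suc v) V1 (?E ?\<Delta>')" using wtyp_lin_out(2) by (simp add: has_def)
  obtain \<Delta>2 where 2: "w_split (?E ?\<Delta>') \<Delta>2 (wtake (Suc v) V1 (?E ?\<Delta>'))" "w_var \<Delta>2 (Suc v) V1"
    "\<Delta>2 (Suc v) = Some (One V1) \<or> w_un V1"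
    using ex_split_w_var[OF v] by auto
  have eq2: "wtake (Suc v) V1 (?E ?\<Delta>') = ?E ?\<Delta>3" by (auto simp: wtake_def)
  have "dom ?\<Delta>3 \<subseteq> N"
    using wtyp_lin_out(1,2) wtyp_lin_out.prems by (auto simp: wtake_def has_def split: if_splits)
  then have "wtyped (case_nat (l x) l) (ext (One V2) ?\<Delta>3) P L"
    by (intro wtyp_lin_out.IH dom_ext_subset)
  then have "wtyped (case_nat (l x) l) ((?E ?\<Delta>3)(0 \<mapsto> One V2)) P L" by simp
  from wty_lin_out[OF 1(1)[unfolded eq1] 2(1)[unfolded eq2] 1(3,2) _ _ _ _ this, where ?y1.0 = "Suc v"]
  have "wtyped (case_nat (l x) l) (?E \<Delta>) (WOut (Suc x) (Suc v) 0 P) (insert (l x) L)"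
    using 2(2,3) by (simp add: w_payload_def)
  then show ?case using wtyp_lin_out(3,4) by (intro wty_res)
next
  case (wtyp_cli_out x n V \<Delta> v z N P l L)
  obtain \<Delta>1 where 1: "w_split \<Delta> \<Delta>1 (wtake x (TCli n V) \<Delta>)" "w_var \<Delta>1 x (TCli n V)"
    using ex_split_w_var[OF wtyp_cli_out(1)] by auto
  then have 1: "w_split \<Delta> \<Delta>1 \<Delta>" "w_var \<Delta>1 x (TCli n V)" by (simp_all add: wtake_def)
  obtain \<Delta>2 where 2: "w_split \<Delta> \<Delta>2 (wtake v V \<Delta>)" "w_var \<Delta>2 v V" "\<Delta>2 v = Some (One V) \<or> w_un V"
    using ex_split_w_var[OF wtyp_cli_out(2)] by auto
  have dom: "dom (wtake v V \<Delta>) \<subseteq> N" using w_split_dom(2)[OF 2(1)] wtyp_cli_out.prems by simp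
  have "wtyped l ((wtake v V \<Delta>)(z \<mapsto> One TUnit)) P L"
    using dom wtyp_cli_out(3) by (intro wtyped_upd_fresh[OF wtyp_cli_out.IH wtyp_cli_out(4)]) auto
  then show ?case
    using 1 2 wtyp_cli_out(3) wtyp_cli_out.prems
    by (intro wty_cli_out[OF 1(1) 2(1) 1(2)]) (auto simp: w_payload_def)
qed (auto intro: wtyped.intros)

lemma wtyp_strengthen:
  assumes "wtyp (insert c N) l \<Delta> P L" "dom \<Delta> \<subseteq> insert c N" "c \<notin> N" "c \<notin> wfn P" "\<And>d. \<Delta> c = Some d \<Longrightarrow> e_un d"
  shows "wtyp N l (\<Delta>(c := None)) P L"
proof (rule wtyped_imp_wtyp)
  show "shape N P" using shape_antimono[OF wtyp_shape[OF assms(1)]] by auto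
  show "dom (\<Delta>(c := None)) \<subseteq> N" using assms(2) by auto
  show "wtyped l (\<Delta>(c := None)) P L"
    using wtyp_imp_wtyped[OF assms(1,2)] assms(4,5) by (rule wtyped_upd_fresh) auto
qed

text \<open>With \<open>wtyp_strengthen\<close> as the way back, the scope can be enlarged
  temporarily by a fresh name of type \<open>unit\<close>, which then serves as a second
  object.\<close>

lemma wtyp_insert_fresh:
  assumes "wtyp N l \<Delta> P L" "dom \<Delta> \<subseteq> N" "c \<notin> N" "c \<notin> wfn P"
  shows "wtyp (insert c N) l (\<Delta>(c \<mapsto> One TUnit)) P L"
proof (rule wtyped_imp_wtyp)
  show "shape (insert c N) P" using shape_insert[OF wtyp_shape[OF assms(1)]] assms(4) by auto
  show "dom (\<Delta>(c \<mapsto> One TUnit)) \<subseteq> insert c N" using assms(2) by auto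
  have "\<Delta> c = None" using assms(2,3) by auto
  then show "wtyped l (\<Delta>(c \<mapsto> One TUnit)) P L"
    using assms(4) by (intro wtyped_upd_fresh[OF wtyp_imp_wtyped[OF assms(1,2)]]) auto
qed

section \<open>Renaming typed processes\<close>

text \<open>An unrestricted entry for one end may be completed to both ends, since the judgment for
  a name accepts either form.\<close>

definition ele :: "wentry \<Rightarrow> wentry \<Rightarrow> bool" where
  "ele e d \<longleftrightarrow> e_un e \<and> (d = e \<or> (\<exists>V. e = One V \<and> d = both V))"

text \<open>
  \<open>mrg f \<Delta> y e\<close>: the entries of \<open>\<Delta>\<close> for the names that \<open>f\<close> maps to \<open>y\<close> can be merged to the entry \<open>e\<close>.
  A received endpoint may meet the dual endpoint of the same channel: then \<open>x:V\<close> and \<open>x':dual V\<close>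
  become \<open>y::V\<close>.
\<close>
definition mrg :: "(name \<Rightarrow> name) \<Rightarrow> wctx \<Rightarrow> name \<Rightarrow> wentry option \<Rightarrow> bool" where
  "mrg f \<Delta> y e \<longleftrightarrow> (case e of None \<Rightarrow> \<forall>x. f x = y \<longrightarrow> \<Delta> x = None
   | Some d \<Rightarrow> if e_un d then \<forall>x e. f x = y \<longrightarrow> \<Delta> x = Some e \<longrightarrow> ele e d
     else (\<exists>x. f x = y \<and> \<Delta> x = Some d \<and> (\<forall>x'. f x' = y \<longrightarrow> x' \<noteq> x \<longrightarrow> \<Delta> x' = None)) \<or>
       (\<exists>V x1 x2. d = both V \<and> x1 \<noteq> x2 \<and> f x1 = y \<and> f x2 = y \<and> \<Delta> x1 = Some (One V) \<and>
         \<Delta> x2 = Some (One (wdual V)) \<and> (\<forall>x'. f x' = y \<longrightarrow> x' \<noteq> x1 \<longrightarrow> x' \<noteq> x2 \<longrightarrow> \<Delta> x' = None)))"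

definition wren_ok :: "(name \<Rightarrow> name) \<Rightarrow> wctx \<Rightarrow> wctx \<Rightarrow> bool" where
  "wren_ok f \<Delta> \<Delta>' \<longleftrightarrow> (\<forall>y. mrg f \<Delta> y (\<Delta>' y))"

lemma wren_okD: "wren_ok f \<Delta> \<Delta>' \<Longrightarrow> mrg f \<Delta> y (\<Delta>' y)"
  by (simp add: wren_ok_def)

lemma mrg_None: "(\<And>x. f x = y \<Longrightarrow> \<Delta> x = None) \<Longrightarrow> mrg f \<Delta> y None"
  by (simp add: mrg_def)

lemma mrg_un: "e_un d \<Longrightarrow> (\<And>x e. f x = y \<Longrightarrow> \<Delta> x = Some e \<Longrightarrow> ele e d) \<Longrightarrow> mrg f \<Delta> y (Some d)"
  by (simp add: mrg_def)

lemma mrg_uniq: "\<not> e_un d \<Longrightarrow> f x = y \<Longrightarrow> \<Delta> x = Some d \<Longrightarrow>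
    (\<And>x'. f x' = y \<Longrightarrow> x' \<noteq> x \<Longrightarrow> \<Delta> x' = None) \<Longrightarrow> mrg f \<Delta> y (Some d)"
  unfolding mrg_def by auto

lemma mrg_dual: "\<not> w_un V \<Longrightarrow> x1 \<noteq> x2 \<Longrightarrow> f x1 = y \<Longrightarrow> f x2 = y \<Longrightarrow> \<Delta> x1 = Some (One V) \<Longrightarrow>
    \<Delta> x2 = Some (One (wdual V)) \<Longrightarrow> (\<And>x'. f x' = y \<Longrightarrow> x' \<noteq> x1 \<Longrightarrow> x' \<noteq> x2 \<Longrightarrow> \<Delta> x' = None) \<Longrightarrow>
    mrg f \<Delta> y (Some (both V))"
  unfolding mrg_def option.case
  by (simp, rule disjI2, rule exI[of _ V], rule conjI[OF refl], rule exI[of _ x1], rule exI[of _ x2], simp)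

lemma mrg_cases:
  assumes "mrg f \<Delta> y e"
  obtains (none) "e = None" "\<And>x. f x = y \<Longrightarrow> \<Delta> x = None"
  | (un) d where "e = Some d" "e_un d" "\<And>x e. f x = y \<Longrightarrow> \<Delta> x = Some e \<Longrightarrow> ele e d"
  | (uniq) d x where "e = Some d" "\<not> e_un d" "f x = y" "\<Delta> x = Some d"
      "\<And>x'. f x' = y \<Longrightarrow> x' \<noteq> x \<Longrightarrow> \<Delta> x' = None"
  | (dual) V x1 x2 where "e = Some (both V)" "\<not> w_un V" "x1 \<noteq> x2" "f x1 = y" "f x2 = y"
      "\<Delta> x1 = Some (One V)" "\<Delta> x2 = Some (One (wdual V))"
      "\<And>x'. f x' = y \<Longrightarrow> x' \<noteq> x1 \<Longrightarrow> x' \<noteq> x2 \<Longrightarrow> \<Delta> x' = None"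
proof (cases e)
  case None
  then show ?thesis using assms none by (simp add: mrg_def)
next
  case (Some d)
  show ?thesis
  proof (cases "e_un d")
    case True
    then show ?thesis using assms Some un by (simp add: mrg_def)
  next
    case False
    with assms Some consider
      x where "f x = y" "\<Delta> x = Some d" "\<forall>x'. f x' = y \<longrightarrow> x' \<noteq> x \<longrightarrow> \<Delta> x' = None"
      | V x1 x2 where "d = both V" "x1 \<noteq> x2" "f x1 = y" "f x2 = y" "\<Delta> x1 = Some (One V)"
         "\<Delta> x2 = Some (One (wdual V))" "\<forall>x'. f x' = y \<longrightarrow> x' \<noteq> x1 \<longrightarrow> x' \<noteq> x2 \<longrightarrow> \<Delta> x' = None"
      unfolding mrg_def by auto
    then show ?thesis
    proof cases
      case 1
      then show ?thesis using uniq[OF Some False] by blast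
    next
      case 2
      then have "\<not> w_un V" using False by simp
      with 2 show ?thesis using dual Some by blast
    qed
  qed
qed

lemma mrg_cong:
  assumes "mrg f \<Delta> y e" "\<And>x. f x = y \<Longrightarrow> \<Delta>' x = \<Delta> x"
  shows "mrg f \<Delta>' y e"
  using assms(1)
proof (cases rule: mrg_cases)
  case none
  then show ?thesis using assms(2) by (simp add: mrg_None)
next
  case (un d)
  show ?thesis unfolding un(1) using un(2) by (rule mrg_un) (use un(3) assms(2) in auto)
next
  case (uniq d x)
  show ?thesis unfolding uniq(1) using uniq(2,3)
    by (rule mrg_uniq) (use uniq assms(2) in auto)
next
  case (dual V x1 x2)
  show ?thesis unfolding dual(1) using dual(2-5)
    by (rule mrg_dual) (use dual assms(2) in auto)
qed

lemma mrg_single: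
  assumes "f x = y" "\<And>x'. f x' = y \<Longrightarrow> x' = x"
  shows "mrg f \<Delta> y (\<Delta> x)"
proof (cases "\<Delta> x")
  case None
  then show ?thesis using assms(2) by (metis mrg_None)
next
  case (Some d)
  show ?thesis
  proof (cases "e_un d")
    case True
    then have "mrg f \<Delta> y (Some d)" by (rule mrg_un) (use Some assms(2) True in \<open>auto simp: ele_def\<close>)
    then show ?thesis using Some by simp
  next
    case False
    then have "mrg f \<Delta> y (Some d)" using assms(1) Some by (rule mrg_uniq) (use assms(2) in blast)
    then show ?thesis using Some by simp
  qed
qed

text \<open>Each entry follows its own side of the split. The interesting case is a linear
  \<open>y::V\<close> merged from two dual entries: these choose their sides independently, and the
  four outcomes are just the ways in which \<open>y::V\<close> can be split.\<close>

lemma mrg_split: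
  assumes "mrg f \<Delta> y e" "w_split \<Delta> \<Delta>1 \<Delta>2"
  shows "\<exists>a b. w_split_entry e a b \<and> mrg f \<Delta>1 y a \<and> mrg f \<Delta>2 y b"
proof -
  note D = w_split_D[OF assms(2)]
  have None: "\<Delta>1 x = None \<and> \<Delta>2 x = None" if "\<Delta> x = None" for x
    using D[of x] that by (simp add: w_split_entry_iff)
  from assms(1) show ?thesis
  proof (cases rule: mrg_cases)
    case none
    then have "mrg f \<Delta>1 y None" "mrg f \<Delta>2 y None" using None by (auto intro!: mrg_None)
    then show ?thesis using none by (intro exI[of _ None]) (simp add: w_split_entry_iff)
  next
    case (un d)
    have un': "ele e d" if x: "f x = y" "\<Delta>1 x = Some e \<or> \<Delta>2 x = Some e" for x e
    proof -
      obtain e' where e': "\<Delta> x = Some e'" using x(2) None[of x] by (cases "\<Delta> x") auto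
      then have "ele e' d" using un(3) x(1) by blast
      moreover then have "\<Delta>1 x = \<Delta> x" "\<Delta>2 x = \<Delta> x"
        using D[of x] e' by (auto simp: w_split_entry_iff ele_def)
      ultimately show ?thesis using e' x(2) by auto
    qed
    then have "mrg f \<Delta>1 y (Some d)" "mrg f \<Delta>2 y (Some d)" using un(2) by (auto intro!: mrg_un)
    then show ?thesis using un by (intro exI[of _ "Some d"]) (simp add: w_split_entry_iff)
  next
    case (uniq d x)
    have "mrg f \<Delta>' y (\<Delta>' x)" if le: "\<And>x. \<Delta> x = None \<Longrightarrow> \<Delta>' x = None"
      and lin: "\<And>d. \<Delta>' x = Some d \<Longrightarrow> \<not> e_un d" for \<Delta>'
    proof (cases "\<Delta>' x")
      case None
      then have "\<Delta>' x' = None" if "f x' = y" for x'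
        using uniq(5) le None that by (cases "x' = x") auto
      then show ?thesis using None by (simp add: mrg_None)
    next
      case (Some d')
      have "mrg f \<Delta>' y (Some d')"
        using lin[OF Some] uniq(3) Some by (rule mrg_uniq) (use uniq(5) le in auto)
      then show ?thesis using Some by simp
    qed
    moreover have "\<not> e_un d'" if "\<Delta>1 x = Some d' \<or> \<Delta>2 x = Some d'" for d'
      using D[of x] uniq(2,4) that by (auto simp: w_split_entry_iff)
    ultimately have "mrg f \<Delta>1 y (\<Delta>1 x)" "mrg f \<Delta>2 y (\<Delta>2 x)" using None by blast+
    moreover have "w_split_entry e (\<Delta>1 x) (\<Delta>2 x)" using D[of x] uniq(1,4) by simp
    ultimately show ?thesis by blast
  next
    case (dual V x1 x2)
    have rest: "\<Delta>1 x' = None \<and> \<Delta>2 x' = None" if "f x' = y" "x' \<noteq> x1" "x' \<noteq> x2" for x'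
      using dual(8)[OF that] None by blast
    have one: "\<not> e_un (One V)" "\<not> e_un (One (wdual V))" using dual(2) by simp_all
    have x1: "\<Delta>1 x1 = Some (One V) \<and> \<Delta>2 x1 = None \<or> \<Delta>1 x1 = None \<and> \<Delta>2 x1 = Some (One V)"
      using D[of x1] dual(2,6) by (auto simp: w_split_entry_iff)
    have x2: "\<Delta>1 x2 = Some (One (wdual V)) \<and> \<Delta>2 x2 = None \<or> \<Delta>1 x2 = None \<and> \<Delta>2 x2 = Some (One (wdual V))"
      using D[of x2] dual(2,7) by (auto simp: w_split_entry_iff)
    have both: "mrg f \<Delta>' y (Some (both V))" if "\<Delta>' x1 = Some (One V)" "\<Delta>' x2 = Some (One (wdual V))"
      "\<And>x'. f x' = y \<Longrightarrow> x' \<noteq> x1 \<Longrightarrow> x' \<noteq> x2 \<Longrightarrow> \<Delta>' x' = None" for \<Delta>'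
      using dual(2-5) that by (rule mrg_dual)
    have none: "mrg f \<Delta>' y None" if "\<Delta>' x1 = None" "\<Delta>' x2 = None"
      "\<And>x'. f x' = y \<Longrightarrow> x' \<noteq> x1 \<Longrightarrow> x' \<noteq> x2 \<Longrightarrow> \<Delta>' x' = None" for \<Delta>'
      using that by (metis mrg_None)
    have left: "mrg f \<Delta>' y (Some (One V))" if "\<Delta>' x1 = Some (One V)" "\<Delta>' x2 = None"
      "\<And>x'. f x' = y \<Longrightarrow> x' \<noteq> x1 \<Longrightarrow> x' \<noteq> x2 \<Longrightarrow> \<Delta>' x' = None" for \<Delta>'
      using one(1) dual(4) that(1) by (rule mrg_uniq) (use that in metis)
    have right: "mrg f \<Delta>' y (Some (One (wdual V)))" if "\<Delta>' x1 = None" "\<Delta>' x2 = Some (One (wdual V))"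
      "\<And>x'. f x' = y \<Longrightarrow> x' \<noteq> x1 \<Longrightarrow> x' \<noteq> x2 \<Longrightarrow> \<Delta>' x' = None" for \<Delta>'
      using one(2) dual(5) that(2) by (rule mrg_uniq) (use that in metis)
    have split: "w_split_entry (Some (both V)) (Some (both V)) None" "w_split_entry (Some (both V)) None (Some (both V))"
      "w_split_entry (Some (both V)) (Some (One V)) (Some (One (wdual V)))"
      "w_split_entry (Some (both V)) (Some (One (wdual V))) (Some (One V))"
      using dual(2) by (auto simp: w_split_entry_iff)
    have rest1: "\<And>x'. f x' = y \<Longrightarrow> x' \<noteq> x1 \<Longrightarrow> x' \<noteq> x2 \<Longrightarrow> \<Delta>1 x' = None"
      and rest2: "\<And>x'. f x' = y \<Longrightarrow> x' \<noteq> x1 \<Longrightarrow> x' \<noteq> x2 \<Longrightarrow> \<Delta>2 x' = None"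
      using rest by simp_all
    from x1 x2 show ?thesis
      unfolding dual(1)
    proof (elim disjE conjE)
      assume 1: "\<Delta>1 x1 = Some (One V)" "\<Delta>2 x1 = None" "\<Delta>1 x2 = Some (One (wdual V))" "\<Delta>2 x2 = None"
      show "\<exists>a b. w_split_entry (Some (both V)) a b \<and> mrg f \<Delta>1 y a \<and> mrg f \<Delta>2 y b" using split(1) both[OF 1(1,3) rest1] none[OF 1(2,4) rest2] by (intro exI conjI)
    next
      assume 1: "\<Delta>1 x1 = Some (One V)" "\<Delta>2 x1 = None" "\<Delta>1 x2 = None" "\<Delta>2 x2 = Some (One (wdual V))"
      show "\<exists>a b. w_split_entry (Some (both V)) a b \<and> mrg f \<Delta>1 y a \<and> mrg f \<Delta>2 y b" using split(3) left[OF 1(1,3) rest1] right[OF 1(2,4) rest2] by (intro exI conjI)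
    next
      assume 1: "\<Delta>1 x1 = None" "\<Delta>2 x1 = Some (One V)" "\<Delta>1 x2 = Some (One (wdual V))" "\<Delta>2 x2 = None"
      show "\<exists>a b. w_split_entry (Some (both V)) a b \<and> mrg f \<Delta>1 y a \<and> mrg f \<Delta>2 y b" using split(4) right[OF 1(1,3) rest1] left[OF 1(2,4) rest2] by (intro exI conjI)
    next
      assume 1: "\<Delta>1 x1 = None" "\<Delta>2 x1 = Some (One V)" "\<Delta>1 x2 = None" "\<Delta>2 x2 = Some (One (wdual V))"
      show "\<exists>a b. w_split_entry (Some (both V)) a b \<and> mrg f \<Delta>1 y a \<and> mrg f \<Delta>2 y b" using split(2) none[OF 1(1,3) rest1] both[OF 1(2,4) rest2] by (intro exI conjI)
    qed
  qed
qed

lemma wren_ok_split: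
  assumes "wren_ok f \<Delta> \<Delta>'" "w_split \<Delta> \<Delta>1 \<Delta>2"
  obtains \<Delta>1' \<Delta>2' where "w_split \<Delta>' \<Delta>1' \<Delta>2'" "wren_ok f \<Delta>1 \<Delta>1'" "wren_ok f \<Delta>2 \<Delta>2'"
proof -
  have "\<forall>y. \<exists>a b. w_split_entry (\<Delta>' y) a b \<and> mrg f \<Delta>1 y a \<and> mrg f \<Delta>2 y b"
    using mrg_split[OF wren_okD[OF assms(1)] assms(2)] by blast
  then obtain A B where "\<forall>y. w_split_entry (\<Delta>' y) (A y) (B y) \<and> mrg f \<Delta>1 y (A y) \<and> mrg f \<Delta>2 y (B y)"
    by metis
  then show thesis using that[of A B] by (simp add: w_split_def wren_ok_def)
qed

lemma wren_ok_has:
  assumes "wren_ok f \<Delta> \<Delta>'" "has x V \<Delta>"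
  shows "has (f x) V \<Delta>'"
  using wren_okD[OF assms(1), of "f x"]
proof (cases rule: mrg_cases)
  case none
  then show ?thesis using assms(2) by (auto simp: has_def)
next
  case (un d)
  obtain e where e: "\<Delta> x = Some e" "e = One V \<or> e = both V" using assms(2) by (auto simp: has_def)
  then have "ele e d" using un(3) by blast
  then show ?thesis using e un(1) by (auto simp: has_def ele_def)
next
  case (uniq d x')
  then have "x' = x" using assms(2) by (metis has_def option.distinct(1) uniq(5))
  then show ?thesis using assms(2) uniq by (auto simp: has_def)
next
  case (dual W x1 x2)
  have "x = x1 \<or> x = x2" using assms(2) by (metis dual(8) has_def option.distinct(1))
  then show ?thesis using dual assms(2) by (auto simp: has_def)
qed

text \<open>Using one of two merged dual ends leaves exactly the other one, which is also what
  \<open>wtake\<close> leaves of \<open>y::V\<close>.\<close>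

lemma wren_ok_take:
  assumes "wren_ok f \<Delta> \<Delta>'" "has x V \<Delta>"
  shows "wren_ok f (wtake x V \<Delta>) (wtake (f x) V \<Delta>')"
proof (cases "w_un V")
  case True
  then show ?thesis using assms(1) by (simp add: wtake_def)
next
  case lin: False
  show ?thesis
    unfolding wren_ok_def
  proof
    fix y
    show "mrg f (wtake x V \<Delta>) y (wtake (f x) V \<Delta>' y)"
    proof (cases "y = f x")
      case False
      then have "mrg f (wtake x V \<Delta>) y (\<Delta>' y)"
        by (intro mrg_cong[OF wren_okD[OF assms(1)]]) (auto simp: wtake_def)
      moreover have "wtake (f x) V \<Delta>' y = \<Delta>' y" using False by (simp add: wtake_def)
      ultimately show ?thesis by simp
    next
      case True
      from wren_okD[OF assms(1), of "f x"]
      have "mrg f (wtake x V \<Delta>) (f x) (wtake (f x) V \<Delta>' (f x))"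
      proof (cases rule: mrg_cases)
        case none
        then show ?thesis using assms(2) by (auto simp: has_def)
      next
        case (un d)
        then have "ele (One V) d \<or> ele (both V) d" using assms(2) by (auto simp: has_def)
        then show ?thesis using lin by (simp add: ele_def)
      next
        case (uniq d x')
        then have x': "x' = x" using assms(2) by (metis has_def option.distinct(1) uniq(5))
        show ?thesis
        proof (cases "\<Delta> x = Some (One V)")
          case True
          then have "mrg f (wtake x V \<Delta>) (f x) None"
            using lin uniq x' by (intro mrg_None) (auto simp: wtake_def)
          then show ?thesis using True lin uniq x' by (simp add: wtake_def)
        next
          case False
          then have "d = both V" using assms(2) uniq x' by (auto simp: has_def)
          moreover have "mrg f (wtake x V \<Delta>) (f x) (Some (One (wdual V)))"
            using lin uniq False x' by (intro mrg_uniq[of _ _ x]) (auto simp: wtake_def)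
          ultimately show ?thesis using lin uniq by (simp add: wtake_def)
        qed
      next
        case (dual W x1 x2)
        have "x = x1 \<or> x = x2" using assms(2) by (metis dual(8) has_def option.distinct(1))
        then show ?thesis
        proof
          assume x: "x = x1"
          have W: "W = V" using dual(6) x assms(2) by (simp add: has_def)
          have "mrg f (wtake x V \<Delta>) (f x) (Some (One (wdual V)))"
            using lin dual(3,5,7) dual(8) dual(6) x W by (intro mrg_uniq[of _ _ x2]) (simp_all add: wtake_def)
          then show ?thesis using lin dual(1) by (simp add: wtake_def)
        next
          assume x: "x = x2"
          have "wdual W = V" using dual(7) x assms(2) by (simp add: has_def)
          then have W: "W = wdual V" by (metis wdual_wdual)
          have "mrg f (wtake x V \<Delta>) (f x) (Some (One (wdual V)))"
            using lin dual(3,4,6) dual(8) dual(7) x W by (intro mrg_uniq[of _ _ x1]) (simp_all add: wtake_def)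
          then show ?thesis using lin dual(1) by (simp add: wtake_def)
        qed
      qed
      then show ?thesis using True by simp
    qed
  qed
qed

lemma wren_ok_un:
  assumes "wren_ok f \<Delta> \<Delta>'" "w_un_ctx \<Delta>"
  shows "w_un_ctx \<Delta>'"
  unfolding w_un_ctx_iff
proof (intro allI impI)
  fix y e assume y: "\<Delta>' y = Some e"
  note un = assms(2)[unfolded w_un_ctx_iff, rule_format]
  from wren_okD[OF assms(1), of y] show "e_un e"
  proof (cases rule: mrg_cases)
    case (uniq d x)
    then show ?thesis using un[OF uniq(4)] by simp
  next
    case (dual V x1 x2)
    then show ?thesis using un[OF dual(6)] by simp
  qed (use y in simp_all)
qed

lemma wren_ok_ext:
  assumes "wren_ok f \<Delta> \<Delta>'"
  shows "wren_ok (up f) (ext e \<Delta>) (ext e \<Delta>')"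
  unfolding wren_ok_def
proof
  fix y
  show "mrg (up f) (ext e \<Delta>) y (ext e \<Delta>' y)"
  proof (cases y)
    case 0
    have "mrg (up f) (ext e \<Delta>) 0 (ext e \<Delta> 0)" by (rule mrg_single) simp_all
    then show ?thesis using 0 by simp
  next
    case (Suc m)
    from wren_okD[OF assms, of m] have "mrg (up f) (ext e \<Delta>) (Suc m) (\<Delta>' m)"
    proof (cases rule: mrg_cases)
      case none
      show ?thesis unfolding none(1)
      proof (rule mrg_None)
        fix x assume "up f x = Suc m"
        then show "ext e \<Delta> x = None" using none(2) by (cases x) auto
      qed
    next
      case (un d)
      show ?thesis unfolding un(1) using un(2)
      proof (rule mrg_un)
        fix x e' assume "up f x = Suc m" "ext e \<Delta> x = Some e'"
        then show "ele e' d" using un(3) by (cases x) auto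
      qed
    next
      case (uniq d x)
      show ?thesis unfolding uniq(1) using uniq(2)
      proof (rule mrg_uniq[of _ _ "Suc x"])
        fix x' assume "up f x' = Suc m" "x' \<noteq> Suc x"
        then show "ext e \<Delta> x' = None" using uniq(5) by (cases x') auto
      qed (use uniq in simp_all)
    next
      case (dual V x1 x2)
      show ?thesis unfolding dual(1) using dual(2)
      proof (rule mrg_dual[of _ "Suc x1" "Suc x2"])
        fix x' assume "up f x' = Suc m" "x' \<noteq> Suc x1" "x' \<noteq> Suc x2"
        then show "ext e \<Delta> x' = None" using dual(8) by (cases x') auto
      qed (use dual in simp_all)
    qed
    then show ?thesis using Suc by simp
  qed
qed

text \<open>An entry \<open>x:unit\<close> allows any level, so nothing is demanded for it. This
  permits a fresh second object whose level has nothing to do with that of the bound name.\<close>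

definition lvl_ok :: "(name \<Rightarrow> name) \<Rightarrow> (name \<Rightarrow> nat) \<Rightarrow> (name \<Rightarrow> nat) \<Rightarrow> wctx \<Rightarrow> bool" where
  "lvl_ok f l l' \<Delta> \<longleftrightarrow> (\<forall>x e. \<Delta> x = Some e \<longrightarrow> e \<noteq> One TUnit \<longrightarrow> l' (f x) = l x)"

lemma lvl_ok_ext: "lvl_ok f l l' \<Delta> \<Longrightarrow> lvl_ok (up f) (case_nat k l) (case_nat k l') (ext e \<Delta>)"
  by (auto simp: lvl_ok_def ext_def split: nat.splits)

lemma lvl_ok_split: "w_split \<Delta> \<Delta>1 \<Delta>2 \<Longrightarrow> lvl_ok f l l' \<Delta> \<Longrightarrow> lvl_ok f l l' \<Delta>1"
  unfolding lvl_ok_def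
proof (intro allI impI)
  fix x e assume "w_split \<Delta> \<Delta>1 \<Delta>2" "\<forall>x e. \<Delta> x = Some e \<longrightarrow> e \<noteq> One TUnit \<longrightarrow> l' (f x) = l x"
    "\<Delta>1 x = Some e" "e \<noteq> One TUnit"
  then show "l' (f x) = l x"
    using w_split_D[of \<Delta> \<Delta>1 \<Delta>2 x]
    by (auto simp: w_split_entry_iff split: option.splits if_splits)
qed

lemma lvl_ok_take: "has x V \<Delta> \<Longrightarrow> lvl_ok f l l' \<Delta> \<Longrightarrow> lvl_ok f l l' (wtake x V \<Delta>)"
  by (auto simp: lvl_ok_def wtake_def has_def split: if_splits)

lemma lvl_ok_has: "lvl_ok f l l' \<Delta> \<Longrightarrow> has x V \<Delta> \<Longrightarrow> V \<noteq> TUnit \<Longrightarrow> l' (f x) = l x"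
  by (auto simp: lvl_ok_def has_def)

text \<open>Subjects of outputs never have type \<open>unit\<close>, so their levels are kept and
  the set \<open>L\<close> is literally the same. Thus the level condition of replicated inputs
  survives.\<close>

lemma wtyp_wren:
  "wtyp N l \<Delta> P L \<Longrightarrow> scope_map N N' f \<Longrightarrow> wren_ok f \<Delta> \<Delta>' \<Longrightarrow> lvl_ok f l l' \<Delta> \<Longrightarrow>
    wtyp N' l' \<Delta>' (wren f P) L"
proof (induction arbitrary: N' f \<Delta>' l' rule: wtyp.induct)
  case (wtyp_nil \<Delta> N l)
  then show ?case using wren_ok_un by (auto intro: wtyp.wtyp_nil)
next
  case (wtyp_par \<Delta> \<Delta>1 \<Delta>2 N l P L1 Q L2)
  obtain \<Delta>1' \<Delta>2' where "w_split \<Delta>' \<Delta>1' \<Delta>2'" "wren_ok f \<Delta>1 \<Delta>1'" "wren_ok f \<Delta>2 \<Delta>2'"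
    using wren_ok_split[OF wtyp_par.prems(2) wtyp_par(1)] .
  then show ?case
    using wtyp_par.IH wtyp_par.prems(1,3) lvl_ok_split[OF wtyp_par(1)] lvl_ok_split[OF w_split_sym[OF wtyp_par(1)]]
    by (auto intro!: wtyp.wtyp_par)
next
  case (wtyp_res V k N l \<Delta> P L)
  have "wtyp (scope N') (case_nat k l') (ext (both V) \<Delta>') (wren (up f) P) L"
    using wtyp_res.prems by (intro wtyp_res.IH scope_map_up wren_ok_ext lvl_ok_ext)
  then show ?case using wtyp_res(1,2) by (auto intro: wtyp.wtyp_res)
next
  case (wtyp_lin_in x n V1 V2 \<Delta> k1 l N P L)
  let ?T = "TIn n V1 V2"
  have lx: "l' (f x) = l x" using lvl_ok_has[OF wtyp_lin_in.prems(3) wtyp_lin_in(1)] by simp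
  have "wtyp (scope (scope N')) (case_nat k1 (case_nat (l x) l'))
     (ext (One V1) (ext (One V2) (wtake (f x) ?T \<Delta>'))) (wren (up (up f)) P) L"
    using wtyp_lin_in.prems wtyp_lin_in(1)
    by (intro wtyp_lin_in.IH scope_map_up wren_ok_ext lvl_ok_ext lvl_ok_take wren_ok_take)
  then show ?case
    using wtyp_lin_in(2,3) wren_ok_has[OF wtyp_lin_in.prems(2) wtyp_lin_in(1)] lx
    by (auto intro!: wtyp.wtyp_lin_in)
next
  case (wtyp_srv_in x n V \<Delta> k1 N k2 l P L)
  have "wtyp (scope (scope N')) (case_nat k1 (case_nat k2 l'))
     (ext (One V) (ext (One TUnit) \<Delta>')) (wren (up (up f)) P) L"
    using wtyp_srv_in.prems by (intro wtyp_srv_in.IH scope_map_up wren_ok_ext lvl_ok_ext)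
  then show ?case
    unfolding wren.simps
    by (rule wtyp.wtyp_srv_in[OF wren_ok_has[OF wtyp_srv_in.prems(2) wtyp_srv_in(1)] wtyp_srv_in(2)])
next
  case (wtyp_rep \<Delta> x n V k1 N k2 l P L)
  have "wtyp (scope (scope N')) (case_nat k1 (case_nat k2 l'))
     (ext (One V) (ext (One TUnit) \<Delta>')) (wren (up (up f)) P) L"
    using wtyp_rep.prems by (intro wtyp_rep.IH scope_map_up wren_ok_ext lvl_ok_ext)
  then show ?case
    unfolding wren.simps
    by (rule wtyp.wtyp_rep[OF wren_ok_un[OF wtyp_rep.prems(2) wtyp_rep(1)]
          wren_ok_has[OF wtyp_rep.prems(2) wtyp_rep(2)] wtyp_rep(3) _ wtyp_rep(5)])
next
  case (wtyp_lin_out x n V1 V2 \<Delta> v l N P L)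
  let ?T = "TOut n V1 V2"
  have lx: "l' (f x) = l x" using lvl_ok_has[OF wtyp_lin_out.prems(3) wtyp_lin_out(1)] by simp
  note 1 = wren_ok_has[OF wtyp_lin_out.prems(2) wtyp_lin_out(1)]
    and 2 = wren_ok_take[OF wtyp_lin_out.prems(2) wtyp_lin_out(1)]
  note 3 = wren_ok_has[OF 2 wtyp_lin_out(2)]
  have "wtyp (scope N') (case_nat (l x) l') (ext (One V2) (wtake (f v) V1 (wtake (f x) ?T \<Delta>'))) (wren (up f) P) L"
    using wtyp_lin_out.prems wtyp_lin_out(1,2) 2
    by (intro wtyp_lin_out.IH scope_map_up wren_ok_ext lvl_ok_ext lvl_ok_take wren_ok_take)
  then have "wtyp N' l' \<Delta>' (WNu (WOut (Suc (f x)) (Suc (f v)) 0 (wren (up f) P))) (insert (l' (f x)) L)"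
    using wtyp_lin_out(3,4) lx by (intro wtyp.wtyp_lin_out[OF 1 3]) simp_all
  then show ?case using lx by simp
next
  case (wtyp_cli_out x n V \<Delta> v z N P l L)
  have lx: "l' (f x) = l x" using lvl_ok_has[OF wtyp_cli_out.prems(3) wtyp_cli_out(1)] by simp
  note 1 = wren_ok_has[OF wtyp_cli_out.prems(2) wtyp_cli_out(1)]
    and 2 = wren_ok_has[OF wtyp_cli_out.prems(2) wtyp_cli_out(2)]
  have "wtyp N' l' (wtake (f v) V \<Delta>') (wren f P) L"
    using wtyp_cli_out.prems wtyp_cli_out(2) by (intro wtyp_cli_out.IH lvl_ok_take wren_ok_take)
  moreover have "f z \<notin> N'" using wtyp_cli_out(3) scope_map_mem[OF wtyp_cli_out.prems(1)] by simp
  moreover have "f z \<notin> wfn (wren f P)"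
    using wtyp_cli_out(4) scope_map_eq[OF wtyp_cli_out.prems(1) wtyp_cli_out(3)] unfolding wfn_wren
    by (metis imageE)
  ultimately show ?case
    using wtyp.wtyp_cli_out[OF 1 2, of "f z" N' "wren f P" l' L] lx by simp
qed

section \<open>Typed inputs and outputs\<close>

text \<open>The analogue of \<open>lift2\<close> for a restriction of a single name.\<close>

definition lift1 :: "wentry \<Rightarrow> wctx \<Rightarrow> wctx" where
  "lift1 e \<Delta> = case_nat (if e_un e then Some e else None) \<Delta>"

lemma w_split_lift1:
  assumes "w_split \<Delta> \<Delta>1 \<Delta>2"
  shows "w_split (ext e \<Delta>) (ext e \<Delta>1) (lift1 e \<Delta>2)"
  unfolding w_split_def
proof
  fix n show "w_split_entry (ext e \<Delta> n) (ext e \<Delta>1 n) (lift1 e \<Delta>2 n)"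
    using w_split_D[OF assms] by (cases n) (auto simp: lift1_def w_split_entry_iff)
qed

lemma wtyp_lift1:
  assumes "wtyp N l \<Delta> P L"
  shows "wtyp (scope N) (case_nat k l) (lift1 e \<Delta>) (wren Suc P) L"
proof (rule wtyp_wren[OF assms])
  show "scope_map N (scope N) Suc" by (simp add: scope_map_def)
  show "lvl_ok Suc l (case_nat k l) \<Delta>" by (simp add: lvl_ok_def)
  show "wren_ok Suc \<Delta> (lift1 e \<Delta>)"
    unfolding wren_ok_def
  proof
    fix y show "mrg Suc \<Delta> y (lift1 e \<Delta> y)"
    proof (cases y)
      case 0
      have "mrg Suc \<Delta> 0 None" "e_un e \<Longrightarrow> mrg Suc \<Delta> 0 (Some e)"
        by (rule mrg_None, simp, rule mrg_un, simp_all)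
      then show ?thesis using 0 by (simp add: lift1_def)
    next
      case (Suc m)
      have "mrg Suc \<Delta> (Suc m) (\<Delta> m)" by (rule mrg_single) simp_all
      then show ?thesis using Suc by (simp add: lift1_def)
    qed
  qed
qed

lemma scope_map_id: "scope_map N N (\<lambda>n. n)"
  by (simp add: scope_map_def)

text \<open>Renaming by the identity: merging tolerates additional unrestricted entries and their
  completion from one end to both.\<close>

lemma wtyp_weaken:
  assumes "wtyp N l \<Delta> P L" "\<And>y. \<Delta>' y \<noteq> \<Delta> y \<Longrightarrow> \<exists>d. \<Delta>' y = Some d \<and> e_un d \<and> (\<forall>e. \<Delta> y = Some e \<longrightarrow> ele e d)"
  shows "wtyp N l \<Delta>' P L"
proof -
  have "wren_ok (\<lambda>n. n) \<Delta> \<Delta>'"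
    unfolding wren_ok_def
  proof
    fix y show "mrg (\<lambda>n. n) \<Delta> y (\<Delta>' y)"
    proof (cases "\<Delta>' y = \<Delta> y")
      case True
      then show ?thesis using mrg_single[of "\<lambda>n. n" y y \<Delta>] by simp
    next
      case False
      then obtain d where d: "\<Delta>' y = Some d" "e_un d" "\<forall>e. \<Delta> y = Some e \<longrightarrow> ele e d"
        using assms(2) by blast
      have "mrg (\<lambda>n. n) \<Delta> y (Some d)" using d(2) by (rule mrg_un) (use d(3) in auto)
      then show ?thesis using d(1) by simp
    qed
  qed
  then show ?thesis
    using wtyp_wren[OF assms(1) scope_map_id, of \<Delta>' l] by (simp add: lvl_ok_def)
qed

section \<open>Consistent levels, and the transfer of a payload across a split\<close>

primrec lev :: "wentry \<Rightarrow> nat \<Rightarrow> bool" where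
  "lev (One V) k \<longleftrightarrow> level_of V k"
| "lev (Both A) k \<longleftrightarrow> (\<forall>V\<in>A. level_of V k)"

text \<open>Used on receipt: the level assigned to a bound name is that of its type, and consistency
  makes it the level of the name received.\<close>

definition lvl_ctx :: "(name \<Rightarrow> nat) \<Rightarrow> wctx \<Rightarrow> bool" where
  "lvl_ctx l \<Delta> \<longleftrightarrow> (\<forall>x e. \<Delta> x = Some e \<longrightarrow> lev e (l x))"

lemma lvl_ctx_ext: "lvl_ctx l \<Delta> \<Longrightarrow> lev e k \<Longrightarrow> lvl_ctx (case_nat k l) (ext e \<Delta>)"
  by (auto simp: lvl_ctx_def ext_def split: nat.splits)

lemma lvl_ctx_split: "w_split \<Delta> \<Delta>1 \<Delta>2 \<Longrightarrow> lvl_ctx l \<Delta> \<Longrightarrow> lvl_ctx l \<Delta>1"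
  unfolding lvl_ctx_def
proof (intro allI impI)
  fix x e assume "w_split \<Delta> \<Delta>1 \<Delta>2" "\<forall>x e. \<Delta> x = Some e \<longrightarrow> lev e (l x)" "\<Delta>1 x = Some e"
  moreover then have "\<Delta> x = Some e \<or> (\<exists>V. \<Delta> x = Some (both V) \<and> (e = One V \<or> e = One (wdual V)))"
    using w_split_D[of \<Delta> \<Delta>1 \<Delta>2 x] by (auto simp: w_split_entry_iff split: option.splits if_splits)
  ultimately show "lev e (l x)" by (metis insertCI lev.simps)
qed

lemma lvl_ctx_has: "lvl_ctx l \<Delta> \<Longrightarrow> has v V \<Delta> \<Longrightarrow> level_of V (l v)"
  unfolding lvl_ctx_def has_def by (metis insertCI lev.simps)

lemma has_ext [simp]: "has (Suc x) V (ext e \<Delta>) \<longleftrightarrow> has x V \<Delta>"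
  by (simp add: has_def)

lemma wtake_ext [simp]: "wtake (Suc x) V (ext e \<Delta>) = ext e (wtake x V \<Delta>)"
  by (simp add: wtake_def)

lemma split_take:
  assumes "w_split \<Delta> \<Delta>1 \<Delta>2" "has x V \<Delta>1"
  shows "has x V \<Delta>" "w_split (wtake x V \<Delta>) (wtake x V \<Delta>1) \<Delta>2"
proof -
  note D = w_split_D[OF assms(1)]
  show "has x V \<Delta>"
    using D[of x] assms(2) by (auto simp: has_def w_split_entry_iff split: option.splits if_splits)
  show "w_split (wtake x V \<Delta>) (wtake x V \<Delta>1) \<Delta>2"
    unfolding w_split_def
  proof
    fix y show "w_split_entry (wtake x V \<Delta> y) (wtake x V \<Delta>1 y) (\<Delta>2 y)"
    proof (cases "y = x \<and> \<not> w_un V")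
      case True
      then have "\<Delta>1 x = Some (One V) \<and> (\<Delta> x = Some (One V) \<and> \<Delta>2 x = None \<or>
          \<Delta> x = Some (both V) \<and> \<Delta>2 x = Some (One (wdual V))) \<or>
        \<Delta>1 x = Some (both V) \<and> \<Delta> x = Some (both V) \<and> \<Delta>2 x = None"
        using D[of x] assms(2) by (auto simp: has_def w_split_entry_iff split: option.splits if_splits)
      then show ?thesis using True by (auto simp: wtake_def w_split_entry_iff)
    next
      case False
      then show ?thesis using D[of y] by (auto simp: wtake_def)
    qed
  qed
qed

text \<open>The receiver may already own the opposite end of the received channel; then the two
  halves become \<open>v::V\<close>.\<close>

definition wput :: "name \<Rightarrow> wtype \<Rightarrow> wctx \<Rightarrow> wctx" where
  "wput v V \<Delta> = (if w_un V then \<Delta> else \<Delta>(v \<mapsto> if \<Delta> v = None then One V else both V))"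

definition wput_ok :: "name \<Rightarrow> wtype \<Rightarrow> wctx \<Rightarrow> bool" where
  "wput_ok v V \<Delta> \<longleftrightarrow> (if w_un V then has v V \<Delta> else \<Delta> v = None \<or> \<Delta> v = Some (One (wdual V)))"

lemma wput_ext [simp]: "wput (Suc v) V (ext e \<Delta>) = ext e (wput v V \<Delta>)"
  by (simp add: wput_def)

lemma wput_ok_ext [simp]: "wput_ok (Suc v) V (ext e \<Delta>) \<longleftrightarrow> wput_ok v V \<Delta>"
  by (simp add: wput_ok_def)

lemma wput_other: "c \<noteq> v \<Longrightarrow> wput v V \<Delta> c = \<Delta> c"
  by (simp add: wput_def)

lemma wput_ok_cong: "\<Delta> c = \<Delta>' c \<Longrightarrow> wput_ok c V \<Delta> \<longleftrightarrow> wput_ok c V \<Delta>'"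
  by (simp add: wput_ok_def has_def)

lemma split_put:
  assumes "w_split \<Delta> \<Delta>1 \<Delta>2" "wput_ok v V \<Delta>"
  shows "wput_ok v V \<Delta>1" "w_split (wput v V \<Delta>) (wput v V \<Delta>1) \<Delta>2"
proof -
  note D = w_split_D[OF assms(1)]
  have lin: "\<Delta> v = None \<and> \<Delta>1 v = None \<and> \<Delta>2 v = None \<or>
      \<Delta> v = Some (One (wdual V)) \<and> (\<Delta>1 v = Some (One (wdual V)) \<and> \<Delta>2 v = None \<or>
        \<Delta>1 v = None \<and> \<Delta>2 v = Some (One (wdual V)))" if "\<not> w_un V"
    using that D[of v] assms(2) by (auto simp: wput_ok_def w_split_entry_iff split: if_splits)
  show "wput_ok v V \<Delta>1"
  proof (cases "w_un V")
    case True
    then have "\<Delta>1 v = \<Delta> v" using D[of v] assms(2) by (auto simp: wput_ok_def has_def w_split_entry_iff)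
    then show ?thesis using assms(2) wput_ok_cong by metis
  next
    case False
    then show ?thesis using lin by (auto simp: wput_ok_def)
  qed
  show "w_split (wput v V \<Delta>) (wput v V \<Delta>1) \<Delta>2"
    unfolding w_split_def
  proof
    fix y show "w_split_entry (wput v V \<Delta> y) (wput v V \<Delta>1 y) (\<Delta>2 y)"
    proof (cases "y = v \<and> \<not> w_un V")
      case True
      then show ?thesis using lin by (auto simp: wput_def w_split_entry_iff)
    next
      case False
      then show ?thesis using D[of y] by (auto simp: wput_def)
    qed
  qed
qed

text \<open>The payload changes sides while the whole context stays the same. For a linear
  \<open>v::V\<close>, either a split into halves becomes full ownership by the receiver, or full
  ownership by the sender becomes a split into halves.\<close>

lemma split_take_put:
  assumes "w_split \<Delta> \<Delta>1 \<Delta>2" "has v V \<Delta>1"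
  shows "wput_ok v V \<Delta>2" "w_split \<Delta> (wtake v V \<Delta>1) (wput v V \<Delta>2)"
proof -
  note D = w_split_D[OF assms(1)]
  have lin: "\<Delta>1 v = Some (One V) \<and> (\<Delta> v = Some (One V) \<and> \<Delta>2 v = None \<or>
      \<Delta> v = Some (both V) \<and> \<Delta>2 v = Some (One (wdual V))) \<or>
    \<Delta>1 v = Some (both V) \<and> \<Delta> v = Some (both V) \<and> \<Delta>2 v = None" if "\<not> w_un V"
    using D[of v] assms(2) that by (auto simp: has_def w_split_entry_iff split: option.splits if_splits)
  show "wput_ok v V \<Delta>2"
  proof (cases "w_un V")
    case True
    then show ?thesis
      using D[of v] assms(2) by (auto simp: wput_ok_def has_def w_split_entry_iff split: option.splits if_splits)
  next
    case False
    then show ?thesis using lin by (auto simp: wput_ok_def)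
  qed
  show "w_split \<Delta> (wtake v V \<Delta>1) (wput v V \<Delta>2)"
    unfolding w_split_def
  proof
    fix y show "w_split_entry (\<Delta> y) (wtake v V \<Delta>1 y) (wput v V \<Delta>2 y)"
    proof (cases "y = v \<and> \<not> w_un V")
      case True
      then show ?thesis using lin by (auto simp: wput_def wtake_def w_split_entry_iff)
    next
      case False
      then show ?thesis using D[of y] by (auto simp: wput_def wtake_def)
    qed
  qed
qed

lemma wtyp_subst:
  assumes "wtyp (scope (scope N)) (case_nat k1 (case_nat k2 l)) (ext (One V1) (ext (One V2) \<Delta>)) P L"
    "v \<in> N" "c \<in> N" "v \<noteq> c" "wput_ok v V1 \<Delta>" "wput_ok c V2 \<Delta>"
    "V1 = TUnit \<or> k1 = l v" "V2 = TUnit \<or> k2 = l c"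
  shows "wtyp N l (wput c V2 (wput v V1 \<Delta>)) (wren (case_nat v (case_nat c id)) P) L"
proof (rule wtyp_wren[OF assms(1)])
  let ?f = "case_nat v (case_nat c id)" and ?\<Delta> = "ext (One V1) (ext (One V2) \<Delta>)"
  have "?f n \<in> N \<longleftrightarrow> n \<in> scope (scope N)" for n
    using assms(2,3) by (rule_tac nat2_cases[of n]) simp_all
  moreover have "inj_on ?f (- scope (scope N))" by (auto simp: inj_on_def not_scope2)
  ultimately show "scope_map (scope (scope N)) N ?f" by (simp add: scope_map_def)
  show "lvl_ok ?f (case_nat k1 (case_nat k2 l)) l ?\<Delta>"
    using assms(7,8) by (auto simp: lvl_ok_def ext_eq_Some ext_def split: nat.splits)
  have pre: "?f x = y \<longleftrightarrow> x = 0 \<and> v = y \<or> x = Suc 0 \<and> c = y \<or> x = Suc (Suc y)" for x y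
    by (rule nat2_cases[of x]) auto
  \<comment> \<open>One argument for both objects: \<open>x\<close> is the index 0 or 1 of a
    received name, and besides it only the old name is mapped to \<open>y\<close>.\<close>
  have put: "mrg ?f ?\<Delta> y (wput y V \<Delta> y)"
    if x: "?f x = y" "x < 2" "?\<Delta> x = Some (One V)" "wput_ok y V \<Delta>"
      "\<And>x'. ?f x' = y \<Longrightarrow> x' = x \<or> x' = Suc (Suc y)" for x y V
  proof (cases "w_un V")
    case True
    then obtain d where d: "\<Delta> y = Some d" "d = One V \<or> d = both V"
      using x(4) by (auto simp: wput_ok_def has_def)
    have "e_un d" using True d(2) by auto
    then have "mrg ?f ?\<Delta> y (Some d)"
    proof (rule mrg_un)
      fix x' e assume a: "?f x' = y" and b: "?\<Delta> x' = Some e"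
      from x(5)[OF a] have "e = One V \<or> e = d" using b x(3) d(1) by (elim disjE) simp_all
      then show "ele e d" using True d(2) by (auto simp: ele_def)
    qed
    then show ?thesis using True d by (simp add: wput_def)
  next
    case False
    then consider "\<Delta> y = None" | "\<Delta> y = Some (One (wdual V))"
      using x(4) by (auto simp: wput_ok_def)
    then show ?thesis
    proof cases
      case 1
      have "mrg ?f ?\<Delta> y (Some (One V))"
      proof (rule mrg_uniq[where x = x and f = ?f and \<Delta> = ?\<Delta>])
        show "\<not> e_un (One V)" using False by simp
        show "?f x = y" by (rule x(1))
        show "?\<Delta> x = Some (One V)" by (rule x(3))
        fix x' assume "?f x' = y" "x' \<noteq> x"
        then have "x' = Suc (Suc y)" using x(5) by blast
        then show "?\<Delta> x' = None" using 1 by simp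
      qed
      then show ?thesis using 1 False by (simp add: wput_def)
    next
      case 2
      have "?f (Suc (Suc y)) = y" "?\<Delta> (Suc (Suc y)) = Some (One (wdual V))" "x \<noteq> Suc (Suc y)"
        using 2 x(2) by auto
      then have "mrg ?f ?\<Delta> y (Some (both V))"
        using x(1,3) False x(5) by (intro mrg_dual[of V x "Suc (Suc y)"]) auto
      then show ?thesis using 2 False by (simp add: wput_def)
    qed
  qed
  show "wren_ok ?f ?\<Delta> (wput c V2 (wput v V1 \<Delta>))"
    unfolding wren_ok_def
  proof
    fix y
    consider "y = v" | "y = c" | "y \<noteq> v" "y \<noteq> c" by blast
    then show "mrg ?f ?\<Delta> y (wput c V2 (wput v V1 \<Delta>) y)"
    proof cases
      case 1
      have "mrg ?f ?\<Delta> v (wput v V1 \<Delta> v)"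
        using assms(4,5) by (intro put[of 0]) (simp_all add: pre)
      then show ?thesis using assms(4) 1 by (simp add: wput_other)
    next
      case 2
      have "mrg ?f ?\<Delta> c (wput c V2 \<Delta> c)"
        using assms(4,6) by (intro put[of "Suc 0"]) (simp_all add: pre)
      moreover have "wput c V2 (wput v V1 \<Delta>) c = wput c V2 \<Delta> c"
        using assms(4) by (auto simp: wput_def)
      ultimately show ?thesis using 2 by simp
    next
      case 3
      have "mrg ?f ?\<Delta> y (?\<Delta> (Suc (Suc y)))"
        using 3 by (intro mrg_single) (auto simp: pre)
      then show ?thesis using 3 by (simp add: wput_other)
    qed
  qed
qed

text \<open>Linear and server inputs in one: for a server \<open>W\<close> is unrestricted and the
  second object has type \<open>unit\<close>. The typing of the residual is conditional, as the
  objects and their levels come from the sender.\<close>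

definition in_typed :: "name set \<Rightarrow> (name \<Rightarrow> nat) \<Rightarrow> wctx \<Rightarrow> name \<Rightarrow> name \<Rightarrow> name \<Rightarrow> wproc \<Rightarrow> bool" where
  "in_typed N l \<Delta> x v c U \<longleftrightarrow> (\<exists>W n V1 V2. has x W \<Delta> \<and> (W = TIn n V1 V2 \<or> W = TSrv n V1 \<and> V2 = TUnit) \<and>
     (wput_ok v V1 (wtake x W \<Delta>) \<longrightarrow> wput_ok c V2 (wtake x W \<Delta>) \<longrightarrow> level_of V1 (l v) \<longrightarrow>
       (V2 = TUnit \<or> l c = l x) \<longrightarrow> (\<exists>L. wtyp N l (wput c V2 (wput v V1 (wtake x W \<Delta>))) U L)))"

lemma in_typed_par:
  assumes "in_typed N l \<Delta>1 x v c U" "w_split \<Delta> \<Delta>1 \<Delta>2" "wtyp N l \<Delta>2 Q L2" "v \<noteq> c"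
  shows "in_typed N l \<Delta> x v c (WPar U Q)" "in_typed N l \<Delta> x v c (WPar Q U)"
proof -
  obtain W n V1 V2 where 1: "has x W \<Delta>1" "W = TIn n V1 V2 \<or> W = TSrv n V1 \<and> V2 = TUnit"
     "wput_ok v V1 (wtake x W \<Delta>1) \<Longrightarrow> wput_ok c V2 (wtake x W \<Delta>1) \<Longrightarrow> level_of V1 (l v) \<Longrightarrow>
       V2 = TUnit \<or> l c = l x \<Longrightarrow> \<exists>L. wtyp N l (wput c V2 (wput v V1 (wtake x W \<Delta>1))) U L"
    using assms(1) unfolding in_typed_def by blast
  note 2 = split_take[OF assms(2) 1(1)]
  have 3: "\<exists>L. wtyp N l (wput c V2 (wput v V1 (wtake x W \<Delta>))) (WPar U Q) L"
    "\<exists>L. wtyp N l (wput c V2 (wput v V1 (wtake x W \<Delta>))) (WPar Q U) L"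
    if a: "wput_ok v V1 (wtake x W \<Delta>)" "wput_ok c V2 (wtake x W \<Delta>)" "level_of V1 (l v)" "V2 = TUnit \<or> l c = l x"
  proof -
    note 4 = split_put[OF 2(2) a(1)]
    have "wput_ok c V2 (wput v V1 (wtake x W \<Delta>))"
      using a(2) wput_ok_cong[of "wput v V1 (wtake x W \<Delta>)" c "wtake x W \<Delta>" V2]
        wput_other[of c v V1 "wtake x W \<Delta>"] assms(4) by simp
    note 5 = split_put(2)[OF 4(2) this]
    obtain L where "wtyp N l (wput c V2 (wput v V1 (wtake x W \<Delta>1))) U L"
      using 1(3)[OF 4(1) split_put(1)[OF 2(2) a(2)] a(3,4)] by blast
    then show "\<exists>L. wtyp N l (wput c V2 (wput v V1 (wtake x W \<Delta>))) (WPar U Q) L"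
      "\<exists>L. wtyp N l (wput c V2 (wput v V1 (wtake x W \<Delta>))) (WPar Q U) L"
      using wtyp_par[OF 5 _ assms(3)] wtyp_par[OF w_split_sym[OF 5] assms(3)] by blast+
  qed
  show "in_typed N l \<Delta> x v c (WPar U Q)" "in_typed N l \<Delta> x v c (WPar Q U)"
    unfolding in_typed_def using 1(2) 2(1) 3 by blast+
qed

lemma level_of_unique: "level_of V k \<Longrightarrow> level_of V k' \<Longrightarrow> V = TUnit \<or> k = k'"
  by (cases V) auto

lemma in_typed_cases:
  "wtyp N l \<Delta> Q L \<Longrightarrow> Q \<midarrow>LIn x v c\<rightarrow>\<^sub>w U \<Longrightarrow> v \<in> N \<Longrightarrow> c \<in> N \<Longrightarrow> v \<noteq> c \<Longrightarrow> in_typed N l \<Delta> x v c U"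
proof (induction arbitrary: x v c U rule: wtyp.induct)
  case (wtyp_nil \<Delta> N l)
  then show ?case by (auto elim: wtrans_NilE)
next
  case (wtyp_par \<Delta> \<Delta>1 \<Delta>2 N l P L1 Q L2)
  note prems = wtyp_par.prems
  from prems(1) show ?case
  proof (cases rule: wtrans_Par_inE)
    case (left U1)
    then show ?thesis
      using in_typed_par(1)[OF wtyp_par.IH(1)[OF _ prems(2-4)] wtyp_par(1,3) prems(4)] by blast
  next
    case (right U2)
    then show ?thesis
      using in_typed_par(2)[OF wtyp_par.IH(2)[OF _ prems(2-4)] w_split_sym[OF wtyp_par(1)] wtyp_par(2) prems(4)]
      by blast
  qed
next
  case (wtyp_res V k N l \<Delta> P L)
  from wtyp_res.prems(1) obtain U0 where U: "U = WNu U0" and tr: "P \<midarrow>LIn (Suc x) (Suc v) (Suc c)\<rightarrow>\<^sub>w U0"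
    by (auto elim: wtrans_Nu_inE)
  have "in_typed (scope N) (case_nat k l) (ext (both V) \<Delta>) (Suc x) (Suc v) (Suc c) U0"
    using wtyp_res.prems(2-4) by (intro wtyp_res.IH[OF tr]) simp_all
  then obtain W n V1 V2 where 1: "has x W \<Delta>" "W = TIn n V1 V2 \<or> W = TSrv n V1 \<and> V2 = TUnit"
     "wput_ok v V1 (wtake x W \<Delta>) \<Longrightarrow> wput_ok c V2 (wtake x W \<Delta>) \<Longrightarrow> level_of V1 (l v) \<Longrightarrow>
       V2 = TUnit \<or> l c = l x \<Longrightarrow>
       \<exists>L. wtyp (scope N) (case_nat k l) (ext (both V) (wput c V2 (wput v V1 (wtake x W \<Delta>)))) U0 L"
    unfolding in_typed_def has_ext wtake_ext wput_ext wput_ok_ext nat.case by blast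
  then show ?case
    unfolding in_typed_def U using wtyp.wtyp_res[OF wtyp_res(1,2)] by blast
next
  case (wtyp_lin_in y n V1 V2 \<Delta> k1 l N P L)
  have U: "x = y" "U = wren (case_nat v (case_nat c id)) P"
    using wtyp_lin_in.prems(1) by (auto elim: wtrans_In_inE)
  have "wtyp N l (wput c V2 (wput v V1 (wtake y (TIn n V1 V2) \<Delta>))) U L"
    if "wput_ok v V1 (wtake y (TIn n V1 V2) \<Delta>)" "wput_ok c V2 (wtake y (TIn n V1 V2) \<Delta>)" "level_of V1 (l v)"
      "V2 = TUnit \<or> l c = l y"
    unfolding U(2) using that wtyp_lin_in.prems(2-4) level_of_unique[OF wtyp_lin_in(2), of "l v"]
    by (intro wtyp_subst[OF wtyp_lin_in(4)]) auto
  then show ?case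
    unfolding in_typed_def U(1) using wtyp_lin_in(1) by blast
next
  case (wtyp_srv_in y n V \<Delta> k1 N k2 l P L)
  have U: "x = y" "U = wren (case_nat v (case_nat c id)) P"
    using wtyp_srv_in.prems(1) by (auto elim: wtrans_In_inE)
  have "wtyp N l (wput c TUnit (wput v V \<Delta>)) U L"
    if "wput_ok v V \<Delta>" "wput_ok c TUnit \<Delta>" "level_of V (l v)"
    unfolding U(2) using that wtyp_srv_in.prems(2-4) level_of_unique[OF wtyp_srv_in(2), of "l v"]
    by (intro wtyp_subst[OF wtyp_srv_in(3)]) auto
  moreover have "wtake y (TSrv n V) \<Delta> = \<Delta>" by (simp add: wtake_def)
  ultimately show ?case
    unfolding in_typed_def U(1) using wtyp_srv_in(1) by metis
next
  case (wtyp_rep \<Delta> y n V k1 N k2 l P L)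
  have U: "x = y" "U = WPar (WRep y P) (wren (case_nat v (case_nat c id)) P)"
    using wtyp_rep.prems(1) by (auto elim: wtrans_Rep_inE)
  have "\<exists>L. wtyp N l (wput c TUnit (wput v V \<Delta>)) U L"
    if "wput_ok v V \<Delta>" "wput_ok c TUnit \<Delta>" "level_of V (l v)"
  proof -
    have "wtyp N l (wput c TUnit (wput v V \<Delta>)) (wren (case_nat v (case_nat c id)) P) L"
      using that wtyp_rep.prems(2-4) level_of_unique[OF wtyp_rep(3), of "l v"]
      by (intro wtyp_subst[OF wtyp_rep(4)]) auto
    moreover have "wput c TUnit (wput v V \<Delta>) = wput v V \<Delta>" by (simp add: wput_def)
    \<comment> \<open>The server needs only its unrestricted context; a linear payload goes to the
      new copy alone.\<close>
    moreover have "w_split (wput v V \<Delta>) \<Delta> (wput v V \<Delta>)"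
      unfolding w_split_def
    proof
      fix z
      have un: "\<Delta> z = Some e \<Longrightarrow> e_un e" for z e using wtyp_rep(1) by (simp add: w_un_ctx_iff)
      then have "\<not> w_un V \<Longrightarrow> \<Delta> v = None" using that(1) by (fastforce simp: wput_ok_def)
      then show "w_split_entry (wput v V \<Delta> z) (\<Delta> z) (wput v V \<Delta> z)"
        using un by (auto simp: wput_def w_split_entry_iff split: option.splits)
    qed
    ultimately show ?thesis
      unfolding U(2) using wtyp_par wtyp.wtyp_rep[OF wtyp_rep(1-5)] by metis
  qed
  moreover have "wtake y (TSrv n V) \<Delta> = \<Delta>" by (simp add: wtake_def)
  ultimately show ?case
    unfolding in_typed_def U(1) using wtyp_rep(2) by metis
next
  case (wtyp_lin_out x n V1 V2 \<Delta> v l N P L)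
  then show ?case by (auto elim!: wtrans_Nu_inE wtrans_Out_inE)
next
  case (wtyp_cli_out x n V \<Delta> v z N P l L)
  then show ?case by (auto elim: wtrans_Out_inE)
qed

inductive_cases wtyp_ParE: "wtyp N l \<Delta> (WPar P Q) L"
inductive_cases wtyp_NuE [consumes 1, case_names res lin_out]: "wtyp N l \<Delta> (WNu P) L"

lemma swap01_simps [simp]: "swap01 0 = Suc 0" "swap01 (Suc 0) = 0" "swap01 (Suc (Suc n)) = Suc (Suc n)"
  by (simp_all add: swap01_def)

lemma swap01_swap01 [simp]: "swap01 (swap01 n) = n"
  by (simp add: swap01_def)

lemma wtyp_swap01:
  assumes "wtyp (scope (scope N)) (case_nat k (case_nat k' l)) (ext e (ext e' \<Delta>)) P L"
  shows "wtyp (scope (scope N)) (case_nat k' (case_nat k l)) (ext e' (ext e \<Delta>)) (wren swap01 P) L"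
proof (rule wtyp_wren[OF assms])
  have "swap01 n \<in> scope (scope N) \<longleftrightarrow> n \<in> scope (scope N)" for n
    by (rule nat2_cases[of n]) simp_all
  moreover have "inj swap01" by (metis injI swap01_swap01)
  ultimately show "scope_map (scope (scope N)) (scope (scope N)) swap01"
    by (auto simp: scope_map_def intro: inj_on_subset)
  have l: "case_nat k' (case_nat k l) (swap01 n) = case_nat k (case_nat k' l) n" for n
    by (rule nat2_cases[of n]) simp_all
  then show "lvl_ok swap01 (case_nat k (case_nat k' l)) (case_nat k' (case_nat k l)) (ext e (ext e' \<Delta>))"
    by (simp only: lvl_ok_def) simp
  have \<Delta>: "ext e' (ext e \<Delta>) n = ext e (ext e' \<Delta>) (swap01 n)" for n
    by (rule nat2_cases[of n]) simp_all
  show "wren_ok swap01 (ext e (ext e' \<Delta>)) (ext e' (ext e \<Delta>))"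
    unfolding wren_ok_def \<Delta> by (intro allI mrg_single) (metis swap01_swap01)+
qed

section \<open>Typed residuals of outputs\<close>

definition out_cli_typed :: "name set \<Rightarrow> (name \<Rightarrow> nat) \<Rightarrow> wctx \<Rightarrow> nat \<Rightarrow> name \<Rightarrow> name \<Rightarrow> name \<Rightarrow> wproc \<Rightarrow> bool" where
  "out_cli_typed N l \<Delta> k a b c U \<longleftrightarrow> k = 0 \<and> c \<notin> N \<and>
     (\<exists>n V L. has a (TCli n V) \<Delta> \<and> has b V \<Delta> \<and> wtyp N l (wtake b V \<Delta>) U L)"

definition out_lin_typed :: "name set \<Rightarrow> (name \<Rightarrow> nat) \<Rightarrow> wctx \<Rightarrow> nat \<Rightarrow> name \<Rightarrow> name \<Rightarrow> name \<Rightarrow> wproc \<Rightarrow> bool" where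
  "out_lin_typed N l \<Delta> k a b c U \<longleftrightarrow> k = Suc 0 \<and> c = 0 \<and>
     (\<exists>x v n V1 V2 L. a = Suc x \<and> b = Suc v \<and> has x (TOut n V1 V2) \<Delta> \<and> has v V1 (wtake x (TOut n V1 V2) \<Delta>) \<and>
       weights_pos V2 \<and> level_of V2 (l x) \<and>
       wtyp (scope N) (case_nat (l x) l) (ext (One V2) (wtake v V1 (wtake x (TOut n V1 V2) \<Delta>))) U L)"

text \<open>The process \<open>P\<close> below the opened restriction is kept with its typing, so
  that the restriction can later be put around sender and receiver. Unlike in \<open>out_ext\<close>
  it binds a single name, with both ends in one entry.\<close>

definition out_ext_typed :: "name set \<Rightarrow> (name \<Rightarrow> nat) \<Rightarrow> wctx \<Rightarrow> nat \<Rightarrow> name \<Rightarrow> name \<Rightarrow> name \<Rightarrow> wproc \<Rightarrow> bool" where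
  "out_ext_typed N l \<Delta> k a b c U \<longleftrightarrow> (\<exists>j V k0 P L. k = Suc j \<and> b = j \<and>
     (j = 0 \<and> (\<exists>z. z \<notin> N \<and> c = Suc z) \<or> j = Suc 0 \<and> c = 0) \<and> weights_pos V \<and> level_of V k0 \<and>
     wtyp (scope N) (case_nat k0 l) (ext (both V) \<Delta>) P L \<and> P \<midarrow>LOut j a b c\<rightarrow>\<^sub>w U)"

lemma out_cli_typed_par:
  assumes "out_cli_typed N l \<Delta>1 k a b c U" "w_split \<Delta> \<Delta>1 \<Delta>2" "wtyp N l \<Delta>2 Q L2"
  shows "out_cli_typed N l \<Delta> k a b c (WPar U (wren (\<lambda>n. n + k) Q))"
    and "out_cli_typed N l \<Delta> k a b c (WPar (wren (\<lambda>n. n + k) Q) U)"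
proof -
  obtain n V L where 1: "k = 0" "c \<notin> N" "has a (TCli n V) \<Delta>1" "has b V \<Delta>1" "wtyp N l (wtake b V \<Delta>1) U L"
    using assms(1) unfolding out_cli_typed_def by blast
  note 2 = split_take(1)[OF assms(2) 1(3)] and 3 = split_take[OF assms(2) 1(4)]
  show "out_cli_typed N l \<Delta> k a b c (WPar U (wren (\<lambda>n. n + k) Q))"
    "out_cli_typed N l \<Delta> k a b c (WPar (wren (\<lambda>n. n + k) Q) U)"
    unfolding out_cli_typed_def
    using 1(1,2) 2 3(1) wtyp_par[OF 3(2) 1(5) assms(3)] wtyp_par[OF w_split_sym[OF 3(2)] assms(3) 1(5)]
    by auto
qed

lemma out_lin_typed_par:
  assumes "out_lin_typed N l \<Delta>1 k a b c U" "w_split \<Delta> \<Delta>1 \<Delta>2" "wtyp N l \<Delta>2 Q L2"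
  shows "out_lin_typed N l \<Delta> k a b c (WPar U (wren (\<lambda>n. n + k) Q))"
    and "out_lin_typed N l \<Delta> k a b c (WPar (wren (\<lambda>n. n + k) Q) U)"
proof -
  obtain x v n V1 V2 L where 1: "k = Suc 0" "c = 0" "a = Suc x" "b = Suc v" "has x (TOut n V1 V2) \<Delta>1"
     "has v V1 (wtake x (TOut n V1 V2) \<Delta>1)" "weights_pos V2" "level_of V2 (l x)"
     "wtyp (scope N) (case_nat (l x) l) (ext (One V2) (wtake v V1 (wtake x (TOut n V1 V2) \<Delta>1))) U L"
    using assms(1) unfolding out_lin_typed_def by blast
  note 2 = split_take[OF assms(2) 1(5)]
  note 3 = split_take[OF 2(2) 1(6)]
  note 4 = w_split_lift1[OF 3(2), of "One V2"] and 5 = wtyp_lift1[OF assms(3), of "l x" "One V2"]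
  have eq: "wren (\<lambda>n. n + k) Q = wren Suc Q" using 1(1) by simp
  show "out_lin_typed N l \<Delta> k a b c (WPar U (wren (\<lambda>n. n + k) Q))"
    unfolding out_lin_typed_def eq
    using 1(1-4,7,8) 2(1) 3(1) wtyp_par[OF 4 1(9) 5] by blast
  show "out_lin_typed N l \<Delta> k a b c (WPar (wren (\<lambda>n. n + k) Q) U)"
    unfolding out_lin_typed_def eq
    using 1(1-4,7,8) 2(1) 3(1) wtyp_par[OF w_split_sym[OF 4] 5 1(9)] by blast
qed

lemma out_ext_typed_par:
  assumes "out_ext_typed N l \<Delta>1 k a b c U" "w_split \<Delta> \<Delta>1 \<Delta>2" "wtyp N l \<Delta>2 Q L2"
  shows "out_ext_typed N l \<Delta> k a b c (WPar U (wren (\<lambda>n. n + k) Q))"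
    and "out_ext_typed N l \<Delta> k a b c (WPar (wren (\<lambda>n. n + k) Q) U)"
proof -
  obtain j V k0 P L where 1: "k = Suc j" "b = j" "j = 0 \<and> (\<exists>z. z \<notin> N \<and> c = Suc z) \<or> j = Suc 0 \<and> c = 0"
     "weights_pos V" "level_of V k0" "wtyp (scope N) (case_nat k0 l) (ext (both V) \<Delta>1) P L"
     "P \<midarrow>LOut j a b c\<rightarrow>\<^sub>w U"
    using assms(1) unfolding out_ext_typed_def by blast
  note 4 = w_split_lift1[OF assms(2), of "both V"] and 5 = wtyp_lift1[OF assms(3), of k0 "both V"]
  have eq: "wren (\<lambda>n. n + k) Q = wren (\<lambda>n. n + j) (wren Suc Q)" using 1(1) by simp
  show "out_ext_typed N l \<Delta> k a b c (WPar U (wren (\<lambda>n. n + k) Q))"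
    unfolding out_ext_typed_def eq
    using 1(1-5) wtyp_par[OF 4 1(6) 5] wt_parL_out[OF 1(7), of "wren Suc Q"] by blast
  show "out_ext_typed N l \<Delta> k a b c (WPar (wren (\<lambda>n. n + k) Q) U)"
    unfolding out_ext_typed_def eq
    using 1(1-5) wtyp_par[OF w_split_sym[OF 4] 5 1(6)] wt_parR_out[OF 1(7), of "wren Suc Q"] by blast
qed

lemma not_scope1: "n \<notin> scope N \<longleftrightarrow> (\<exists>m. n = Suc m \<and> m \<notin> N)"
  by (cases n) auto

lemma out_cli_typed_res:
  assumes "out_cli_typed (scope N) (case_nat k0 l) (ext (both V) \<Delta>) k (skip k a) (skip k b) (skip k c) U"
    "weights_pos V" "level_of V k0"
  shows "out_cli_typed N l \<Delta> k a b c (WNu (wren (rot k) U))"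
proof -
  have k: "k = 0" using assms(1) by (simp add: out_cli_typed_def)
  then obtain n V' L where 1: "c \<notin> N" "has a (TCli n V') \<Delta>" "has b V' \<Delta>"
    "wtyp (scope N) (case_nat k0 l) (ext (both V) (wtake b V' \<Delta>)) U L"
    using assms(1) by (auto simp: out_cli_typed_def skip_0)
  moreover have "wren (rot k) U = U" using k by (simp add: rot_0[abs_def])
  ultimately show ?thesis
    using wtyp_res[OF assms(2,3) 1(4)] k by (auto simp: out_cli_typed_def)
qed

lemma out_lin_typed_res:
  assumes "out_lin_typed (scope N) (case_nat k0 l) (ext (both V) \<Delta>) k (skip k a) (skip k b) (skip k c) U"
    "weights_pos V" "level_of V k0"
  shows "out_lin_typed N l \<Delta> k a b c (WNu (wren (rot k) U))"
proof -
  obtain x v n V1 V2 L where 1: "k = Suc 0" "skip k c = 0" "skip k a = Suc x" "skip k b = Suc v"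
     "has x (TOut n V1 V2) (ext (both V) \<Delta>)" "has v V1 (wtake x (TOut n V1 V2) (ext (both V) \<Delta>))"
     "weights_pos V2" "level_of V2 (case_nat k0 l x)"
     "wtyp (scope (scope N)) (case_nat (case_nat k0 l x) (case_nat k0 l))
       (ext (One V2) (wtake v V1 (wtake x (TOut n V1 V2) (ext (both V) \<Delta>)))) U L"
    using assms(1) unfolding out_lin_typed_def by blast
  have "a = x" "x \<noteq> 0" "b = v" "v \<noteq> 0" and c: "c = 0"
    using 1(1-4) by (auto simp: skip_def split: if_splits)
  then obtain x' v' where 2: "x = Suc x'" "v = Suc v'" "a = Suc x'" "b = Suc v'"
    by (metis not0_implies_Suc)
  have "rot (Suc 0) = swap01" by (simp add: fun_eq_iff rot_def swap01_def)
  then have typed: "wtyp (scope (scope N)) (case_nat k0 (case_nat (l x') l))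
      (ext (both V) (ext (One V2) (wtake v' V1 (wtake x' (TOut n V1 V2) \<Delta>)))) (wren (rot k) U) L"
    using wtyp_swap01[of N "l x'" k0 l "One V2" "both V"] 1(1,9) unfolding 2 by simp
  then show ?thesis
    unfolding out_lin_typed_def using wtyp_res[OF assms(2,3) typed] 1(1,5-8) c unfolding 2 by auto
qed

lemma out_ext_typed_res:
  assumes "out_ext_typed (scope N) (case_nat k0 l) (ext (both V) \<Delta>) k (skip k a) (skip k b) (skip k c) U"
    "weights_pos V" "level_of V k0"
  shows "out_ext_typed N l \<Delta> k a b c (WNu (wren (rot k) U))"
proof -
  obtain j V1 k1 P L where 1: "k = Suc j" "skip k b = j"
     "j = 0 \<and> (\<exists>z. z \<notin> scope N \<and> skip k c = Suc z) \<or> j = Suc 0 \<and> skip k c = 0"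
     "weights_pos V1" "level_of V1 k1"
     "wtyp (scope (scope N)) (case_nat k1 (case_nat k0 l)) (ext (both V1) (ext (both V) \<Delta>)) P L"
     "P \<midarrow>LOut j (skip k a) (skip k b) (skip k c)\<rightarrow>\<^sub>w U"
    using assms(1) unfolding out_ext_typed_def by metis
  have b: "b = j" using 1(1,2) by (auto simp: skip_def split: if_splits)
  have c: "j = 0 \<and> (\<exists>z. z \<notin> N \<and> c = Suc z) \<or> j = Suc 0 \<and> c = 0"
    using 1(1,3) by (auto simp: skip_def not_scope1 split: if_splits)
  have "wtyp (scope N) (case_nat k1 l) (ext (both V1) \<Delta>) (WNu (wren swap01 P)) L"
    using wtyp_res[OF assms(2,3) wtyp_swap01[OF 1(6)]] .
  moreover have "WNu (wren swap01 P) \<midarrow>LOut j a b c\<rightarrow>\<^sub>w WNu (wren (rot k) U)"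
    using wtrans_out_swap[OF 1(7)[unfolded 1(1)]] 1(1) by simp
  ultimately show ?thesis unfolding out_ext_typed_def using 1(1,4,5) b c by blast
qed

text \<open>The three cases of \<open>out_cases\<close>, now obtained from the typing with weights.
  Again the scope \<open>N\<close> excludes that the second object of a client output is
  bound.\<close>

lemma out_typed_cases:
  "wtyp N l \<Delta> P L \<Longrightarrow> P \<midarrow>LOut k a b c\<rightarrow>\<^sub>w U \<Longrightarrow>
    out_cli_typed N l \<Delta> k a b c U \<or> out_lin_typed N l \<Delta> k a b c U \<or> out_ext_typed N l \<Delta> k a b c U"
proof (induction arbitrary: k a b c U rule: wtyp.induct)
  case (wtyp_nil \<Delta> N l)
  then show ?case by (auto elim: wtrans_NilE)
next
  case (wtyp_par \<Delta> \<Delta>1 \<Delta>2 N l P L1 Q L2)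
  from wtyp_par.prems show ?case
  proof (cases rule: wtrans_Par_outE)
    case (left U1)
    show ?thesis
      unfolding left(1) using wtyp_par.IH(1)[OF left(2)] out_cli_typed_par(1)[OF _ wtyp_par(1,3)]
        out_lin_typed_par(1)[OF _ wtyp_par(1,3)] out_ext_typed_par(1)[OF _ wtyp_par(1,3)] by metis
  next
    case (right U2)
    note split = w_split_sym[OF wtyp_par(1)]
    show ?thesis
      unfolding right(1) using wtyp_par.IH(2)[OF right(2)] out_cli_typed_par(2)[OF _ split wtyp_par(2)]
        out_lin_typed_par(2)[OF _ split wtyp_par(2)] out_ext_typed_par(2)[OF _ split wtyp_par(2)] by metis
  qed
next
  case (wtyp_res V k0 N l \<Delta> P L)
  from wtyp_res.prems show ?case
  proof (cases rule: wtrans_Nu_outE)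
    case (opened j)
    from wtyp_res.IH[OF opened(2)] have "b = j \<and> (j = 0 \<and> (\<exists>z. z \<notin> N \<and> c = Suc z) \<or> j = Suc 0 \<and> c = 0)"
    proof (elim disjE)
      assume "out_cli_typed (scope N) (case_nat k0 l) (ext (both V) \<Delta>) j a b c U"
      then show ?thesis using opened(4) by (auto simp: out_cli_typed_def not_scope1)
    next
      assume "out_lin_typed (scope N) (case_nat k0 l) (ext (both V) \<Delta>) j a b c U"
      then show ?thesis using opened(4) by (auto simp: out_lin_typed_def)
    next
      assume "out_ext_typed (scope N) (case_nat k0 l) (ext (both V) \<Delta>) j a b c U"
      then obtain i where "j = Suc i" "b = i"
        "i = 0 \<and> (\<exists>z. z \<notin> scope N \<and> c = Suc z) \<or> i = Suc 0 \<and> c = 0"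
        unfolding out_ext_typed_def by blast
      then show ?thesis using opened(4) by (auto simp: not_scope1)
    qed
    then have "out_ext_typed N l \<Delta> k a b c U"
      unfolding out_ext_typed_def using opened(1,2) wtyp_res(1-3) by blast
    then show ?thesis by blast
  next
    case (res U0)
    show ?thesis
      unfolding res(1) using wtyp_res.IH[OF res(2)] out_cli_typed_res[OF _ wtyp_res(1,2)]
        out_lin_typed_res[OF _ wtyp_res(1,2)] out_ext_typed_res[OF _ wtyp_res(1,2)] by metis
  qed
next
  case (wtyp_lin_in x n V1 V2 \<Delta> k1 l N P L)
  then show ?case by (auto elim: wtrans_In_outE)
next
  case (wtyp_srv_in x n V \<Delta> k1 N k2 l P L)
  then show ?case by (auto elim: wtrans_In_outE)
next
  case (wtyp_rep \<Delta> x n V k1 N k2 l P L)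
  then show ?case by (auto elim: wtrans_Rep_outE)
next
  case (wtyp_lin_out x n V1 V2 \<Delta> v l N P L)
  have "k = Suc 0 \<and> a = Suc x \<and> b = Suc v \<and> c = 0 \<and> U = P"
    using wtyp_lin_out.prems by (cases rule: wtrans_Nu_outE) (auto elim!: wtrans_Out_outE simp: skip_def)
  then have "out_lin_typed N l \<Delta> k a b c U"
    unfolding out_lin_typed_def using wtyp_lin_out(1-5) by blast
  then show ?case by blast
next
  case (wtyp_cli_out x n V \<Delta> v z N P l L)
  have "k = 0 \<and> a = x \<and> b = v \<and> c = z \<and> U = P"
    using wtyp_cli_out.prems by (auto elim!: wtrans_Out_outE)
  then have "out_cli_typed N l \<Delta> k a b c U"
    unfolding out_cli_typed_def using wtyp_cli_out(1-3,5) by blast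
  then show ?case by blast
qed

section \<open>Subject reduction\<close>

text \<open>A linear communication consumes both endpoints of its channel.\<close>
definition ctx_red :: "wctx \<Rightarrow> wctx \<Rightarrow> bool" where
  "ctx_red \<Delta> \<Delta>' \<longleftrightarrow> \<Delta>' = \<Delta> \<or> (\<exists>x V. \<not> w_un V \<and> \<Delta> x = Some (both V) \<and> \<Delta>' = \<Delta>(x := None))"

lemma lift1_Suc: "lift1 e \<Delta> (Suc x) = \<Delta> x"
  by (simp add: lift1_def)

text \<open>If the consumed channel is the restricted one, its name is dead and is retyped with
  \<open>unit\<close>, the counterpart of \<open>end\<close> on the session side. Otherwise the
  restriction keeps its type.\<close>

lemma ctx_red_res:
  assumes "ctx_red (ext (both V) \<Delta>) \<Delta>'" "weights_pos V" "level_of V k"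
  obtains \<Delta>'' where "ctx_red \<Delta> \<Delta>''"
    "\<And>N l U L. wtyp (scope N) (case_nat k l) \<Delta>' U L \<Longrightarrow> wtyp N l \<Delta>'' (WNu U) L"
  using assms(1) unfolding ctx_red_def
proof (elim disjE exE conjE)
  assume "\<Delta>' = ext (both V) \<Delta>"
  then show thesis using that[of \<Delta>] wtyp_res[OF assms(2,3)] unfolding ctx_red_def by blast
next
  fix x V' assume x: "\<not> w_un V'" "ext (both V) \<Delta> x = Some (both V')" "\<Delta>' = (ext (both V) \<Delta>)(x := None)"
  show thesis
  proof (cases x)
    case 0
    have "wtyp N l \<Delta> (WNu U) L" if U: "wtyp (scope N) (case_nat k l) \<Delta>' U L" for N l U L
    proof -
      have "wtyp (scope N) (case_nat k l) (ext (both TUnit) \<Delta>) U L"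
      proof (rule wtyp_weaken[OF U])
        fix y assume "ext (both TUnit) \<Delta> y \<noteq> \<Delta>' y"
        then have "y = 0" using x(3) 0 by (cases y) auto
        then show "\<exists>d. ext (both TUnit) \<Delta> y = Some d \<and> e_un d \<and> (\<forall>e. \<Delta>' y = Some e \<longrightarrow> ele e d)"
          using x(3) 0 by simp
      qed
      then show ?thesis by (rule wtyp_res[rotated 2]) simp_all
    qed
    then show thesis using that[of \<Delta>] unfolding ctx_red_def by blast
  next
    case (Suc m)
    then have m: "\<Delta>' = ext (both V) (\<Delta>(m := None))" "\<Delta> m = Some (both V')" using x(2,3) by simp_all
    have "ctx_red \<Delta> (\<Delta>(m := None))" using m(2) x(1) unfolding ctx_red_def by blast
    then show thesis using that wtyp_res[OF assms(2,3)] unfolding m(1) by blast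
  qed
qed

lemma ctx_red_split:
  assumes "ctx_red \<Delta>1 \<Delta>1'" "w_split \<Delta> \<Delta>1 \<Delta>2"
  shows "\<exists>\<Delta>'. ctx_red \<Delta> \<Delta>' \<and> w_split \<Delta>' \<Delta>1' \<Delta>2"
  using assms(1) unfolding ctx_red_def
proof (elim disjE exE conjE)
  assume "\<Delta>1' = \<Delta>1"
  then show "\<exists>\<Delta>'. (\<Delta>' = \<Delta> \<or> (\<exists>x V. \<not> w_un V \<and> \<Delta> x = Some (both V) \<and> \<Delta>' = \<Delta>(x := None))) \<and> w_split \<Delta>' \<Delta>1' \<Delta>2"
    using assms(2) by blast
next
  fix x V assume x: "\<not> w_un V" "\<Delta>1 x = Some (both V)" "\<Delta>1' = \<Delta>1(x := None)"
  have D: "\<Delta> x = Some (both V)" "\<Delta>2 x = None"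
    using w_split_D[OF assms(2), of x] x(1,2)
    by (auto simp: w_split_entry_iff split: option.splits if_splits)
  have "w_split (\<Delta>(x := None)) (\<Delta>1(x := None)) (\<Delta>2(x := None))"
    by (rule w_split_upd[OF assms(2)]) simp
  moreover have "\<Delta>2(x := None) = \<Delta>2" using D(2) by auto
  ultimately have "w_split (\<Delta>(x := None)) \<Delta>1' \<Delta>2" using x(3) by simp
  then show "\<exists>\<Delta>'. (\<Delta>' = \<Delta> \<or> (\<exists>x V. \<not> w_un V \<and> \<Delta> x = Some (both V) \<and> \<Delta>' = \<Delta>(x := None))) \<and> w_split \<Delta>' \<Delta>1' \<Delta>2"
    using x(1) D(1) by blast
qed

lemma wfn_in_aux: "P \<midarrow>\<alpha>\<rightarrow>\<^sub>w P' \<Longrightarrow> \<alpha> = LIn x v c \<Longrightarrow> wfn P' \<subseteq> wfn P \<union> {v, c}"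
proof (induction arbitrary: x v c rule: wtrans.induct)
  case (wt_in x P v1 v2)
  have "case_nat v1 (case_nat v2 id) n \<in> {v1, v2} \<union> {m. Suc (Suc m) \<in> wfn P}" if "n \<in> wfn P" for n
    using that by (rule_tac nat2_cases[of n]) auto
  then show ?case using wt_in by auto
next
  case (wt_rep x P v1 v2)
  have "case_nat v1 (case_nat v2 id) n \<in> {v1, v2} \<union> {m. Suc (Suc m) \<in> wfn P}" if "n \<in> wfn P" for n
    using that by (rule_tac nat2_cases[of n]) auto
  then show ?case using wt_rep by auto
next
  case (wt_res_in P x v1 v2 P')
  from wt_res_in.IH[OF refl] wt_res_in.prems show ?case by auto
next
  case (wt_parL_in P x v1 v2 P' Q)
  from wt_parL_in.IH[OF refl] wt_parL_in.prems show ?case by auto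
next
  case (wt_parR_in Q x v1 v2 Q' P)
  from wt_parR_in.IH[OF refl] wt_parR_in.prems show ?case by auto
qed simp_all

definition comm_typed where
  "comm_typed N l \<Delta> k U1 U2 \<longleftrightarrow> (\<exists>\<Delta>' L L'. ctx_red \<Delta> \<Delta>' \<and> wtyp N l \<Delta>' ((WNu ^^ k) (WPar U1 U2)) L \<and>
     wtyp N l \<Delta>' ((WNu ^^ k) (WPar U2 U1)) L')"

lemma has_mem_dom: "has x V \<Delta> \<Longrightarrow> x \<in> dom \<Delta>"
  by (auto simp: has_def)

lemma comm_cli_typed:
  assumes "out_cli_typed N l \<Delta>1 k a b c U1" "wtyp N l \<Delta>2 Q L2" "w_split \<Delta> \<Delta>1 \<Delta>2" "dom \<Delta> \<subseteq> N"
    "lvl_ctx l \<Delta>" "finite N" "\<And>c. Q \<midarrow>LIn a b c\<rightarrow>\<^sub>w U2"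
  shows "comm_typed N l \<Delta> k U1 U2"
proof -
  obtain n V L1 where 1: "k = 0" "has a (TCli n V) \<Delta>1" "has b V \<Delta>1" "wtyp N l (wtake b V \<Delta>1) U1 L1"
    using assms(1) unfolding out_cli_typed_def by blast
  note a = split_take(1)[OF assms(3) 1(2)] and b = split_take(1)[OF assms(3) 1(3)]
  have N: "a \<in> N" "b \<in> N" using has_mem_dom[OF a] has_mem_dom[OF b] assms(4) by auto
  have dom2: "dom \<Delta>2 \<subseteq> N" using w_split_dom(2)[OF assms(3)] assms(4) by simp
  have "finite (N \<union> wfn Q)" using assms(6) finite_wfn by simp
  then obtain c where c: "c \<notin> N" "c \<notin> wfn Q"
    using ex_new_if_finite[OF infinite_UNIV_nat] by blast
  let ?N = "insert c N" and ?\<Delta>2 = "\<Delta>2(c \<mapsto> One TUnit)"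
  have "b \<noteq> c" "a \<noteq> c" using N c by auto
  have "in_typed ?N l ?\<Delta>2 a b c U2"
    using wtyp_insert_fresh[OF assms(2) dom2 c] assms(7) N(2) \<open>b \<noteq> c\<close> by (intro in_typed_cases) simp_all
  then obtain W m V1 V2 where 2: "has a W ?\<Delta>2" "W = TIn m V1 V2 \<or> W = TSrv m V1 \<and> V2 = TUnit"
     "wput_ok b V1 (wtake a W ?\<Delta>2) \<Longrightarrow> wput_ok c V2 (wtake a W ?\<Delta>2) \<Longrightarrow> level_of V1 (l b) \<Longrightarrow>
       V2 = TUnit \<or> l c = l a \<Longrightarrow> \<exists>L. wtyp ?N l (wput c V2 (wput b V1 (wtake a W ?\<Delta>2))) U2 L"
    unfolding in_typed_def by blast
  \<comment> \<open>The channel is unrestricted, so sender and receiver have the same entry; an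
    input type in it can only be the dual of the client type.\<close>
  have "\<Delta>1 a = \<Delta>2 a"
    using w_split_D[OF assms(3), of a] 1(2) by (auto simp: has_def w_split_entry_iff split: option.splits if_splits)
  then have aW: "has a W \<Delta>1" using 2(1) \<open>a \<noteq> c\<close> by (simp add: has_def)
  have W: "W = TSrv m V" "V1 = V" "V2 = TUnit"
    using aW 1(2) 2(2) by (auto simp: has_def doubleton_eq_iff)
  have take: "wtake a (TSrv m V) ?\<Delta>2 = ?\<Delta>2" by (simp add: wtake_def)
  note put = split_take_put[OF assms(3) 1(3)]
  have "wput_ok b V ?\<Delta>2" using put(1) \<open>b \<noteq> c\<close> wput_ok_cong[of ?\<Delta>2 b \<Delta>2 V] by simp
  moreover have "wput_ok c TUnit ?\<Delta>2" by (simp add: wput_ok_def has_def)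
  moreover have "level_of V (l b)" using lvl_ctx_has[OF assms(5) b] .
  ultimately obtain L where L: "wtyp ?N l (wput c TUnit (wput b V ?\<Delta>2)) U2 L"
    using 2(3) unfolding W take by blast
  have eq: "wput c TUnit (wput b V ?\<Delta>2) = (wput b V \<Delta>2)(c \<mapsto> One TUnit)"
    using \<open>b \<noteq> c\<close> by (auto simp: wput_def fun_eq_iff)
  have dom: "dom (wput b V \<Delta>2) \<subseteq> N" using dom2 N(2) by (auto simp: wput_def)
  \<comment> \<open>The same residual arises with the payload \<open>b\<close> as second object, so
    its free names are among those of \<open>Q\<close> and \<open>b\<close>.\<close>
  have "c \<notin> wfn U2" using wfn_in_aux[OF assms(7)[of b] refl] c(2) \<open>b \<noteq> c\<close> by auto
  moreover have "dom ((wput b V \<Delta>2)(c \<mapsto> One TUnit)) \<subseteq> ?N" using dom by auto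
  ultimately have "wtyp N l (((wput b V \<Delta>2)(c \<mapsto> One TUnit))(c := None)) U2 L"
    using c(1) L[unfolded eq] by (intro wtyp_strengthen) auto
  moreover have "((wput b V \<Delta>2)(c \<mapsto> One TUnit))(c := None) = wput b V \<Delta>2"
    unfolding fun_upd_upd using dom c(1) by (intro fun_upd_idem) blast
  ultimately have U2: "wtyp N l (wput b V \<Delta>2) U2 L" by simp
  show ?thesis
    unfolding comm_typed_def ctx_red_def using 1(1) wtyp_par[OF put(2) 1(4) U2]
      wtyp_par[OF w_split_sym[OF put(2)] U2 1(4)] by auto
qed

lemma comm_lin_typed:
  assumes "out_lin_typed N l \<Delta>1 k (a + k) b c U1" "wtyp N l \<Delta>2 Q L2" "w_split \<Delta> \<Delta>1 \<Delta>2" "dom \<Delta> \<subseteq> N"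
    "lvl_ctx l \<Delta>" "wren (\<lambda>n. n + k) Q \<midarrow>LIn (a + k) b c\<rightarrow>\<^sub>w U2"
  shows "comm_typed N l \<Delta> k U1 U2"
proof -
  obtain v n V1 V2 L1 where 1: "k = Suc 0" "c = 0" "b = Suc v" "has a (TOut n V1 V2) \<Delta>1"
     "has v V1 (wtake a (TOut n V1 V2) \<Delta>1)" "weights_pos V2" "level_of V2 (l a)"
     "wtyp (scope N) (case_nat (l a) l) (ext (One V2) (wtake v V1 (wtake a (TOut n V1 V2) \<Delta>1))) U1 L1"
    using assms(1) unfolding out_lin_typed_def by auto
  let ?T = "TOut n V1 V2" and ?l = "case_nat (l a) l"
  have tr: "wren Suc Q \<midarrow>LIn (Suc a) (Suc v) 0\<rightarrow>\<^sub>w U2" using assms(6) 1(1-3) by simp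
  note take = split_take[OF assms(3) 1(4)]
  note v = split_take(1)[OF take(2) 1(5)]
  have N: "v \<in> N" using has_mem_dom[OF v] has_mem_dom[OF take(1)] assms(4) by (auto simp: wtake_def split: if_splits)
  \<comment> \<open>Index 0 is the name created by the output. If unrestricted, it has to be in the
    receiver's context before the input; if linear, it is added by the input. \<open>lift1\<close>
    covers both.\<close>
  have "in_typed (scope N) ?l (lift1 (One (wdual V2)) \<Delta>2) (Suc a) (Suc v) 0 U2"
    using N by (intro in_typed_cases[OF wtyp_lift1[OF assms(2)] tr]) simp_all
  then obtain W m V1' V2' where 2: "has (Suc a) W (lift1 (One (wdual V2)) \<Delta>2)"
     "W = TIn m V1' V2' \<or> W = TSrv m V1' \<and> V2' = TUnit"
     "wput_ok (Suc v) V1' (wtake (Suc a) W (lift1 (One (wdual V2)) \<Delta>2)) \<Longrightarrow>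
      wput_ok 0 V2' (wtake (Suc a) W (lift1 (One (wdual V2)) \<Delta>2)) \<Longrightarrow> level_of V1' (?l (Suc v)) \<Longrightarrow>
      V2' = TUnit \<or> ?l 0 = ?l (Suc a) \<Longrightarrow>
      \<exists>L. wtyp (scope N) ?l (wput 0 V2' (wput (Suc v) V1' (wtake (Suc a) W (lift1 (One (wdual V2)) \<Delta>2)))) U2 L"
    unfolding in_typed_def by blast
  have aW: "has a W \<Delta>2" using 2(1) by (simp add: has_def lift1_def)
  have D: "\<Delta>1 a = Some (One ?T)" "\<Delta> a = Some (both ?T)" "\<Delta>2 a = Some (One (wdual ?T))"
  proof -
    have lin: "\<not> e_un (One ?T)" "\<not> e_un (both ?T)" by simp_all
    \<comment> \<open>The receiver uses \<open>a\<close> too, so the linear entry must have been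
      split into its two halves.\<close>
    have "\<Delta>2 a \<noteq> None" using aW by (auto simp: has_def)
    then have "\<Delta>1 a = Some (One ?T) \<and> \<Delta> a = Some (both ?T) \<and> \<Delta>2 a = Some (One (wdual ?T))"
      using w_split_D[OF assms(3), of a] 1(4) lin unfolding has_def
      by (cases "\<Delta> a") (auto simp: w_split_entry_iff simp del: wdual.simps e_un.simps split: if_splits)
    then show "\<Delta>1 a = Some (One ?T)" "\<Delta> a = Some (both ?T)" "\<Delta>2 a = Some (One (wdual ?T))" by blast+
  qed
  have W: "W = TIn n V1 (wdual V2)" "V1' = V1" "V2' = wdual V2"
    using aW 2(2) D(3) by (auto simp: has_def)
  have take1: "wtake a ?T \<Delta>1 = \<Delta>1(a := None)" using D(1) by (simp add: wtake_def)
  have take2: "wtake (Suc a) (TIn n V1 (wdual V2)) (lift1 (One (wdual V2)) \<Delta>2) = lift1 (One (wdual V2)) (\<Delta>2(a := None))"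
    using D(3) by (auto simp: wtake_def lift1_def fun_eq_iff split: nat.splits)
  have split: "w_split (\<Delta>(a := None)) (\<Delta>1(a := None)) (\<Delta>2(a := None))"
    by (rule w_split_upd[OF assms(3)]) simp
  note put = split_take_put[OF split 1(5)[unfolded take1]]
  have "wput_ok (Suc v) V1 (lift1 (One (wdual V2)) (\<Delta>2(a := None)))"
    using put(1) by (simp only: wput_ok_def has_def lift1_Suc)
  moreover have "wput_ok 0 (wdual V2) (lift1 (One (wdual V2)) (\<Delta>2(a := None)))"
    by (simp add: wput_ok_def lift1_def has_def)
  moreover have "has v V1 \<Delta>"
    using v D(2) by (auto simp: wtake_def has_def split: if_splits)
  then have "level_of V1 (?l (Suc v))" using lvl_ctx_has[OF assms(5)] by simp
  ultimately obtain L where "wtyp (scope N) ?l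
      (wput 0 (wdual V2) (wput (Suc v) V1 (lift1 (One (wdual V2)) (\<Delta>2(a := None))))) U2 L"
    using 2(3) unfolding W take2 by auto
  moreover have "wput 0 (wdual V2) (wput (Suc v) V1 (lift1 (One (wdual V2)) (\<Delta>2(a := None)))) =
      ext (One (wdual V2)) (wput v V1 (\<Delta>2(a := None)))" (is "?lhs = ?rhs")
  proof
    fix y show "?lhs y = ?rhs y" by (cases y) (auto simp: wput_def lift1_def)
  qed
  ultimately have U2: "wtyp (scope N) ?l (ext (One (wdual V2)) (wput v V1 (\<Delta>2(a := None)))) U2 L" by simp
  let ?A = "wtake v V1 (\<Delta>1(a := None))" and ?B = "wput v V1 (\<Delta>2(a := None))"
  have U1: "wtyp (scope N) ?l (ext (One V2) ?A) U1 L1" using 1(8) take1 by simp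
  \<comment> \<open>The continuations share the new name: if \<open>V2\<close> is linear, each has
    one end; otherwise both entries are completed to \<open>both V2\<close>, since an unrestricted
    entry is copied whole.\<close>
  have "\<exists>A B. w_split (ext (both V2) (\<Delta>(a := None))) A B \<and> wtyp (scope N) ?l A U1 L1 \<and> wtyp (scope N) ?l B U2 L"
  proof (cases "w_un V2")
    case True
    have "w_split (ext (both V2) (\<Delta>(a := None))) (ext (both V2) ?A) (ext (both V2) ?B)"
      unfolding w_split_def
    proof
      fix y show "w_split_entry (ext (both V2) (\<Delta>(a := None)) y) (ext (both V2) ?A y) (ext (both V2) ?B y)"
        using w_split_D[OF put(2)] True by (cases y) (simp_all add: w_split_entry_iff)
    qed
    moreover have up: "wtyp (scope N) ?l (ext (both V2) A) U L" if "wtyp (scope N) ?l (ext (One V) A) U L"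
      "V = V2 \<or> V = wdual V2" for A U L V
    proof (rule wtyp_weaken[OF that(1)])
      fix y assume "ext (both V2) A y \<noteq> ext (One V) A y"
      then have "y = 0" by (cases y) auto
      moreover have "both V2 = both V" "w_un V"
        using that(2) True both_wdual[of V2] by (metis, metis w_un_wdual)
      then have "ele (One V) (both V2)" unfolding ele_def by (metis e_un.simps(1))
      ultimately show "\<exists>d. ext (both V2) A y = Some d \<and> e_un d \<and> (\<forall>e. ext (One V) A y = Some e \<longrightarrow> ele e d)"
        using True by simp
    qed
    ultimately show ?thesis using up[OF U1] up[OF U2] by blast
  next
    case False
    have "w_split (ext (both V2) (\<Delta>(a := None))) (ext (One V2) ?A) (ext (One (wdual V2)) ?B)"
      unfolding w_split_def
    proof
      fix y show "w_split_entry (ext (both V2) (\<Delta>(a := None)) y) (ext (One V2) ?A y) (ext (One (wdual V2)) ?B y)"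
        using w_split_D[OF put(2)] False by (cases y) (auto simp: w_split_entry_iff)
    qed
    then show ?thesis using U1 U2 by blast
  qed
  then obtain A B where AB: "w_split (ext (both V2) (\<Delta>(a := None))) A B"
    "wtyp (scope N) ?l A U1 L1" "wtyp (scope N) ?l B U2 L" by blast
  have "ctx_red \<Delta> (\<Delta>(a := None))" unfolding ctx_red_def using D(2) by (intro disjI2 exI[of _ a] exI[of _ ?T]) simp
  then show ?thesis
    unfolding comm_typed_def
    using 1(1) wtyp_res[OF 1(6,7) wtyp_par[OF AB]] wtyp_res[OF 1(6,7) wtyp_par[OF w_split_sym[OF AB(1)] AB(3,2)]]
    by auto
qed

lemma comm_out_in_typed:
  "wtyp N l \<Delta>1 P L1 \<Longrightarrow> wtyp N l \<Delta>2 Q L2 \<Longrightarrow> w_split \<Delta> \<Delta>1 \<Delta>2 \<Longrightarrow> dom \<Delta> \<subseteq> N \<Longrightarrow> lvl_ctx l \<Delta> \<Longrightarrow> finite N \<Longrightarrow>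
    P \<midarrow>LOut k (a + k) b c\<rightarrow>\<^sub>w U1 \<Longrightarrow> wren (\<lambda>n. n + k) Q \<midarrow>LIn (a + k) b c\<rightarrow>\<^sub>w U2 \<Longrightarrow>
    c < k \<or> (\<forall>c. wren (\<lambda>n. n + k) Q \<midarrow>LIn (a + k) b c\<rightarrow>\<^sub>w U2) \<Longrightarrow> comm_typed N l \<Delta> k U1 U2"
proof (induction k arbitrary: N l \<Delta> \<Delta>1 \<Delta>2 P Q L1 L2 a)
  case 0
  then have "out_cli_typed N l \<Delta>1 0 a b c U1"
    using out_typed_cases[OF 0(1) 0(7)] by (auto simp: out_lin_typed_def out_ext_typed_def)
  then show ?case using 0(2-6) by (rule comm_cli_typed) (use 0(9) in simp)
next
  case (Suc k)
  note prems = Suc.prems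
  have "\<not> out_cli_typed N l \<Delta>1 (Suc k) (a + Suc k) b c U1" by (simp add: out_cli_typed_def)
  with out_typed_cases[OF prems(1,7)] consider
    "out_lin_typed N l \<Delta>1 (Suc k) (a + Suc k) b c U1" | "out_ext_typed N l \<Delta>1 (Suc k) (a + Suc k) b c U1" by blast
  then show ?case
  proof cases
    case 1
    then show ?thesis using prems(2-5,8) by (rule comm_lin_typed)
  next
    case 2
    \<comment> \<open>The name opened last is the payload, index \<open>k\<close> of the label, and
      the second object differs from it. So the condition on \<open>c\<close> passes from
      \<open>Suc k\<close> to \<open>k\<close>.\<close>
    then obtain V k0 P1 L where 3: "weights_pos V" "level_of V k0"
      "wtyp (scope N) (case_nat k0 l) (ext (both V) \<Delta>1) P1 L" "P1 \<midarrow>LOut k (Suc a + k) b c\<rightarrow>\<^sub>w U1"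
      "c < Suc k \<longrightarrow> c < k"
      unfolding out_ext_typed_def by auto
    have eq: "wren (\<lambda>n. n + k) (wren Suc Q) = wren (\<lambda>n. n + Suc k) Q" "Suc a + k = a + Suc k" by simp_all
    have "comm_typed (scope N) (case_nat k0 l) (ext (both V) \<Delta>) k U1 U2"
    proof (rule Suc.IH[OF 3(3) wtyp_lift1[OF prems(2)] w_split_lift1[OF prems(3)] dom_ext_subset[OF prems(4)] _ _ 3(4)])
      show "lvl_ctx (case_nat k0 l) (ext (both V) \<Delta>)" using prems(5) 3(2) by (simp add: lvl_ctx_ext)
      show "finite (scope N)" using prems(6) by (simp add: scope_def)
      show "wren (\<lambda>n. n + k) (wren Suc Q) \<midarrow>LIn (Suc a + k) b c\<rightarrow>\<^sub>w U2" unfolding eq by (rule prems(8))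
      show "c < k \<or> (\<forall>c. wren (\<lambda>n. n + k) (wren Suc Q) \<midarrow>LIn (Suc a + k) b c\<rightarrow>\<^sub>w U2)"
        unfolding eq using prems(9) 3(5) by blast
    qed
    then obtain \<Delta>' L L' where 4: "ctx_red (ext (both V) \<Delta>) \<Delta>'"
      "wtyp (scope N) (case_nat k0 l) \<Delta>' ((WNu ^^ k) (WPar U1 U2)) L"
      "wtyp (scope N) (case_nat k0 l) \<Delta>' ((WNu ^^ k) (WPar U2 U1)) L'"
      unfolding comm_typed_def by blast
    show ?thesis
      using ctx_red_res[OF 4(1) 3(1,2)] 4(2,3) unfolding comm_typed_def funpow_Suc_WNu by metis
  qed
qed

lemma stau_typed:
  "stau P P' \<Longrightarrow> wtyp N l \<Delta> P L \<Longrightarrow> dom \<Delta> \<subseteq> N \<Longrightarrow> lvl_ctx l \<Delta> \<Longrightarrow> finite N \<Longrightarrow>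
    \<exists>\<Delta>' L'. ctx_red \<Delta> \<Delta>' \<and> wtyp N l \<Delta>' P' L'"
proof (induction arbitrary: N l \<Delta> L rule: stau.induct)
  case (stau_res P P')
  from stau_res.prems(1) show ?case
  proof (cases rule: wtyp_NuE)
    case (res V k)
    have "\<exists>\<Delta>' L'. ctx_red (ext (both V) \<Delta>) \<Delta>' \<and> wtyp (scope N) (case_nat k l) \<Delta>' P' L'"
      using stau_res.prems res(2)
      by (intro stau_res.IH[OF res(3)] dom_ext_subset lvl_ctx_ext) (simp_all add: scope_def)
    then show ?thesis using ctx_red_res[OF _ res(1,2)] by metis
  next
    \<comment> \<open>A prefix has no \<open>stau\<close> step.\<close>
    case (lin_out x n V1 V2 v P0 L0)
    with stau_res(1) show ?thesis by (auto elim: stau.cases)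
  qed
next
  case (stau_parL P P' Q)
  from stau_parL.prems(1) obtain \<Delta>1 \<Delta>2 L1 L2 where 1: "w_split \<Delta> \<Delta>1 \<Delta>2" "wtyp N l \<Delta>1 P L1" "wtyp N l \<Delta>2 Q L2"
    by (auto elim: wtyp_ParE)
  obtain \<Delta>1' L' where 2: "ctx_red \<Delta>1 \<Delta>1'" "wtyp N l \<Delta>1' P' L'"
    using stau_parL.IH[OF 1(2) _ lvl_ctx_split[OF 1(1)]] stau_parL.prems w_split_dom(1)[OF 1(1)] by blast
  show ?case using ctx_red_split[OF 2(1) 1(1)] wtyp_par[OF _ 2(2) 1(3)] by blast
next
  case (stau_parR P P' Q)
  from stau_parR.prems(1) obtain \<Delta>1 \<Delta>2 L1 L2 where 1: "w_split \<Delta> \<Delta>2 \<Delta>1" "wtyp N l \<Delta>1 P L1" "wtyp N l \<Delta>2 Q L2"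
    by (auto elim: wtyp_ParE)
  note 1 = w_split_sym[OF 1(1)] 1(2,3)
  obtain \<Delta>1' L' where 2: "ctx_red \<Delta>1 \<Delta>1'" "wtyp N l \<Delta>1' P' L'"
    using stau_parR.IH[OF 1(2) _ lvl_ctx_split[OF 1(1)]] stau_parR.prems w_split_dom(1)[OF 1(1)] by blast
  show ?case using ctx_red_split[OF 2(1) 1(1)] wtyp_par[OF w_split_sym 1(3) 2(2)] by blast
next
  case (stau_comL P k a b c P' Q Q')
  from stau_comL.prems(1) obtain \<Delta>1 \<Delta>2 L1 L2 where 1: "w_split \<Delta> \<Delta>1 \<Delta>2" "wtyp N l \<Delta>1 P L1" "wtyp N l \<Delta>2 Q L2"
    by (auto elim: wtyp_ParE)
  show ?case
    using comm_out_in_typed[OF 1(2,3,1) stau_comL.prems(2-4) stau_comL(1-3)] unfolding comm_typed_def by blast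
next
  case (stau_comR P k a b c P' Q Q')
  from stau_comR.prems(1) obtain \<Delta>1 \<Delta>2 L1 L2 where 1: "w_split \<Delta> \<Delta>2 \<Delta>1" "wtyp N l \<Delta>1 P L1" "wtyp N l \<Delta>2 Q L2"
    by (auto elim: wtyp_ParE)
  note 1 = w_split_sym[OF 1(1)] 1(2,3)
  show ?case
    using comm_out_in_typed[OF 1(2,3,1) stau_comR.prems(2-4) stau_comR(1-3)] unfolding comm_typed_def by blast
qed

lemma type_trans_level: "type_trans l x T V \<Longrightarrow> level_of V (l x)"
  by (erule type_trans.cases) simp_all

theorem mainTheorem5:
  fixes P :: sproc and \<Gamma> :: sctx and l :: "name \<Rightarrow> nat" and W U :: wproc
  assumes "P \<in> calW"
    and "session_ctx \<Gamma>"
    and "\<Gamma> \<turnstile>\<^sub>s P"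
    and "translates \<Gamma> P W"
    and "w_derivable l \<Gamma> W"
    and "W \<midarrow>Tau\<rightarrow>\<^sub>w U"
  shows "\<exists>R\<in>calW. \<exists>Q\<in>calW. P \<longrightarrow>\<^sub>s Q \<and> R \<equiv>\<^sub>s Q \<and> translates \<Gamma> R U"
proof -
  have str: "str (dom \<Gamma>) \<Gamma> P W" using assms(4) strans_imp_str by (simp add: translates_def)
  have "sess \<Gamma>" using assms(2) by (auto simp: sess_def session_ctx_def ran_def)
  then obtain R where R: "P \<longrightarrow>\<^sub>s R" "str (dom \<Gamma>) \<Gamma> R U" "stau W U"
    using translated_tau[OF str subset_refl _ assms(6)] by blast
  have tr: "translates \<Gamma> R U" using str_imp_strans[OF R(2)] by (simp add: translates_def)
  obtain \<Delta> L where \<Delta>: "ctx_trans l \<Gamma> \<Delta>" "wtyped l \<Delta> W L"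
    using assms(5) by (auto simp: w_derivable_def)
  have dom: "dom \<Delta> = dom \<Gamma>" using \<Delta>(1) by (simp add: ctx_trans_def)
  have One: "\<exists>V. e = One V \<and> level_of V (l x)" if e: "\<Delta> x = Some e" for x e
  proof -
    obtain T where "\<Gamma> x = Some T" using e dom by auto
    then show ?thesis using \<Delta>(1) e type_trans_level unfolding ctx_trans_def by fastforce
  qed
  then have "lvl_ctx l \<Delta>" by (fastforce simp: lvl_ctx_def)
  moreover have "wtyp (dom \<Gamma>) l \<Delta> W L"
    using str_shape[OF str] dom \<Delta>(2) by (intro wtyped_imp_wtyp) simp_all
  moreover have "finite (dom \<Gamma>)" using assms(2) by (simp add: session_ctx_def)
  ultimately obtain \<Delta>' L' where "ctx_red \<Delta> \<Delta>'" "wtyp (dom \<Gamma>) l \<Delta>' U L'"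
    using stau_typed[OF R(3)] dom by blast
  \<comment> \<open>A translated context has no entry \<open>x::V\<close>, hence no channel that
    could be consumed; the residual is typed in the same context as \<open>W\<close>.\<close>
  moreover have "\<Delta> x \<noteq> Some (both V)" for x V using One by blast
  ultimately have "wtyp (dom \<Gamma>) l \<Delta> U L'" by (auto simp: ctx_red_def)
  then have "wtyped l \<Delta> U L'" by (rule wtyp_imp_wtyped[OF _ equalityD1[OF dom]])
  then have "w_derivable l \<Gamma> U" using \<Delta>(1) by (auto simp: w_derivable_def)
  moreover have "\<Gamma> \<turnstile>\<^sub>s R" using strans_styped tr by (simp add: translates_def)
  ultimately have "R \<in> calW" using assms(2) tr by (auto simp: calW_def)
  then show ?thesis using R(1) tr sc_refl by blast
qed

end
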